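(* Assume: (A1) $\psi$ is proper, closed and convex, $\mathrm{dom}(F)\neq\emptyset$, and $F^\star:=\inf_x F(x)>-\infty$; (A2) $\mathbb{E}_\xi[\|\nabla f_\xi(x)-\nabla f_\xi(y)\|^2]\le L^2\|x-y\|^2$ for all $x,y\in\mathrm{dom}(F)$, with $L\in(0,\infty)$; (A3) $\mathbb{E}_\xi[\|\nabla f_\xi(x)-\nabla f(x)\|^2]\le\sigma^2$ for all $x\in\mathrm{dom}(F)$, with $\sigma\in[0,\infty)$. Let $\{x_t^{(s)}\}_{t=0,\dots,m}^{s=1,\dots,S}$ be generated by the mini-batch restarting algorithm ProxHSGD-RS (see context, with mini-batch sizes $b,\hat b\in\mathbb{N}_+$ and initial batch size $\tilde b\in\mathbb{N}_+$ at every stage, $\hat b\le\tilde b(m+1)$) applied to $\min_xF(x)$ from $\overline{x}^{(0)}$ with $\eta_t=\eta\in(0,\frac1L)$, $\delta:=\frac2\eta-2L>0$, $\beta:=1-\frac{\hat b^{1/2}}{[\tilde b(m+1)]^{1/2}}$, and $$\gamma_m:=\frac\delta L,\qquad \gamma_t:=\frac{\delta b}{Lb+L(1+L^2\eta^2)\big[\beta^2\gamma_{t+1}+\beta^4\gamma_{t+2}+\cdots+\beta^{2(m-t)}\gamma_m\big]},\quad t=0,\dots,m-1,$$ where $\eta$ is such that $\gamma_t\in(0,1]$ for all $t$ (i.e. $\delta\le L$). Let $\Sigma_m:=\sum_{t=0}^m\gamma_t$. Then: (a) If $\overline{x}_T$ is chosen at random from the iterates $x_t^{(s)}$ with $\mathbb{P}(\overline{x}_T=x_t^{(s)})=\frac{\gamma_t}{S\Sigma_m}$,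 then $$\mathbb{E}\big[\|\mathcal{G}_\eta(\overline{x}_T)\|^2\big]\le\frac{8\sqrt2\Big[\hat b^{1/4}b^{1/2}L+[\tilde b(m+1)]^{1/4}\sqrt{L\delta}\Big]}{L\eta^2\delta S(m+1)\hat b^{1/4}b^{1/2}}\big[F(\overline{x}^{(0)})-F^\star\big]+\frac{8\sigma^2}{L^2\eta^2[\hat b\tilde b(m+1)]^{1/2}}.$$ (b) Given $\varepsilon>0$ and $c_1>\frac1{m+1}$, choose $\hat b=b\in\mathbb{N}_+$ with $1\le b\le\frac{2\sqrt{6\delta}}{L\sqrt L\,\eta\varepsilon}$, and $$\tilde b:=\frac{24c_1}{L^2\eta^2\varepsilon^2}\max\{\sigma^2,1\},\qquad m+1:=\frac{24}{c_1L^2\eta^2b\varepsilon^2}\max\{\sigma^2,1\}.$$ Then the total number of iterations $T$ needed to achieve $\mathbb{E}[\|\mathcal{G}_\eta(\overline{x}_T)\|^2]\le\varepsilon^2$ is at most $$T:=(m+1)S=\Big\lfloor\frac{96\sqrt3\max\{1,\sigma\}}{\eta^3L\sqrt{L\delta}\,b\,\varepsilon^3}\big[F(\overline{x}^{(0)})-F^\star\big]\Big\rfloor.$$ This is also the total number of proximal operations $\mathrm{prox}_{\eta\psi}$. The total number of stochastic gradient evaluations is at most $$\mathcal{T}_{\nabla f}:=\Big\lfloor(c_1^2+3)\frac{96\sqrt3\max\{1,\sigma\}}{\eta^3L\sqrt{L\delta}\,\varepsilon^3}\big[F(\overline{x}^{(0)})-F^\star\big]\Big\rfloor.$$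
   Context: Problem: minimize $F(x):=f(x)+\psi(x)$ over $x\in\mathbb{R}^p$, where $f(x)=\mathbb{E}_{\xi\sim\mathbb{P}}[f_\xi(x)]$, each $f_\xi:\mathbb{R}^p\to\mathbb{R}$ is smooth (possibly nonconvex), stochastic gradients are unbiased ($\mathbb{E}_\xi[\nabla f_\xi(x)]=\nabla f(x)$), and $\psi:\mathbb{R}^p\to\mathbb{R}\cup\{+\infty\}$. Proximal operator: $\mathrm{prox}_{\eta\psi}(x):=\arg\min_u\{\eta\psi(u)+\frac12\|u-x\|^2\}$. Gradient mapping: $\mathcal{G}_\eta(x):=\frac1\eta\big(x-\mathrm{prox}_{\eta\psi}(x-\eta\nabla f(x))\big)$. Mini-batch ProxHSGD (started from a point $x_0\in\mathrm{dom}(F)$): compute $\hat v_0:=\frac1{\tilde b}\sum_{\tilde\xi_i\in\widetilde{\mathcal{B}}}\nabla f_{\tilde\xi_i}(x_0)$ with $\widetilde{\mathcal B}$ a fresh batch of $\tilde b$ i.i.d. samples of $\xi$; set $\widehat{x}_1:=\mathrm{prox}_{\eta\psi}(x_0-\eta\hat v_0)$ and $x_1:=(1-\gamma_0)x_0+\gamma_0\widehat{x}_1$. For $t=1,\dots,m$: draw independent mini-batches $\mathcal{B}_t$ (of $b$ i.i.d. samples of $\xi$) and $\hat{\mathcal{B}}_t$ (of $\hat b$ i.i.d. samples of $\xi$), independent of the past; set $$\hat v_t:=\beta\hat v_{t-1}+\frac{\beta}{b}\sum_{\xi_t\in\mathcal{B}_t}\big(\nabla f_{\xi_t}(x_t)-\nabla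 f_{\xi_t}(x_{t-1})\big)+\frac{1-\beta}{\hat b}\sum_{\zeta_t\in\hat{\mathcal{B}}_t}\nabla f_{\zeta_t}(x_t);$$ set $\widehat{x}_{t+1}:=\mathrm{prox}_{\eta\psi}(x_t-\eta\hat v_t)$ and $x_{t+1}:=(1-\gamma_t)x_t+\gamma_t\widehat{x}_{t+1}$ (with $\gamma_t\in(0,1]$). Mini-batch ProxHSGD-RS: given $\overline{x}^{(0)}\in\mathrm{dom}(F)$, for $s=1,\dots,S$ run mini-batch ProxHSGD from $x_0^{(s)}:=\overline{x}^{(s-1)}$, producing $x_0^{(s)},\dots,x_{m+1}^{(s)}$, and set $\overline{x}^{(s)}:=x_{m+1}^{(s)}$. $\mathbb{E}[\cdot]$ is expectation over all randomness, including the independent random choice of $\overline{x}_T$. Convention on counts in (b): integer rounding is ignored, i.e. $\tilde b$, $m+1$ and $S$ are identified with real numbers; the number of stochastic gradient evaluations is counted as $[\tilde b+3b(m+1)]S$ and the number of proximal operations as $(m+1)S$, where $S$ is the number of stages needed. *)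

theory Defs
  imports "HOL-Probability.Probability"
begin

definition grad :: "('a::euclidean_space \<Rightarrow> real) \<Rightarrow> 'a \<Rightarrow> 'a" where
  "grad g x = (THE d. GDERIV g x :> d)"

definition C1_fun :: "('a::euclidean_space \<Rightarrow> real) \<Rightarrow> bool" where
  "C1_fun g \<longleftrightarrow> (\<forall>x. g differentiable (at x)) \<and> continuous_on UNIV (grad g)"

definition edom :: "('a \<Rightarrow> ereal) \<Rightarrow> 'a set" where
  "edom h = {x. h x < \<infinity>}"

definition eepigraph :: "('a \<Rightarrow> ereal) \<Rightarrow> ('a \<times> real) set" where
  "eepigraph h = {(x, r). h x \<le> ereal r}"

definition proper_fun :: "('a \<Rightarrow> ereal) \<Rightarrow> bool" where
  "proper_fun h \<longleftrightarrow> (\<forall>x. h x \<noteq> -\<infinity>) \<and> edom h \<noteq> {}"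

definition closed_fun :: "('a::euclidean_space \<Rightarrow> ereal) \<Rightarrow> bool" where
  "closed_fun h \<longleftrightarrow> closed (eepigraph h)"

definition convex_fun :: "('a::euclidean_space \<Rightarrow> ereal) \<Rightarrow> bool" where
  "convex_fun h \<longleftrightarrow> convex (eepigraph h)"

definition prox :: "real \<Rightarrow> ('a::euclidean_space \<Rightarrow> ereal) \<Rightarrow> 'a \<Rightarrow> 'a" where
  "prox \<eta> \<psi> x = (ARG_MIN (\<lambda>u. ereal \<eta> * \<psi> u + ereal (1/2 * (norm (u - x))\<^sup>2)) u. True)"

definition grad_map ::
    "('a::euclidean_space \<Rightarrow> real) \<Rightarrow> ('a \<Rightarrow> ereal) \<Rightarrow> real \<Rightarrow> 'a \<Rightarrow> 'a" where
  "grad_map f \<psi> \<eta> x = (1/\<eta>) *\<^sub>R (x - prox \<eta> \<psi> (x - \<eta> *\<^sub>R grad f x))"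

text \<open>Labels of the individual samples: \<open>Init s i\<close> belongs to the initial batch (size \<open>bt\<close>)
  of stage \<open>s\<close>; in iteration \<open>t\<close> of stage \<open>s\<close>, \<open>Diff s t i\<close> belongs to the batch used for
  gradient differences (size \<open>b\<close>) and \<open>Fresh s t i\<close> to the other, independent one (size \<open>bh\<close>).\<close>

datatype sample_label = Init nat nat | Diff nat nat nat | Fresh nat nat nat

definition sample_labels :: "nat \<Rightarrow> nat \<Rightarrow> nat \<Rightarrow> nat \<Rightarrow> nat \<Rightarrow> sample_label set" where
  "sample_labels S m bt b bh =
     {Init s i | s i. s \<in> {1..S} \<and> i < bt} \<union>
     {Diff s t i | s t i. s \<in> {1..S} \<and> t \<in> {1..m} \<and> i < b} \<union>
     {Fresh s t i | s t i. s \<in> {1..S} \<and> t \<in> {1..m} \<and> i < bh}"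

text \<open>Iterates \<open>x\<^sub>t\<close> and estimators \<open>v\<^sub>t\<close> of stage \<open>s\<close> started at \<open>x0\<close>, for a fixed
  realization \<open>Z\<close> of all samples.\<close>

fun hsgd_x :: "('z \<Rightarrow> 'a::euclidean_space \<Rightarrow> real) \<Rightarrow> ('a \<Rightarrow> ereal) \<Rightarrow> real \<Rightarrow> real \<Rightarrow> (nat \<Rightarrow> real)
      \<Rightarrow> nat \<Rightarrow> nat \<Rightarrow> nat \<Rightarrow> (sample_label \<Rightarrow> 'z) \<Rightarrow> nat \<Rightarrow> 'a \<Rightarrow> nat \<Rightarrow> 'a"
  and hsgd_v :: "('z \<Rightarrow> 'a \<Rightarrow> real) \<Rightarrow> ('a \<Rightarrow> ereal) \<Rightarrow> real \<Rightarrow> real \<Rightarrow> (nat \<Rightarrow> real)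
      \<Rightarrow> nat \<Rightarrow> nat \<Rightarrow> nat \<Rightarrow> (sample_label \<Rightarrow> 'z) \<Rightarrow> nat \<Rightarrow> 'a \<Rightarrow> nat \<Rightarrow> 'a"
where
  "hsgd_x fs \<psi> \<eta> \<beta> \<gamma> bt b bh Z s x0 0 = x0"
| "hsgd_x fs \<psi> \<eta> \<beta> \<gamma> bt b bh Z s x0 (Suc t) =
     (1 - \<gamma> t) *\<^sub>R hsgd_x fs \<psi> \<eta> \<beta> \<gamma> bt b bh Z s x0 t
     + \<gamma> t *\<^sub>R prox \<eta> \<psi> (hsgd_x fs \<psi> \<eta> \<beta> \<gamma> bt b bh Z s x0 t
                           - \<eta> *\<^sub>R hsgd_v fs \<psi> \<eta> \<beta> \<gamma> bt b bh Z s x0 t)"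
| "hsgd_v fs \<psi> \<eta> \<beta> \<gamma> bt b bh Z s x0 0 =
     (1 / real bt) *\<^sub>R (\<Sum>i<bt. grad (fs (Z (Init s i))) x0)"
| "hsgd_v fs \<psi> \<eta> \<beta> \<gamma> bt b bh Z s x0 (Suc t) =
     \<beta> *\<^sub>R hsgd_v fs \<psi> \<eta> \<beta> \<gamma> bt b bh Z s x0 t
     + (\<beta> / real b) *\<^sub>R (\<Sum>i<b. grad (fs (Z (Diff s (Suc t) i)))
                                   (hsgd_x fs \<psi> \<eta> \<beta> \<gamma> bt b bh Z s x0 (Suc t))
                               - grad (fs (Z (Diff s (Suc t) i)))
                                   (hsgd_x fs \<psi> \<eta> \<beta> \<gamma> bt b bh Z s x0 t))
     + ((1 - \<beta>) / real bh) *\<^sub>R (\<Sum>i<bh. grad (fs (Z (Fresh s (Suc t) i)))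
                                   (hsgd_x fs \<psi> \<eta> \<beta> \<gamma> bt b bh Z s x0 (Suc t)))"

primrec rs_xbar :: "('z \<Rightarrow> 'a::euclidean_space \<Rightarrow> real) \<Rightarrow> ('a \<Rightarrow> ereal) \<Rightarrow> real \<Rightarrow> real
      \<Rightarrow> (nat \<Rightarrow> real) \<Rightarrow> nat \<Rightarrow> nat \<Rightarrow> nat \<Rightarrow> nat \<Rightarrow> (sample_label \<Rightarrow> 'z) \<Rightarrow> 'a \<Rightarrow> nat \<Rightarrow> 'a"
where
  "rs_xbar fs \<psi> \<eta> \<beta> \<gamma> m bt b bh Z xb0 0 = xb0"
| "rs_xbar fs \<psi> \<eta> \<beta> \<gamma> m bt b bh Z xb0 (Suc s) =
     hsgd_x fs \<psi> \<eta> \<beta> \<gamma> bt b bh Z (Suc s) (rs_xbar fs \<psi> \<eta> \<beta> \<gamma> m bt b bh Z xb0 s) (m + 1)"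

text \<open>The iterate with stage index \<open>s \<ge> 1\<close> and inner index \<open>t\<close>.\<close>

definition rs_iterate :: "('z \<Rightarrow> 'a::euclidean_space \<Rightarrow> real) \<Rightarrow> ('a \<Rightarrow> ereal) \<Rightarrow> real \<Rightarrow> real
      \<Rightarrow> (nat \<Rightarrow> real) \<Rightarrow> nat \<Rightarrow> nat \<Rightarrow> nat \<Rightarrow> nat \<Rightarrow> (sample_label \<Rightarrow> 'z) \<Rightarrow> 'a \<Rightarrow> nat \<Rightarrow> nat \<Rightarrow> 'a"
where
  "rs_iterate fs \<psi> \<eta> \<beta> \<gamma> m bt b bh Z xb0 s t =
     hsgd_x fs \<psi> \<eta> \<beta> \<gamma> bt b bh Z s (rs_xbar fs \<psi> \<eta> \<beta> \<gamma> m bt b bh Z xb0 (s - 1)) t"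

text \<open>Operation counts. The number of stages is a real number here, since integer rounding of
  the number of stages is ignored when complexities are counted.\<close>

definition num_prox :: "nat \<Rightarrow> real \<Rightarrow> real" where
  "num_prox m S = (real m + 1) * S"

definition num_grad :: "nat \<Rightarrow> nat \<Rightarrow> nat \<Rightarrow> real \<Rightarrow> real" where
  "num_grad bt b m S = (real bt + 3 * real b * (real m + 1)) * S"

end

theory Submission
  imports Defs
begin

text \<open>
  One proximal step with an estimator of error \<open>e\<close> and displacement \<open>d\<close> decreases \<open>F\<close> by
  \<open>L \<eta>\<^sup>2 \<gamma> \<bar>G\<bar>\<^sup>2 / 4 + \<gamma> (\<delta> - L \<gamma>) \<bar>d\<bar>\<^sup>2 / 2 - (1 + L\<^sup>2 \<eta>\<^sup>2) \<gamma> \<bar>e\<bar>\<^sup>2 / (2 L)\<close>.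
  Telescoping this pathwise over all stages needs no integrability of \<open>F\<close>. Adding the fresh
  samples one at a time, independence gives the recursion of \<open>E \<bar>e\<bar>\<^sup>2\<close> with contraction \<open>\<beta>\<^sup>2\<close>,
  and the weights \<open>\<gamma>\<close> are exactly those for which the accumulated \<open>\<bar>d\<bar>\<^sup>2\<close> terms cancel.

  Writing \<open>\<gamma>\<^sub>t = (\<delta> / L) / (1 + y\<^sub>m\<^sub>-\<^sub>t)\<close>, the damping sequence \<open>y\<close> satisfies
  \<open>y' = \<beta>\<^sup>2 (y + \<kappa> / (1 + y))\<close> with \<open>\<kappa> \<le> 3/2\<close>. The weights need not increase in \<open>t\<close>, but
  \<open>\<gamma>\<^sub>s \<le> (1 + 2 \<beta>) \<gamma>\<^sub>t\<close> for \<open>s \<le> t\<close>, and Chebyshev's sum inequality with this loss still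
  yields the stated noise term. The bound on \<open>y\<close> makes the first term of (a) hold with half the
  stated constant; this spare factor 2 absorbs the rounding in (b), where the number of iterations
  is only known to be at least the floor of the real threshold.
\<close>

section \<open>Gradients and the proximal operator\<close>

lemma GDERIV_grad:
  fixes g :: "'a::euclidean_space \<Rightarrow> real"
  assumes "g differentiable (at x)"
  shows "GDERIV g x :> grad g x"
proof -
  obtain g' where g': "(g has_derivative g') (at x)"
    using assms by (auto simp: differentiable_def)
  then have "linear g'" by (rule has_derivative_linear)
  then have "g' = (\<lambda>h. inner h (adjoint g' 1))"
    using adjoint_works[of g' _ 1] by (simp add: fun_eq_iff)
  with g' have adjoint: "GDERIV g x :> adjoint g' 1" by (simp add: gderiv_def)
  moreover have "d = adjoint g' 1" if "GDERIV g x :> d" for d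
  proof -
    have "inner h d = inner h (adjoint g' 1)" for h
      using has_derivative_unique[of g "\<lambda>h. inner h d" x "\<lambda>h. inner h (adjoint g' 1)"] that adjoint
      by (simp add: gderiv_def fun_eq_iff)
    then show ?thesis by (metis inner_commute vector_eq_ldot)
  qed
  ultimately show ?thesis unfolding grad_def by (rule theI)
qed

lemma GDERIV_imp_DERIV_along_line:
  fixes f :: "'a::real_inner \<Rightarrow> real"
  assumes "GDERIV f (x + t *\<^sub>R h) :> d"
  shows "((\<lambda>t. f (x + t *\<^sub>R h)) has_real_derivative inner d h) (at t)"
proof -
  have "(f has_derivative (\<lambda>k. inner k d)) (at (x + t *\<^sub>R h))"
    using assms by (simp add: gderiv_def)
  moreover have "((\<lambda>t. x + t *\<^sub>R h) has_derivative (\<lambda>s. s *\<^sub>R h)) (at t)"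
    by (auto intro!: derivative_eq_intros)
  ultimately have "((\<lambda>t. f (x + t *\<^sub>R h)) has_derivative (\<lambda>s. inner (s *\<^sub>R h) d)) (at t)"
    using diff_chain_at[of "\<lambda>t. x + t *\<^sub>R h" "\<lambda>s. s *\<^sub>R h" t f] by (fastforce simp: o_def)
  then show ?thesis
    by (simp add: has_field_derivative_def inner_commute mult_commute_abs)
qed

lemma lipschitz_grad_imp_quadratic_upper_bound:
  fixes f :: "'a::euclidean_space \<Rightarrow> real"
  assumes D: "convex D" "x \<in> D" "y \<in> D"
    and diff: "\<And>z. z \<in> D \<Longrightarrow> f differentiable (at z)"
    and lipschitz: "\<And>y z. y \<in> D \<Longrightarrow> z \<in> D \<Longrightarrow> norm (grad f y - grad f z) \<le> L * norm (y - z)"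
  shows "f y \<le> f x + inner (grad f x) (y - x) + L / 2 * (norm (y - x))\<^sup>2"
proof -
  define h where "h = y - x"
  let ?gap = "\<lambda>t. f (x + t *\<^sub>R h) - t * inner (grad f x) h - L * t\<^sup>2 / 2 * (norm h)\<^sup>2"
  have "?gap 1 \<le> ?gap 0"
  proof (rule DERIV_nonpos_imp_nonincreasing[where f = ?gap and a = 0 and b = 1])
    fix t :: real assume t: "0 \<le> t" "t \<le> 1"
    let ?z = "x + t *\<^sub>R h"
    have "?z = (1 - t) *\<^sub>R x + t *\<^sub>R y" by (simp add: h_def algebra_simps)
    then have z: "?z \<in> D" using D t by (simp add: convexD)
    have deriv: "(?gap has_real_derivative
        (inner (grad f ?z) h - inner (grad f x) h - L * t * (norm h)\<^sup>2)) (at t)"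
      using GDERIV_imp_DERIV_along_line[OF GDERIV_grad[OF diff[OF z]]]
      by (auto intro!: derivative_eq_intros)
    have "inner (grad f ?z - grad f x) h \<le> norm (grad f ?z - grad f x) * norm h"
      by (rule norm_cauchy_schwarz)
    also have "\<dots> \<le> (L * norm (?z - x)) * norm h"
      using lipschitz[OF z D(2)] by (rule mult_right_mono) simp
    finally have "inner (grad f ?z) h - inner (grad f x) h \<le> L * t * (norm h)\<^sup>2"
      using t by (simp add: inner_diff_left power2_eq_square)
    with deriv show "\<exists>d. (?gap has_real_derivative d) (at t) \<and> d \<le> 0" by force
  qed simp
  then show ?thesis by (simp add: h_def)
qed

lemma edom_ereal_add: "edom (\<lambda>x. ereal (f x) + \<psi> x) = edom \<psi>"
proof -
  have "ereal (f x) + \<psi> x < \<infinity> \<longleftrightarrow> \<psi> x < \<infinity>" for x by (cases "\<psi> x") auto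
  then show ?thesis by (simp add: edom_def)
qed

locale closed_proper_convex =
  fixes \<psi> :: "'a::euclidean_space \<Rightarrow> ereal"
  assumes proper: "proper_fun \<psi>" and closed: "closed_fun \<psi>" and convex: "convex_fun \<psi>"
begin

abbreviation \<psi>\<^sub>r :: "'a \<Rightarrow> real" where "\<psi>\<^sub>r u \<equiv> real_of_ereal (\<psi> u)"

lemma ereal_\<psi>\<^sub>r: "u \<in> edom \<psi> \<Longrightarrow> \<psi> u = ereal (\<psi>\<^sub>r u)"
  using proper by (cases "\<psi> u") (auto simp: proper_fun_def edom_def)

lemma ereal_add_\<psi>: "u \<in> edom \<psi> \<Longrightarrow> ereal c + \<psi> u = ereal (c + \<psi>\<^sub>r u)"
  by (subst ereal_\<psi>\<^sub>r) simp_all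

lemma mem_eepigraph_iff: "(u, r) \<in> eepigraph \<psi> \<longleftrightarrow> u \<in> edom \<psi> \<and> \<psi>\<^sub>r u \<le> r"
proof -
  have "\<psi> u \<noteq> -\<infinity>" using proper by (simp add: proper_fun_def)
  then show ?thesis by (cases "\<psi> u") (auto simp: eepigraph_def edom_def)
qed

lemma edom_nonempty: obtains u where "u \<in> edom \<psi>"
  using proper by (auto simp: proper_fun_def)

lemma finite_infimum_composite:
  assumes "- \<infinity> < (INF x. ereal (f x) + \<psi> x)"
  obtains c where "(INF x. ereal (f x) + \<psi> x) = ereal c"
    and "\<And>x. x \<in> edom \<psi> \<Longrightarrow> c \<le> f x + \<psi>\<^sub>r x"
proof -
  have le: "(INF x. ereal (f x) + \<psi> x) \<le> ereal (f x + \<psi>\<^sub>r x)" if "x \<in> edom \<psi>" for x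
    using INF_lower[of x UNIV "\<lambda>x. ereal (f x) + \<psi> x"] by (simp add: ereal_add_\<psi> that)
  obtain u where "u \<in> edom \<psi>" by (rule edom_nonempty)
  from le[OF this] obtain c where c: "(INF x. ereal (f x) + \<psi> x) = ereal c"
    using assms by (cases "INF x. ereal (f x) + \<psi> x") auto
  moreover have "c \<le> f x + \<psi>\<^sub>r x" if "x \<in> edom \<psi>" for x using le[OF that] by (simp add: c)
  ultimately show ?thesis by (rule that)
qed

lemma
  assumes "u \<in> edom \<psi>" "v \<in> edom \<psi>" "0 \<le> t" "t \<le> 1"
  shows convex_combination_in_edom: "(1 - t) *\<^sub>R u + t *\<^sub>R v \<in> edom \<psi>"
    and convex_combination_le: "\<psi>\<^sub>r ((1 - t) *\<^sub>R u + t *\<^sub>R v) \<le> (1 - t) * \<psi>\<^sub>r u + t * \<psi>\<^sub>r v"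
proof -
  have "(1 - t) *\<^sub>R (u, \<psi>\<^sub>r u) + t *\<^sub>R (v, \<psi>\<^sub>r v) \<in> eepigraph \<psi>"
    using convex assms unfolding convex_fun_def
    by (intro convexD) (auto simp: mem_eepigraph_iff)
  then show "(1 - t) *\<^sub>R u + t *\<^sub>R v \<in> edom \<psi>"
    and "\<psi>\<^sub>r ((1 - t) *\<^sub>R u + t *\<^sub>R v) \<le> (1 - t) * \<psi>\<^sub>r u + t * \<psi>\<^sub>r v"
    by (auto simp: mem_eepigraph_iff)
qed

lemma convex_edom: "Convex.convex (edom \<psi>)"
  unfolding convex_alt using convex_combination_in_edom by auto

lemma affine_minorant:
  obtains c a where "\<And>u. u \<in> edom \<psi> \<Longrightarrow> c - inner a u \<le> \<psi>\<^sub>r u"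
proof -
  obtain u0 where u0: "u0 \<in> edom \<psi>" by (rule edom_nonempty)
  have "(u0, \<psi>\<^sub>r u0 - 1) \<notin> eepigraph \<psi>" by (simp add: mem_eepigraph_iff)
  then obtain w :: "'a \<times> real" and c where below: "inner w (u0, \<psi>\<^sub>r u0 - 1) < c"
    and above: "\<And>z. z \<in> eepigraph \<psi> \<Longrightarrow> c < inner w z"
    using separating_hyperplane_closed_point[of "eepigraph \<psi>" "(u0, \<psi>\<^sub>r u0 - 1)"] closed convex
    unfolding closed_fun_def convex_fun_def by blast
  obtain a \<rho> where w: "w = (a, \<rho>)" by (cases w)
  have above_plane: "c < inner a u + \<rho> * \<psi>\<^sub>r u" if "u \<in> edom \<psi>" for u
    using above[of "(u, \<psi>\<^sub>r u)"] that by (simp add: mem_eepigraph_iff w)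
  with u0 below have \<rho>: "\<rho> > 0" by (force simp: w algebra_simps)
  show ?thesis
  proof (rule that)
    fix u assume "u \<in> edom \<psi>"
    then have "c / \<rho> < inner a u / \<rho> + \<psi>\<^sub>r u" using above_plane \<rho> by (simp add: field_simps)
    then show "c / \<rho> - inner (a /\<^sub>R \<rho>) u \<le> \<psi>\<^sub>r u" using \<rho> by (simp add: field_simps)
  qed
qed

definition prox_objective :: "real \<Rightarrow> 'a \<Rightarrow> 'a \<Rightarrow> real" where
  "prox_objective \<eta> x u = \<eta> * \<psi>\<^sub>r u + (norm (u - x))\<^sup>2 / 2"

lemma bounded_epigraph_prox_sublevel:
  assumes \<eta>: "\<eta> > 0"
  shows "bounded {w \<in> eepigraph \<psi>. \<eta> * snd w + (norm (fst w - x))\<^sup>2 / 2 \<le> q}" (is "bounded ?K")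
proof -
  obtain c a where minorant: "\<And>u. u \<in> edom \<psi> \<Longrightarrow> c - inner a u \<le> \<psi>\<^sub>r u"
    using affine_minorant by blast
  define C where "C = 2 * (q - \<eta> * c) + (norm (x + \<eta> *\<^sub>R a))\<^sup>2 - (norm x)\<^sup>2"
  define R where "R = norm (x + \<eta> *\<^sub>R a) + sqrt C"
  have "u \<in> cball 0 R \<and> r \<in> {c - norm a * R .. q / \<eta>}"
    if epi: "(u, r) \<in> eepigraph \<psi>" and le_q: "\<eta> * r + (norm (u - x))\<^sup>2 / 2 \<le> q" for u r
  proof -
    have r_ge: "c - inner a u \<le> r"
      using minorant[of u] epi by (auto simp: mem_eepigraph_iff)
    then have "\<eta> * (c - inner a u) \<le> \<eta> * r" using \<eta> by simp
    with le_q have "(norm (u - x))\<^sup>2 \<le> 2 * (q - \<eta> * c + \<eta> * inner a u)"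
      by (simp add: algebra_simps)
    moreover have "(norm (u - (x + \<eta> *\<^sub>R a)))\<^sup>2 =
        (norm (u - x))\<^sup>2 - 2 * \<eta> * inner a u + (norm (x + \<eta> *\<^sub>R a))\<^sup>2 - (norm x)\<^sup>2"
      unfolding power2_norm_eq_inner by (simp add: algebra_simps inner_commute)
    ultimately have "(norm (u - (x + \<eta> *\<^sub>R a)))\<^sup>2 \<le> C"
      unfolding C_def by (simp add: algebra_simps)
    then have "norm (u - (x + \<eta> *\<^sub>R a)) \<le> sqrt C" by (rule real_le_rsqrt)
    then have u_le: "norm u \<le> R"
      unfolding R_def using norm_triangle_sub[of u "x + \<eta> *\<^sub>R a"] by linarith
    have "\<eta> * r \<le> q" using le_q zero_le_power2[of "norm (u - x)"] by linarith
    then have "r \<le> q / \<eta>" using \<eta> by (simp add: field_simps)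
    moreover have "inner a u \<le> norm a * R"
      using norm_cauchy_schwarz[of a u] mult_left_mono[OF u_le norm_ge_zero[of a]] by linarith
    ultimately show ?thesis using r_ge u_le by simp
  qed
  then have "?K \<subseteq> cball 0 R \<times> {c - norm a * R .. q / \<eta>}" by force
  then show ?thesis
    by (rule bounded_subset[rotated]) (intro bounded_Times bounded_cball bounded_closed_interval)
qed

lemma prox_objective_attains_min:
  assumes \<eta>: "\<eta> > 0"
  obtains u where "u \<in> edom \<psi>"
    and "\<And>v. v \<in> edom \<psi> \<Longrightarrow> prox_objective \<eta> x u \<le> prox_objective \<eta> x v"
proof -
  obtain u0 where u0: "u0 \<in> edom \<psi>" by (rule edom_nonempty)
  let ?q = "\<lambda>w. \<eta> * snd w + (norm (fst w - x))\<^sup>2 / 2"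
  let ?K = "{w \<in> eepigraph \<psi>. ?q w \<le> prox_objective \<eta> x u0}"
  have "Topological_Spaces.closed (eepigraph \<psi> \<inter> {w. ?q w \<le> prox_objective \<eta> x u0})"
    using closed unfolding closed_fun_def
    by (intro closed_Int closed_Collect_le continuous_intros) auto
  then have "compact ?K"
    using bounded_epigraph_prox_sublevel[OF \<eta>, of x "prox_objective \<eta> x u0"]
    by (simp add: compact_eq_bounded_closed Collect_conj_eq)
  moreover have "(u0, \<psi>\<^sub>r u0) \<in> ?K" using u0 by (simp add: mem_eepigraph_iff prox_objective_def)
  moreover have "continuous_on ?K ?q" by (intro continuous_intros) simp
  ultimately obtain w where w: "w \<in> ?K" and w_min: "\<And>w'. w' \<in> ?K \<Longrightarrow> ?q w \<le> ?q w'"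
    using continuous_attains_inf[of ?K ?q] by force
  obtain u r where ur: "w = (u, r)" by (cases w)
  have u: "u \<in> edom \<psi>" "\<psi>\<^sub>r u \<le> r" using w by (auto simp: ur mem_eepigraph_iff)
  have "prox_objective \<eta> x u \<le> prox_objective \<eta> x v" if v: "v \<in> edom \<psi>" for v
  proof -
    have "prox_objective \<eta> x u \<le> ?q w" using u(2) \<eta> by (simp add: prox_objective_def ur)
    also have "\<dots> \<le> prox_objective \<eta> x v"
    proof (cases "prox_objective \<eta> x v \<le> prox_objective \<eta> x u0")
      case True
      then show ?thesis
        using w_min[of "(v, \<psi>\<^sub>r v)"] v by (simp add: mem_eepigraph_iff prox_objective_def)
    qed (use w in simp)
    finally show ?thesis .
  qed
  with u(1) show ?thesis by (rule that)
qed

lemma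
  assumes \<eta>: "\<eta> > 0"
  shows prox_in_edom: "prox \<eta> \<psi> x \<in> edom \<psi>"
    and prox_objective_prox_le:
      "v \<in> edom \<psi> \<Longrightarrow> prox_objective \<eta> x (prox \<eta> \<psi> x) \<le> prox_objective \<eta> x v"
proof -
  let ?obj = "\<lambda>u. ereal \<eta> * \<psi> u + ereal (1/2 * (norm (u - x))\<^sup>2)"
  have finite: "?obj u = ereal (prox_objective \<eta> x u)" if "u \<in> edom \<psi>" for u
    by (subst ereal_\<psi>\<^sub>r[OF that]) (simp add: prox_objective_def)
  have infinite: "?obj u = \<infinity>" if "u \<notin> edom \<psi>" for u
    using that \<eta> by (simp add: edom_def)
  obtain u where u: "u \<in> edom \<psi>"
    and u_min: "\<And>v. v \<in> edom \<psi> \<Longrightarrow> prox_objective \<eta> x u \<le> prox_objective \<eta> x v"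
    using prox_objective_attains_min[OF \<eta>, of x] by blast
  have "?obj u \<le> ?obj v" for v
    using finite[OF u] finite[of v] infinite[of v] u_min[of v] by (cases "v \<in> edom \<psi>") auto
  then have "is_arg_min ?obj (\<lambda>_. True) u" by (simp add: is_arg_min_linorder)
  then have "is_arg_min ?obj (\<lambda>_. True) (prox \<eta> \<psi> x)"
    unfolding prox_def arg_min_def by (rule someI)
  then have min: "?obj (prox \<eta> \<psi> x) \<le> ?obj v" for v by (simp add: is_arg_min_linorder)
  show dom: "prox \<eta> \<psi> x \<in> edom \<psi>"
  proof (rule ccontr)
    assume "prox \<eta> \<psi> x \<notin> edom \<psi>"
    from min[of u] show False
      unfolding infinite[OF \<open>prox \<eta> \<psi> x \<notin> edom \<psi>\<close>] finite[OF u] by simp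
  qed
  show "prox_objective \<eta> x (prox \<eta> \<psi> x) \<le> prox_objective \<eta> x v" if "v \<in> edom \<psi>"
    using min[of v] unfolding finite[OF that] finite[OF dom] by simp
qed

lemma prox_variational_inequality:
  assumes \<eta>: "\<eta> > 0" and u: "u \<in> edom \<psi>"
  shows "\<eta> * \<psi>\<^sub>r (prox \<eta> \<psi> x) + inner (x - prox \<eta> \<psi> x) (u - prox \<eta> \<psi> x) \<le> \<eta> * \<psi>\<^sub>r u"
proof -
  define z where "z = prox \<eta> \<psi> x"
  have z: "z \<in> edom \<psi>" unfolding z_def by (rule prox_in_edom[OF \<eta>])
  define gap where "gap = \<eta> * \<psi>\<^sub>r u - \<eta> * \<psi>\<^sub>r z - inner (x - z) (u - z)"
  have gap_perturbed: "0 \<le> gap + t * ((norm (u - z))\<^sup>2 / 2)" if t: "0 < t" "t \<le> 1" for t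
  proof -
    let ?w = "(1 - t) *\<^sub>R z + t *\<^sub>R u"
    have w: "?w \<in> edom \<psi>" "\<psi>\<^sub>r ?w \<le> (1 - t) * \<psi>\<^sub>r z + t * \<psi>\<^sub>r u"
      using convex_combination_in_edom[OF z u, of t] convex_combination_le[OF z u, of t] t by auto
    have "\<eta> * \<psi>\<^sub>r z + (norm (z - x))\<^sup>2 / 2 \<le> \<eta> * \<psi>\<^sub>r ?w + (norm (?w - x))\<^sup>2 / 2"
      using prox_objective_prox_le[OF \<eta> w(1), of x] by (simp only: prox_objective_def z_def)
    also have "\<dots> \<le> \<eta> * ((1 - t) * \<psi>\<^sub>r z + t * \<psi>\<^sub>r u) + (norm (?w - x))\<^sup>2 / 2"
      using w(2) \<eta> by simp
    also have "(norm (?w - x))\<^sup>2 =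
        (norm (z - x))\<^sup>2 - 2 * t * inner (x - z) (u - z) + t\<^sup>2 * (norm (u - z))\<^sup>2"
      unfolding power2_norm_eq_inner by (simp add: algebra_simps inner_commute power2_eq_square)
    finally have "0 \<le> \<eta> * ((1 - t) * \<psi>\<^sub>r z + t * \<psi>\<^sub>r u) - \<eta> * \<psi>\<^sub>r z
        - t * inner (x - z) (u - z) + t\<^sup>2 * (norm (u - z))\<^sup>2 / 2" by (simp add: field_simps)
    also have "\<dots> = t * (gap + t * ((norm (u - z))\<^sup>2 / 2))"
      unfolding gap_def by algebra
    finally show ?thesis using t by (simp add: zero_le_mult_iff)
  qed
  have "0 \<le> gap"
  proof (rule tendsto_lowerbound)
    show "((\<lambda>t. gap + t * ((norm (u - z))\<^sup>2 / 2)) \<longlongrightarrow> gap) (at_right 0)"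
      by (auto intro!: tendsto_eq_intros)
    show "\<forall>\<^sub>F t in at_right 0. 0 \<le> gap + t * ((norm (u - z))\<^sup>2 / 2)"
      using gap_perturbed by (auto simp: eventually_at_right[of 0 1] intro!: exI[of _ 1])
  qed simp
  then show ?thesis by (simp add: gap_def z_def)
qed

lemma prox_nonexpansive:
  assumes \<eta>: "\<eta> > 0"
  shows "norm (prox \<eta> \<psi> x - prox \<eta> \<psi> y) \<le> norm (x - y)"
proof -
  define d where "d = prox \<eta> \<psi> x - prox \<eta> \<psi> y"
  have "inner (x - prox \<eta> \<psi> x) (- d) + inner (y - prox \<eta> \<psi> y) d \<le> 0"
    using prox_variational_inequality[OF \<eta> prox_in_edom[OF \<eta>], of x y]
      prox_variational_inequality[OF \<eta> prox_in_edom[OF \<eta>], of y x]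
    unfolding d_def minus_diff_eq by linarith
  then have "(norm d)\<^sup>2 \<le> inner (x - y) d"
    unfolding power2_norm_eq_inner d_def by (simp add: algebra_simps inner_commute)
  also have "\<dots> \<le> norm (x - y) * norm d" by (rule norm_cauchy_schwarz)
  finally have "norm d * norm d \<le> norm (x - y) * norm d" by (simp add: power2_eq_square)
  then have "norm d \<le> norm (x - y)"
    by (cases "norm d = 0") (auto dest: mult_right_le_imp_le)
  then show ?thesis by (simp add: d_def)
qed

lemma borel_measurable_prox:
  assumes "\<eta> > 0" "g \<in> borel_measurable N"
  shows "(\<lambda>w. prox \<eta> \<psi> (g w)) \<in> borel_measurable N"
proof -
  have "prox \<eta> \<psi> \<in> borel_measurable borel"
    using assms(1) by (intro borel_measurable_continuous_onI lipschitz_on_continuous_on[of 1])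
      (auto simp: lipschitz_on_def dist_norm prox_nonexpansive)
  then show ?thesis by (rule measurable_compose[OF assms(2)])
qed

definition prox_direction :: "real \<Rightarrow> 'a \<Rightarrow> 'a \<Rightarrow> 'a" where
  "prox_direction \<eta> x v = prox \<eta> \<psi> (x - \<eta> *\<^sub>R v) - x"

lemma prox_direction_step_in_edom:
  assumes "\<eta> > 0" "0 \<le> t" "t \<le> 1" "x \<in> edom \<psi>"
  shows "x + t *\<^sub>R prox_direction \<eta> x v \<in> edom \<psi>"
  using convex_combination_in_edom[OF assms(4) prox_in_edom[OF assms(1)] assms(2,3)]
  by (simp add: prox_direction_def algebra_simps)

lemma prox_direction_decrease:
  fixes x v :: 'a
  assumes \<eta>: "\<eta> > 0" and t: "0 \<le> t" "t \<le> 1" and x: "x \<in> edom \<psi>"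
  defines "d \<equiv> prox_direction \<eta> x v"
  shows "\<psi>\<^sub>r (x + t *\<^sub>R d) \<le> \<psi>\<^sub>r x - t * ((norm d)\<^sup>2 / \<eta> + inner v d)"
proof -
  define z where "z = prox \<eta> \<psi> (x - \<eta> *\<^sub>R v)"
  have d: "d = z - x" by (simp add: d_def z_def prox_direction_def)
  have z: "z \<in> edom \<psi>" unfolding z_def by (rule prox_in_edom[OF \<eta>])
  have "\<eta> * \<psi>\<^sub>r z + inner (x - \<eta> *\<^sub>R v - z) (x - z) \<le> \<eta> * \<psi>\<^sub>r x"
    unfolding z_def by (rule prox_variational_inequality[OF \<eta> x])
  moreover have "inner (x - \<eta> *\<^sub>R v - z) (x - z) = (norm d)\<^sup>2 + \<eta> * inner v d"
    unfolding power2_norm_eq_inner d by (simp add: algebra_simps inner_commute)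
  ultimately have "\<eta> * (\<psi>\<^sub>r z - \<psi>\<^sub>r x) \<le> - ((norm d)\<^sup>2 + \<eta> * inner v d)"
    by (simp add: algebra_simps)
  then have "\<psi>\<^sub>r z - \<psi>\<^sub>r x \<le> - ((norm d)\<^sup>2 / \<eta> + inner v d)" using \<eta> by (simp add: field_simps)
  then have "t * (\<psi>\<^sub>r z - \<psi>\<^sub>r x) \<le> t * - ((norm d)\<^sup>2 / \<eta> + inner v d)"
    using t by (intro mult_left_mono)
  moreover have "\<psi>\<^sub>r (x + t *\<^sub>R d) \<le> \<psi>\<^sub>r x + t * (\<psi>\<^sub>r z - \<psi>\<^sub>r x)"
    using convex_combination_le[OF x z t] by (simp add: d algebra_simps)
  ultimately show ?thesis by linarith
qed

lemma norm_prox_direction_diff_le: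
  assumes \<eta>: "\<eta> > 0"
  shows "norm (prox_direction \<eta> x v - prox_direction \<eta> y w) \<le> 2 * norm (x - y) + \<eta> * norm (v - w)"
proof -
  have "norm (prox \<eta> \<psi> (x - \<eta> *\<^sub>R v) - prox \<eta> \<psi> (y - \<eta> *\<^sub>R w)) \<le> norm ((x - y) - \<eta> *\<^sub>R (v - w))"
    using prox_nonexpansive[OF \<eta>, of "x - \<eta> *\<^sub>R v" "y - \<eta> *\<^sub>R w"] by (simp add: algebra_simps)
  also have "\<dots> \<le> norm (x - y) + \<eta> * norm (v - w)"
    using norm_triangle_ineq4[of "x - y" "\<eta> *\<^sub>R (v - w)"] \<eta> by simp
  finally show ?thesis
    using norm_triangle_ineq4[of "prox \<eta> \<psi> (x - \<eta> *\<^sub>R v) - prox \<eta> \<psi> (y - \<eta> *\<^sub>R w)" "x - y"]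
    by (simp add: prox_direction_def algebra_simps)
qed

lemma grad_map_eq_prox_direction: "grad_map f \<psi> \<eta> x = - ((1 / \<eta>) *\<^sub>R prox_direction \<eta> x (grad f x))"
  by (simp add: grad_map_def prox_direction_def algebra_simps)

end

section \<open>Second moments and independent samples\<close>

lemma norm_add_power2_le:
  fixes a c :: "'a::real_inner"
  shows "(norm (a + c))\<^sup>2 \<le> 2 * (norm a)\<^sup>2 + 2 * (norm c)\<^sup>2"
proof -
  have "(norm (a + c))\<^sup>2 + (norm (a - c))\<^sup>2 = 2 * (norm a)\<^sup>2 + 2 * (norm c)\<^sup>2"
    unfolding power2_norm_eq_inner by (simp add: algebra_simps inner_commute)
  then show ?thesis using zero_le_power2[of "norm (a - c)"] by linarith
qed

definition second_moment :: "'w measure \<Rightarrow> ('w \<Rightarrow> 'a::real_normed_vector) \<Rightarrow> ennreal" where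
  "second_moment N g = (\<integral>\<^sup>+w. ennreal ((norm (g w))\<^sup>2) \<partial>N)"

definition square_integrable :: "'w measure \<Rightarrow> ('w \<Rightarrow> 'a::euclidean_space) \<Rightarrow> bool" where
  "square_integrable N g \<longleftrightarrow> g \<in> borel_measurable N \<and> second_moment N g < \<infinity>"

lemma second_moment_scaleR:
  fixes g :: "'w \<Rightarrow> 'a::euclidean_space"
  assumes [measurable]: "g \<in> borel_measurable N"
  shows "second_moment N (\<lambda>w. c *\<^sub>R g w) = ennreal (c\<^sup>2) * second_moment N g"
  unfolding second_moment_def
  by (subst nn_integral_cmult[symmetric]) (simp_all add: power_mult_distrib ennreal_mult)

lemma second_moment_add_le:
  fixes g h :: "'w \<Rightarrow> 'a::euclidean_space"
  assumes [measurable]: "g \<in> borel_measurable N" "h \<in> borel_measurable N"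
  shows "second_moment N (\<lambda>w. g w + h w) \<le> 2 * second_moment N g + 2 * second_moment N h"
proof -
  have "second_moment N (\<lambda>w. g w + h w)
      \<le> (\<integral>\<^sup>+w. ennreal (2 * (norm (g w))\<^sup>2 + 2 * (norm (h w))\<^sup>2) \<partial>N)"
    unfolding second_moment_def by (intro nn_integral_mono ennreal_leI norm_add_power2_le)
  then show ?thesis
    by (simp add: second_moment_def nn_integral_add nn_integral_cmult ennreal_mult)
qed

lemma square_integrable_integrable: "square_integrable N g \<Longrightarrow> integrable N (\<lambda>w. (norm (g w))\<^sup>2)"
  unfolding square_integrable_def second_moment_def by (intro integrableI_bounded) auto

lemma second_moment_eq_integral:
  "square_integrable N g \<Longrightarrow> second_moment N g = ennreal (LINT w|N. (norm (g w))\<^sup>2)"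
  unfolding second_moment_def by (intro nn_integral_eq_integral square_integrable_integrable) auto

lemma square_integrable_bound:
  assumes "square_integrable N h" "g \<in> borel_measurable N"
    and "\<And>w. w \<in> space N \<Longrightarrow> norm (g w) \<le> norm (h w)"
  shows "square_integrable N g"
proof -
  have "second_moment N g \<le> second_moment N h"
    unfolding second_moment_def using assms(3)
    by (intro nn_integral_mono ennreal_leI power_mono) auto
  with assms show ?thesis unfolding square_integrable_def by (auto intro: le_less_trans)
qed

lemma square_integrable_norm: "square_integrable N g \<Longrightarrow> square_integrable N (\<lambda>w. norm (g w))"
  by (auto simp: square_integrable_def second_moment_def)

lemma square_integrable_add:
  "square_integrable N g \<Longrightarrow> square_integrable N h \<Longrightarrow> square_integrable N (\<lambda>w. g w + h w)"
  unfolding square_integrable_def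
  by (auto intro: le_less_trans[OF second_moment_add_le] simp: ennreal_mult_less_top)

lemma square_integrable_scaleR: "square_integrable N g \<Longrightarrow> square_integrable N (\<lambda>w. c *\<^sub>R g w)"
  by (auto simp: square_integrable_def second_moment_scaleR ennreal_mult_less_top)

lemma (in finite_measure) square_integrable_const: "square_integrable M (\<lambda>_. c)"
  by (simp add: square_integrable_def second_moment_def ennreal_mult_eq_top_iff less_top[symmetric])

context prob_space
begin

lemma second_moment_const_add:
  fixes H :: "'a \<Rightarrow> 'b::euclidean_space"
  assumes H: "integrable M H" "second_moment M H < \<infinity>"
  shows "second_moment M (\<lambda>z. a + H z)
    = ennreal ((norm a)\<^sup>2 + 2 * inner a (expectation H) + expectation (\<lambda>z. (norm (H z))\<^sup>2))"
proof -
  have square: "integrable M (\<lambda>z. (norm (H z))\<^sup>2)"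
    using H by (intro square_integrable_integrable) (simp add: square_integrable_def)
  have expand: "(norm (a + H z))\<^sup>2 = (norm a)\<^sup>2 + 2 * inner a (H z) + (norm (H z))\<^sup>2" for z
    unfolding power2_norm_eq_inner by (simp add: algebra_simps inner_commute)
  have "integrable M (\<lambda>z. (norm (a + H z))\<^sup>2)"
    unfolding expand using H(1) square by simp
  then have "second_moment M (\<lambda>z. a + H z) = ennreal (expectation (\<lambda>z. (norm (a + H z))\<^sup>2))"
    unfolding second_moment_def by (intro nn_integral_eq_integral) auto
  also have "expectation (\<lambda>z. (norm (a + H z))\<^sup>2)
      = (norm a)\<^sup>2 + 2 * inner a (expectation H) + expectation (\<lambda>z. (norm (H z))\<^sup>2)"
    unfolding expand using H(1) square by (simp add: prob_space)
  finally show ?thesis .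
qed

lemma second_moment_add_centered_le:
  fixes H :: "'a \<Rightarrow> 'b::euclidean_space"
  assumes H: "integrable M H" "expectation H = 0"
  shows "second_moment M (\<lambda>z. a + H z) \<le> ennreal ((norm a)\<^sup>2) + second_moment M H"
proof (cases "second_moment M H < \<infinity>")
  case True
  then show ?thesis
    using second_moment_const_add[OF H(1) True, of a] second_moment_const_add[OF H(1) True, of 0]
    by (simp add: H(2))
qed (simp add: less_top[symmetric])

lemma second_moment_centered_le:
  fixes H :: "'a \<Rightarrow> 'b::euclidean_space"
  assumes H: "integrable M H"
  shows "second_moment M (\<lambda>z. H z - expectation H) \<le> second_moment M H"
proof (cases "second_moment M H < \<infinity>")
  case True
  have "second_moment M (\<lambda>z. H z - expectation H)
      = ennreal (expectation (\<lambda>z. (norm (H z))\<^sup>2) - (norm (expectation H))\<^sup>2)"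
    using second_moment_const_add[OF H True, of "- expectation H"]
    by (simp add: power2_norm_eq_inner algebra_simps)
  also have "\<dots> \<le> second_moment M H"
    using second_moment_const_add[OF H True, of 0] by (simp add: ennreal_leI)
  finally show ?thesis .
qed (simp add: less_top[symmetric])

lemma norm_expectation_power2_le_second_moment:
  fixes H :: "'a \<Rightarrow> 'b::euclidean_space"
  assumes H: "integrable M H"
  shows "ennreal ((norm (expectation H))\<^sup>2) \<le> second_moment M H"
proof (cases "second_moment M H < \<infinity>")
  case True
  then have H2: "square_integrable M H" using H by (simp add: square_integrable_def)
  have "(norm (expectation H))\<^sup>2 \<le> (expectation (\<lambda>z. norm (H z)))\<^sup>2"
    by (intro power_mono integral_norm_bound) simp
  also have "\<dots> \<le> expectation (\<lambda>z. (norm (H z))\<^sup>2)"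
    using variance_positive[of "\<lambda>z. norm (H z)"] variance_eq[of "\<lambda>z. norm (H z)"]
      H square_integrable_integrable[OF H2] by simp
  finally show ?thesis unfolding second_moment_eq_integral[OF H2] by (rule ennreal_leI)
qed (simp add: less_top[symmetric])

end

lemma borel_measurable_pair_continuous_snd:
  fixes g :: "'z \<Rightarrow> 'a::euclidean_space \<Rightarrow> 'b::euclidean_space"
  assumes meas: "\<And>x. (\<lambda>z. g z x) \<in> borel_measurable P"
    and cont: "\<And>z. z \<in> space P \<Longrightarrow> continuous_on UNIV (g z)"
  shows "(\<lambda>(z, x). g z x) \<in> borel_measurable (P \<Otimes>\<^sub>M borel)"
proof -
  obtain h :: "nat \<Rightarrow> 'a \<Rightarrow> 'a"
    where simple: "\<And>i. simple_function borel (h i)" and lim: "\<And>x. (\<lambda>i. h i x) \<longlonglongrightarrow> x"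
    using borel_measurable_implies_sequence_metric[of "\<lambda>x::'a. x" borel 0] by auto
  show ?thesis
  proof (rule borel_measurable_LIMSEQ_metric)
    show "(\<lambda>w. g (fst w) (h i (snd w))) \<in> borel_measurable (P \<Otimes>\<^sub>M borel)" for i
    proof (rule measurable_compose_countable'[where f = "\<lambda>c w. g (fst w) c"
          and g = "\<lambda>w. h i (snd w)" and I = "range (h i)"])
      show "(\<lambda>w. h i (snd w)) \<in> P \<Otimes>\<^sub>M borel \<rightarrow>\<^sub>M count_space (range (h i))"
        using simple[of i] by (intro measurable_compose[OF measurable_snd])
          (simp add: simple_function_def measurable_count_space_eq2)
      show "countable (range (h i))"
        using simple[of i] by (auto simp: simple_function_def intro: countable_finite)
      show "(\<lambda>w. g (fst w) c) \<in> borel_measurable (P \<Otimes>\<^sub>M borel)" for c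
        by (rule measurable_compose[OF measurable_fst meas])
    qed
    show "(\<lambda>i. g (fst w) (h i (snd w))) \<longlonglongrightarrow> (case w of (z, x) \<Rightarrow> g z x)"
      if "w \<in> space (P \<Otimes>\<^sub>M borel)" for w
    proof -
      have "isCont (g (fst w)) (snd w)"
        using cont[of "fst w"] that
        by (auto simp: space_pair_measure continuous_on_eq_continuous_at)
      from isCont_tendsto_compose[OF this lim] show ?thesis by (simp add: case_prod_beta)
    qed
  qed
qed

context
  fixes P :: "'z measure" and I :: "'i set"
  assumes P: "prob_space P" and I: "finite I"
begin

interpretation product_sigma_finite "\<lambda>_::'i. P"
  using P by (simp add: product_sigma_finite_def prob_space_imp_sigma_finite)

lemma nn_integral_PiM_resample:
  assumes l: "l \<in> I" and f: "f \<in> borel_measurable (PiM I (\<lambda>_. P))"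
  shows "(\<integral>\<^sup>+\<zeta>. f \<zeta> \<partial>PiM I (\<lambda>_. P))
    = (\<integral>\<^sup>+\<zeta>. (\<integral>\<^sup>+z. f (\<zeta>(l := z)) \<partial>P) \<partial>PiM I (\<lambda>_. P))"
proof -
  interpret P: prob_space P by (rule P)
  define I' where "I' = I - {l}"
  have I': "finite I'" "l \<notin> I'" "I = insert l I'" using I l by (auto simp: I'_def)
  let ?Q = "PiM (insert l I') (\<lambda>_. P)"
  have f': "f \<in> borel_measurable ?Q" using f I'(3) by simp
  have update: "(\<lambda>w. (fst w)(l := snd w)) \<in> ?Q \<Otimes>\<^sub>M P \<rightarrow>\<^sub>M ?Q"
    by (rule measurable_fun_upd[where J = "insert l I'"]) auto
  have "(\<lambda>(\<zeta>, z). f (\<zeta>(l := z))) \<in> borel_measurable (?Q \<Otimes>\<^sub>M P)"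
    using measurable_compose[OF update f'] by (simp add: case_prod_beta)
  then have "(\<lambda>\<zeta>. (\<integral>\<^sup>+z. f (\<zeta>(l := z)) \<partial>P)) \<in> borel_measurable ?Q"
    using prob_space_imp_sigma_finite[OF P]
    by (intro sigma_finite_measure.borel_measurable_nn_integral)
  then have "(\<integral>\<^sup>+\<zeta>. (\<integral>\<^sup>+z. f (\<zeta>(l := z)) \<partial>P) \<partial>?Q)
      = (\<integral>\<^sup>+\<zeta>. (\<integral>\<^sup>+y. (\<integral>\<^sup>+z. f ((\<zeta>(l := y))(l := z)) \<partial>P) \<partial>P) \<partial>PiM I' (\<lambda>_. P))"
    by (rule product_nn_integral_insert[OF I'(1,2)])
  also have "\<dots> = (\<integral>\<^sup>+\<zeta>. (\<integral>\<^sup>+z. f (\<zeta>(l := z)) \<partial>P) \<partial>PiM I' (\<lambda>_. P))"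
    by (simp add: P.emeasure_space_1)
  also have "\<dots> = (\<integral>\<^sup>+\<zeta>. f \<zeta> \<partial>?Q)"
    by (rule product_nn_integral_insert[OF I'(1,2) f', symmetric])
  finally show ?thesis by (simp add: I'(3))
qed

context
  fixes H :: "('i \<Rightarrow> 'z) \<Rightarrow> 'z \<Rightarrow> 'a::euclidean_space" and V :: "('i \<Rightarrow> 'z) \<Rightarrow> ennreal"
  assumes H: "(\<lambda>(\<zeta>, z). H \<zeta> z) \<in> borel_measurable (PiM I (\<lambda>_. P) \<Otimes>\<^sub>M P)"
    and integrable: "\<And>\<zeta>. \<zeta> \<in> space (PiM I (\<lambda>_. P)) \<Longrightarrow> integrable P (H \<zeta>)"
    and centered: "\<And>\<zeta>. \<zeta> \<in> space (PiM I (\<lambda>_. P)) \<Longrightarrow> (LINT z|P. H \<zeta> z) = 0"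
    and variance: "\<And>\<zeta>. \<zeta> \<in> space (PiM I (\<lambda>_. P)) \<Longrightarrow> second_moment P (H \<zeta>) \<le> V \<zeta>"
    and V: "V \<in> borel_measurable (PiM I (\<lambda>_. P))"
begin

lemma borel_measurable_noise_at_sample:
  "l \<in> I \<Longrightarrow> (\<lambda>\<zeta>. H \<zeta> (\<zeta> l)) \<in> borel_measurable (PiM I (\<lambda>_. P))"
proof -
  assume "l \<in> I"
  then have "(\<lambda>\<zeta>. (\<zeta>, \<zeta> l)) \<in> PiM I (\<lambda>_. P) \<rightarrow>\<^sub>M PiM I (\<lambda>_. P) \<Otimes>\<^sub>M P" by simp
  from measurable_compose[OF this H] show ?thesis by simp
qed

lemma second_moment_add_fresh_sample:
  assumes l: "l \<in> I" and a: "a \<in> borel_measurable (PiM I (\<lambda>_. P))"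
    and fresh: "\<And>\<zeta> z. a (\<zeta>(l := z)) = a \<zeta>" "\<And>\<zeta> z. H (\<zeta>(l := z)) = H \<zeta>"
  shows "second_moment (PiM I (\<lambda>_. P)) (\<lambda>\<zeta>. a \<zeta> + c *\<^sub>R H \<zeta> (\<zeta> l))
    \<le> second_moment (PiM I (\<lambda>_. P)) a + ennreal (c\<^sup>2) * (\<integral>\<^sup>+\<zeta>. V \<zeta> \<partial>PiM I (\<lambda>_. P))"
proof -
  interpret P: prob_space P by (rule P)
  let ?Q = "PiM I (\<lambda>_. P)"
  note [measurable] = a V borel_measurable_noise_at_sample[OF l]
  have "second_moment ?Q (\<lambda>\<zeta>. a \<zeta> + c *\<^sub>R H \<zeta> (\<zeta> l))
      = (\<integral>\<^sup>+\<zeta>. second_moment P (\<lambda>z. a \<zeta> + c *\<^sub>R H \<zeta> z) \<partial>?Q)"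
    unfolding second_moment_def by (subst nn_integral_PiM_resample[OF l]) (simp_all add: fresh)
  also have "\<dots> \<le> (\<integral>\<^sup>+\<zeta>. ennreal ((norm (a \<zeta>))\<^sup>2) + ennreal (c\<^sup>2) * V \<zeta> \<partial>?Q)"
  proof (rule nn_integral_mono)
    fix \<zeta> assume \<zeta>: "\<zeta> \<in> space ?Q"
    have "second_moment P (\<lambda>z. a \<zeta> + c *\<^sub>R H \<zeta> z)
        \<le> ennreal ((norm (a \<zeta>))\<^sup>2) + second_moment P (\<lambda>z. c *\<^sub>R H \<zeta> z)"
      using integrable[OF \<zeta>] centered[OF \<zeta>] by (intro P.second_moment_add_centered_le) auto
    also have "second_moment P (\<lambda>z. c *\<^sub>R H \<zeta> z) = ennreal (c\<^sup>2) * second_moment P (H \<zeta>)"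
      using integrable[OF \<zeta>] by (intro second_moment_scaleR) auto
    finally show "second_moment P (\<lambda>z. a \<zeta> + c *\<^sub>R H \<zeta> z)
        \<le> ennreal ((norm (a \<zeta>))\<^sup>2) + ennreal (c\<^sup>2) * V \<zeta>"
      using variance[OF \<zeta>] by (meson add_left_mono mult_left_mono order_trans zero_le)
  qed
  also have "\<dots> = second_moment ?Q a + ennreal (c\<^sup>2) * (\<integral>\<^sup>+\<zeta>. V \<zeta> \<partial>?Q)"
    unfolding second_moment_def by (simp add: nn_integral_add nn_integral_cmult)
  finally show ?thesis .
qed

lemma second_moment_add_fresh_samples:
  assumes l: "\<And>i. i < n \<Longrightarrow> l i \<in> I" "inj_on l {..<n}"
    and a: "a \<in> borel_measurable (PiM I (\<lambda>_. P))"
    and fresh: "\<And>\<zeta> z i. i < n \<Longrightarrow> a (\<zeta>(l i := z)) = a \<zeta>"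
      "\<And>\<zeta> z i. i < n \<Longrightarrow> H (\<zeta>(l i := z)) = H \<zeta>"
  shows "second_moment (PiM I (\<lambda>_. P)) (\<lambda>\<zeta>. a \<zeta> + c *\<^sub>R (\<Sum>i<n. H \<zeta> (\<zeta> (l i))))
    \<le> second_moment (PiM I (\<lambda>_. P)) a + of_nat n * (ennreal (c\<^sup>2) * (\<integral>\<^sup>+\<zeta>. V \<zeta> \<partial>PiM I (\<lambda>_. P)))"
  using l fresh
proof (induction n)
  case (Suc n)
  let ?Q = "PiM I (\<lambda>_. P)"
  let ?a = "\<lambda>\<zeta>. a \<zeta> + c *\<^sub>R (\<Sum>i<n. H \<zeta> (\<zeta> (l i)))"
  have "?a \<in> borel_measurable ?Q"
    using a Suc.prems(1) borel_measurable_noise_at_sample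
    by (intro borel_measurable_add borel_measurable_scaleR borel_measurable_sum) auto
  moreover have distinct: "l i \<noteq> l n" if "i < n" for i
    using Suc.prems(2) that by (auto simp: inj_on_def)
  then have "?a (\<zeta>(l n := z)) = ?a \<zeta>" for \<zeta> z
    unfolding Suc.prems(3)[OF lessI] Suc.prems(4)[OF lessI] by simp
  ultimately have "second_moment ?Q (\<lambda>\<zeta>. ?a \<zeta> + c *\<^sub>R H \<zeta> (\<zeta> (l n)))
      \<le> second_moment ?Q ?a + ennreal (c\<^sup>2) * (\<integral>\<^sup>+\<zeta>. V \<zeta> \<partial>?Q)"
    by (intro second_moment_add_fresh_sample Suc.prems(1)[OF lessI] Suc.prems(4)[OF lessI])
  also have "\<dots> \<le> second_moment ?Q a + of_nat n * (ennreal (c\<^sup>2) * (\<integral>\<^sup>+\<zeta>. V \<zeta> \<partial>?Q))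
      + ennreal (c\<^sup>2) * (\<integral>\<^sup>+\<zeta>. V \<zeta> \<partial>?Q)"
    by (intro add_right_mono Suc.IH) (use Suc.prems in \<open>auto intro: inj_on_subset\<close>)
  finally show ?case by (simp add: algebra_simps)
qed simp

lemma second_moment_add_fresh_batch_mean:
  assumes "n \<ge> 1" "\<And>i. i < n \<Longrightarrow> l i \<in> I" "inj_on l {..<n}"
    and "a \<in> borel_measurable (PiM I (\<lambda>_. P))"
    and "\<And>\<zeta> z i. i < n \<Longrightarrow> a (\<zeta>(l i := z)) = a \<zeta>"
      "\<And>\<zeta> z i. i < n \<Longrightarrow> H (\<zeta>(l i := z)) = H \<zeta>"
  shows "second_moment (PiM I (\<lambda>_. P)) (\<lambda>\<zeta>. a \<zeta> + (c / real n) *\<^sub>R (\<Sum>i<n. H \<zeta> (\<zeta> (l i))))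
    \<le> second_moment (PiM I (\<lambda>_. P)) a + ennreal (c\<^sup>2 / real n) * (\<integral>\<^sup>+\<zeta>. V \<zeta> \<partial>PiM I (\<lambda>_. P))"
proof -
  have "real n * (c / real n)\<^sup>2 = c\<^sup>2 / real n" using assms(1) by (simp add: power2_eq_square)
  then have "of_nat n * ennreal ((c / real n)\<^sup>2) = ennreal (c\<^sup>2 / real n)"
    by (simp add: ennreal_of_nat_eq_real_of_nat flip: ennreal_mult)
  then show ?thesis
    using second_moment_add_fresh_samples[OF assms(2-), where c = "c / real n"]
    by (simp flip: mult.assoc)
qed

end

end

section \<open>The weights\<close>

lemma Chebyshev_sum_upper_almost_mono:
  fixes a b :: "nat \<Rightarrow> real"
  assumes almost_mono: "\<And>i j. i \<le> j \<Longrightarrow> j < n \<Longrightarrow> a i \<le> K * a j"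
    and decreasing: "\<And>i j. i \<le> j \<Longrightarrow> j < n \<Longrightarrow> b j \<le> b i"
    and nonneg: "\<And>i. i < n \<Longrightarrow> 0 \<le> b i"
  shows "real n * (\<Sum>i<n. a i * b i) \<le> K * (\<Sum>i<n. a i) * (\<Sum>i<n. b i)"
proof -
  define running_max where "running_max j = Max (a ` {..j})" for j
  have le_max: "a j \<le> running_max j" for j unfolding running_max_def by (intro Max_ge) auto
  have max_le: "running_max j \<le> K * a j" if "j < n" for j
    unfolding running_max_def using almost_mono that by (intro Max.boundedI) auto
  have "real n * (\<Sum>i<n. a i * b i) \<le> real n * (\<Sum>i<n. running_max i * b i)"
    using le_max nonneg by (intro mult_left_mono sum_mono mult_right_mono) auto
  also have "\<dots> \<le> (\<Sum>i<n. running_max i) * (\<Sum>i<n. b i)"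
    unfolding lessThan_atLeast0
  proof (rule Chebyshev_sum_upper)
    show "running_max i \<le> running_max j" if "i \<le> j" for i j
      unfolding running_max_def using that by (intro Max_mono) auto
  qed (rule decreasing)
  also have "\<dots> \<le> (\<Sum>i<n. K * a i) * (\<Sum>i<n. b i)"
    using max_le nonneg by (intro mult_right_mono sum_mono sum_nonneg) auto
  finally show ?thesis by (simp add: sum_distrib_left)
qed

lemma geometric_partial_sum_le:
  fixes q :: real
  assumes "0 \<le> q" "q < 1"
  shows "(\<Sum>j<n. q ^ j) \<le> 1 / (1 - q)"
  using assms by (simp add: sum_gp_strict divide_right_mono)

lemma affine_recursion_le:
  fixes E \<rho> :: "nat \<Rightarrow> real"
  assumes q: "0 \<le> q" and step: "\<And>t. t < m \<Longrightarrow> E (Suc t) \<le> q * (E t + \<rho> t) + \<nu>"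
  shows "t \<le> m \<Longrightarrow> E t \<le> q ^ t * E 0 + (\<Sum>k<t. q ^ (t - k) * \<rho> k) + (\<Sum>j<t. q ^ j) * \<nu>"
proof (induction t)
  case (Suc t)
  have "E (Suc t) \<le> q * (E t + \<rho> t) + \<nu>" using step Suc.prems by simp
  also have "\<dots> \<le> q * ((q ^ t * E 0 + (\<Sum>k<t. q ^ (t - k) * \<rho> k) + (\<Sum>j<t. q ^ j) * \<nu>) + \<rho> t) + \<nu>"
    using Suc q by (intro add_right_mono mult_left_mono) auto
  also have "\<dots> = q ^ Suc t * E 0 + (q * (\<Sum>k<t. q ^ (t - k) * \<rho> k) + q * \<rho> t)
      + (1 + q * (\<Sum>j<t. q ^ j)) * \<nu>" by (simp add: algebra_simps)
  also have "q * (\<Sum>k<t. q ^ (t - k) * \<rho> k) = (\<Sum>k<t. q ^ (Suc t - k) * \<rho> k)"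
    unfolding sum_distrib_left by (intro sum.cong) (auto simp: Suc_diff_le)
  also have "1 + q * (\<Sum>j<t. q ^ j) = (\<Sum>j<Suc t. q ^ j)"
    by (subst sum.lessThan_Suc_shift) (simp add: sum_distrib_left)
  finally show ?case by simp
qed simp

lemma sum_discounted_past_eq_sum_discounted_future:
  fixes a \<rho> :: "nat \<Rightarrow> 'a::comm_semiring_1"
  shows "(\<Sum>t\<le>m. a t * (\<Sum>k<t. q ^ (t - k) * \<rho> k))
    = (\<Sum>k\<le>m. (\<Sum>t=Suc k..m. q ^ (t - k) * a t) * \<rho> k)"
proof -
  have "(\<Sum>t\<le>m. a t * (\<Sum>k<t. q ^ (t - k) * \<rho> k))
      = (\<Sum>k<m. \<Sum>t=Suc k..m. a t * (q ^ (t - k) * \<rho> k))"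
    unfolding sum_distrib_left by (rule sum.nested_swap')
  also have "\<dots> = (\<Sum>k<m. (\<Sum>t=Suc k..m. q ^ (t - k) * a t) * \<rho> k)"
    unfolding sum_distrib_right by (simp add: mult_ac)
  finally show ?thesis by (simp flip: lessThan_Suc_atMost)
qed

text \<open>The map \<open>u \<mapsto> u + \<kappa> / (1 + u)\<close> is convex, so on an interval it is largest at an endpoint.\<close>

lemma add_divide_one_plus_le_max:
  fixes u v \<kappa> :: real
  assumes u: "0 \<le> u" "u \<le> v"
  shows "u + \<kappa> / (1 + u) \<le> max \<kappa> (v + \<kappa> / (1 + v))"
proof (cases "\<kappa> \<le> (1 + u) * (1 + v)")
  case True
  have "\<kappa> / (1 + u) - \<kappa> / (1 + v) = \<kappa> / ((1 + u) * (1 + v)) * (v - u)"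
    using u by (simp add: field_simps)
  also have "\<dots> \<le> 1 * (v - u)" using True u by (intro mult_right_mono) auto
  finally show ?thesis by simp
next
  case False
  have "1 + u \<le> (1 + u) * (1 + v)" using u by (simp add: algebra_simps)
  also have "\<dots> \<le> \<kappa>" using False by simp
  finally have "1 + u \<le> \<kappa>" .
  then have "u * (1 + u) \<le> u * \<kappa>" using u by (intro mult_left_mono)
  then have "u + \<kappa> / (1 + u) \<le> \<kappa>" using u by (simp add: field_simps)
  then show ?thesis by simp
qed

locale damping_recursion =
  fixes y :: "nat \<Rightarrow> real" and \<beta> \<kappa> :: real and m :: nat
  assumes y_0: "y 0 = 0"
    and y_Suc: "\<And>r. r < m \<Longrightarrow> y (Suc r) = \<beta>\<^sup>2 * (y r + \<kappa> / (1 + y r))"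
    and \<beta>: "0 \<le> \<beta>" "\<beta> < 1" and \<kappa>: "0 \<le> \<kappa>" "\<kappa> \<le> 3/2"
begin

lemma \<beta>_power2_bounds: "\<beta>\<^sup>2 < 1" "\<beta>\<^sup>2 \<le> \<beta>"
  using \<beta> by (auto simp: power2_eq_square mult_left_le intro: le_less_trans[of _ \<beta>])

lemma y_nonneg: "r \<le> m \<Longrightarrow> 0 \<le> y r"
proof (induction r)
  case (Suc r)
  then show ?case using y_Suc[of r] \<kappa>(1) by simp
qed (simp add: y_0)

lemma \<beta>_power2_\<kappa>_le_sqrt: "\<beta>\<^sup>2 * \<kappa> \<le> sqrt (\<kappa> / (1 - \<beta>))"
proof (rule real_le_rsqrt)
  have "\<beta> * (1 - \<beta>) \<le> 1/4"
    using zero_le_power2[of "\<beta> - 1/2"] by (simp add: power2_eq_square algebra_simps)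
  moreover have "\<beta>\<^sup>2 * \<beta> \<le> 1" using \<beta>_power2_bounds \<beta> mult_le_one[of "\<beta>\<^sup>2" \<beta>] by simp
  ultimately have "(\<beta>\<^sup>2 * \<beta>) * (\<beta> * (1 - \<beta>)) \<le> 1 * (1/4)"
    using \<beta> by (intro mult_mono) auto
  then have "((\<beta>\<^sup>2 * \<beta>) * (\<beta> * (1 - \<beta>))) * (\<kappa> * \<kappa>) \<le> 1/4 * (3/2 * \<kappa>)"
    using \<beta> \<kappa> by (intro mult_mono) auto
  moreover have "((\<beta>\<^sup>2 * \<beta>) * (\<beta> * (1 - \<beta>))) * (\<kappa> * \<kappa>) = (\<beta>\<^sup>2 * \<kappa>)\<^sup>2 * (1 - \<beta>)"
    by (simp add: power2_eq_square)
  ultimately show "(\<beta>\<^sup>2 * \<kappa>)\<^sup>2 \<le> \<kappa> / (1 - \<beta>)" using \<beta> \<kappa> by (simp add: field_simps)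
qed

lemma y_le_sqrt:
  assumes "r \<le> m"
  shows "y r \<le> sqrt (\<kappa> / (1 - \<beta>))"
proof -
  define Y where "Y = sqrt (\<kappa> / (1 - \<beta>))"
  have Y: "0 \<le> Y" "(1 - \<beta>) * Y\<^sup>2 = \<kappa>" using \<kappa> \<beta> by (auto simp: Y_def)
  have fixed_point: "\<beta>\<^sup>2 * (Y + \<kappa> / (1 + Y)) \<le> Y"
  proof -
    have "\<beta>\<^sup>2 * \<kappa> \<le> (1 - \<beta>) * Y\<^sup>2" using \<beta>_power2_bounds \<kappa> Y(2) by (simp add: mult_left_le_one_le)
    also have "\<dots> \<le> (1 - \<beta>\<^sup>2) * (Y * (1 + Y))"
      using \<beta>_power2_bounds Y(1) by (intro mult_mono) (auto simp: power2_eq_square algebra_simps)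
    finally have "\<beta>\<^sup>2 * (Y * (1 + Y) + \<kappa>) \<le> Y * (1 + Y)" by (simp add: algebra_simps)
    then show ?thesis using Y(1) by (simp add: field_simps)
  qed
  have "y r \<le> Y" using assms
  proof (induction r)
    case (Suc r)
    then have "y r + \<kappa> / (1 + y r) \<le> max \<kappa> (Y + \<kappa> / (1 + Y))"
      using y_nonneg by (intro add_divide_one_plus_le_max) auto
    then have "y (Suc r) \<le> \<beta>\<^sup>2 * max \<kappa> (Y + \<kappa> / (1 + Y))"
      using y_Suc[of r] Suc.prems by (simp add: mult_left_mono)
    also have "\<dots> \<le> Y"
      using \<beta>_power2_\<kappa>_le_sqrt fixed_point unfolding Y_def[symmetric] by (simp add: max_def)
    finally show ?case .
  qed (simp add: y_0 Y)
  then show ?thesis by (simp only: Y_def)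
qed

lemma y_mono_if_large_contraction:
  assumes large: "1/3 \<le> \<beta>\<^sup>2"
  shows "Suc r \<le> m \<Longrightarrow> y r \<le> y (Suc r) \<and> \<beta>\<^sup>2 * \<kappa> \<le> y (Suc r)"
proof (induction r)
  case 0
  then show ?case using y_Suc[of 0] y_0 \<kappa> by simp
next
  case (Suc r)
  then have IH: "y r \<le> y (Suc r)" "\<beta>\<^sup>2 * \<kappa> \<le> y (Suc r)" by auto
  have nonneg: "0 \<le> y r" "0 \<le> y (Suc r)" using y_nonneg Suc.prems by auto
  have "(1 - \<beta>\<^sup>2) * \<kappa> \<le> (2/3) * (3/2)"
    using large \<kappa> \<beta>_power2_bounds by (intro mult_mono) auto
  then have "\<kappa> \<le> 1 * (1 + \<beta>\<^sup>2 * \<kappa>)" by (simp add: algebra_simps)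
  also have "\<dots> \<le> (1 + y r) * (1 + y (Suc r))"
    using nonneg IH \<kappa> by (intro mult_mono) auto
  finally have "\<kappa> / ((1 + y r) * (1 + y (Suc r))) * (y (Suc r) - y r) \<le> 1 * (y (Suc r) - y r)"
    using nonneg IH by (intro mult_right_mono) auto
  also have "\<kappa> / ((1 + y r) * (1 + y (Suc r))) * (y (Suc r) - y r)
      = \<kappa> / (1 + y r) - \<kappa> / (1 + y (Suc r))" using nonneg by (simp add: field_simps)
  finally have "\<beta>\<^sup>2 * (y r + \<kappa> / (1 + y r)) \<le> \<beta>\<^sup>2 * (y (Suc r) + \<kappa> / (1 + y (Suc r)))"
    by (intro mult_left_mono) auto
  then show ?case using y_Suc[of r] y_Suc[of "Suc r"] Suc.prems IH by simp
qed

lemma y_le_if_small_contraction: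
  assumes small: "\<beta>\<^sup>2 < 1/3"
  shows "r \<le> m \<Longrightarrow> y r \<le> 2 * \<beta>"
proof (induction r)
  case (Suc r)
  then have y: "0 \<le> y r" "y r \<le> 2 * \<beta>" using y_nonneg by auto
  have "\<beta> \<le> 3/5"
    using small by (intro power2_le_imp_le[of \<beta> "3/5"]) (auto simp: power_divide)
  have "\<kappa> / (1 + y r) \<le> \<kappa>" using \<kappa> y by (simp add: field_simps)
  then have "\<beta>\<^sup>2 * (y r + \<kappa> / (1 + y r)) \<le> \<beta>\<^sup>2 * (2 * \<beta> + 3/2)"
    using y \<kappa> by (intro mult_left_mono) auto
  also have "\<dots> = \<beta> * (2 * \<beta>\<^sup>2 + 3/2 * \<beta>)" by (simp add: power2_eq_square algebra_simps)
  also have "\<dots> \<le> \<beta> * 2"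
    using small \<beta> \<open>\<beta> \<le> 3/5\<close> by (intro mult_left_mono) auto
  finally show ?case using y_Suc[of r] Suc.prems by simp
qed (simp add: y_0 \<beta>)

lemma y_almost_mono:
  assumes qr: "q \<le> r" "r \<le> m"
  shows "1 + y q \<le> (1 + 2 * \<beta>) * (1 + y r)"
proof (cases "1/3 \<le> \<beta>\<^sup>2")
  case True
  have "y q \<le> y r"
    using qr
  proof (induction r rule: dec_induct)
    case (step r)
    then show ?case using y_mono_if_large_contraction[OF True, of r] by simp
  qed simp
  moreover have "1 * (1 + y r) \<le> (1 + 2 * \<beta>) * (1 + y r)"
    using \<beta> y_nonneg[OF qr(2)] by (intro mult_right_mono) auto
  ultimately show ?thesis by simp
next
  case False
  then have "1 + y q \<le> (1 + 2 * \<beta>) * 1" using y_le_if_small_contraction[of q] qr by simp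
  also have "\<dots> \<le> (1 + 2 * \<beta>) * (1 + y r)"
    using \<beta> y_nonneg[OF qr(2)] by (intro mult_left_mono) auto
  finally show ?thesis .
qed

end

lemma one_plus_power2_mult_inverse_gap_le:
  fixes u :: real
  assumes u: "2/3 \<le> u" "u < 1"
  shows "(1 + u\<^sup>2) * (2 / u - 2) \<le> 3/2"
proof -
  have "3/4 * u - (1 + u\<^sup>2) * (1 - u) = (u - 2/3) * (u * (u - 1/3) + 55/36) + 1/54"
    by (simp add: power2_eq_square field_simps)
  moreover have "0 \<le> (u - 2/3) * (u * (u - 1/3) + 55/36)"
    using u by (intro mult_nonneg_nonneg add_nonneg_nonneg) auto
  ultimately have "(1 + u\<^sup>2) * (1 - u) \<le> 3/4 * u" by linarith
  then show ?thesis using u by (simp add: field_simps)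
qed

locale hsgd_parameters =
  fixes L \<eta> \<delta> \<beta> :: real and \<gamma> :: "nat \<Rightarrow> real" and m b bh bt :: nat
  assumes L: "0 < L" and \<eta>: "0 < \<eta>" "\<eta> < 1 / L" and \<delta>: "\<delta> = 2 / \<eta> - 2 * L"
    and batch_sizes: "1 \<le> b" "1 \<le> bh" "1 \<le> bt" and bh_le: "bh \<le> bt * (m + 1)"
    and \<beta>_def: "\<beta> = 1 - sqrt (real bh) / sqrt (real bt * (real m + 1))"
    and \<gamma>_m: "\<gamma> m = \<delta> / L"
    and \<gamma>_t: "\<And>t. t < m \<Longrightarrow> \<gamma> t = \<delta> * real b /
        (L * real b + L * (1 + L\<^sup>2 * \<eta>\<^sup>2) * (\<Sum>k=t+1..m. \<beta> ^ (2 * (k - t)) * \<gamma> k))"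
    and \<gamma>_range: "\<And>t. t \<le> m \<Longrightarrow> 0 < \<gamma> t \<and> \<gamma> t \<le> 1"
begin

definition noise_level :: real where "noise_level = 1 / sqrt (real bh * real bt * (real m + 1))"

lemma noise_level_pos: "0 < noise_level"
  using batch_sizes by (simp add: noise_level_def)

lemma one_minus_\<beta>: "1 - \<beta> = real bh * noise_level"
proof -
  have "real bh * noise_level = (real bh / sqrt (real bh)) / sqrt (real bt * (real m + 1))"
    by (simp add: noise_level_def real_sqrt_mult mult.assoc)
  then show ?thesis by (simp add: \<beta>_def real_div_sqrt)
qed

lemma inverse_batch_eq_noise_level: "1 / (real bt * (real m + 1) * (1 - \<beta>)) = noise_level"
proof -
  have "noise_level * (real bt * (real m + 1) * (1 - \<beta>))
      = (noise_level * noise_level) * (real bh * real bt * (real m + 1))"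
    by (simp only: one_minus_\<beta> mult_ac)
  also have "\<dots> = 1" using batch_sizes by (simp add: noise_level_def)
  finally have "noise_level * (real bt * (real m + 1) * (1 - \<beta>)) = 1" .
  then show ?thesis by (metis mult_zero_right nonzero_eq_divide_eq zero_neq_one)
qed

lemma \<beta>_bounds: "0 \<le> \<beta>" "\<beta> < 1"
proof -
  have "real bh \<le> real bt * (real m + 1)"
    using bh_le by (metis of_nat_1 of_nat_add of_nat_le_iff of_nat_mult)
  then show "0 \<le> \<beta>" using batch_sizes by (simp add: \<beta>_def)
  have "0 < real bh * noise_level" using noise_level_pos batch_sizes by simp
  then show "\<beta> < 1" using one_minus_\<beta> by linarith
qed

lemma L\<eta>_bounds: "0 < L * \<eta>" "L * \<eta> < 1" "L\<^sup>2 * \<eta>\<^sup>2 < 1"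
proof -
  show "0 < L * \<eta>" "L * \<eta> < 1" using L \<eta> by (simp_all add: field_simps)
  then have "(L * \<eta>)\<^sup>2 < 1" by (simp add: power_less_one_iff)
  then show "L\<^sup>2 * \<eta>\<^sup>2 < 1" by (simp add: power_mult_distrib)
qed

lemma \<delta>_pos: "0 < \<delta>"
  using L\<eta>_bounds \<eta> by (simp add: \<delta> field_simps)

definition tail :: "nat \<Rightarrow> real" where
  "tail t = (\<Sum>k=Suc t..m. (\<beta>\<^sup>2) ^ (k - t) * \<gamma> k)"

definition \<kappa> :: real where "\<kappa> = (1 + L\<^sup>2 * \<eta>\<^sup>2) * (\<delta> / L) / real b"

definition damping :: "nat \<Rightarrow> real" where
  "damping r = (1 + L\<^sup>2 * \<eta>\<^sup>2) * tail (m - r) / real b"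

lemma tail_m [simp]: "tail m = 0"
  by (simp add: tail_def)

lemma tail_rec: "t < m \<Longrightarrow> tail t = \<beta>\<^sup>2 * (\<gamma> (Suc t) + tail (Suc t))"
proof -
  assume "t < m"
  then have "tail t = \<beta>\<^sup>2 * \<gamma> (Suc t) + (\<Sum>k=Suc (Suc t)..m. (\<beta>\<^sup>2) ^ (k - t) * \<gamma> k)"
    unfolding tail_def by (simp add: sum.atLeast_Suc_atMost)
  also have "(\<Sum>k=Suc (Suc t)..m. (\<beta>\<^sup>2) ^ (k - t) * \<gamma> k) = \<beta>\<^sup>2 * tail (Suc t)"
    unfolding tail_def sum_distrib_left by (intro sum.cong) (auto simp: Suc_diff_Suc[symmetric])
  finally show ?thesis by (simp add: algebra_simps)
qed

lemma \<gamma>_eq: "t \<le> m \<Longrightarrow> \<gamma> t = (\<delta> / L) / (1 + damping (m - t))"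
proof (cases "t = m")
  case True
  then show ?thesis by (simp add: \<gamma>_m damping_def)
next
  case False
  moreover assume "t \<le> m"
  ultimately have t: "t < m" by simp
  have "L * real b + L * (1 + L\<^sup>2 * \<eta>\<^sup>2) * tail t = L * real b * (1 + damping (m - t))"
    using t batch_sizes by (simp add: damping_def field_simps)
  then have "\<gamma> t = \<delta> * real b / (L * real b * (1 + damping (m - t)))"
    using \<gamma>_t[OF t] by (simp add: tail_def power_mult)
  then show ?thesis using batch_sizes by simp
qed

lemma \<kappa>_bounds: "0 \<le> \<kappa>" "\<kappa> \<le> 3/2" "\<kappa> \<le> 2 * (\<delta> / (L * real b))"
proof -
  have nonneg: "0 \<le> (1 + L\<^sup>2 * \<eta>\<^sup>2) * (\<delta> / L)" using \<delta>_pos L by simp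
  then show "0 \<le> \<kappa>" unfolding \<kappa>_def by (rule divide_nonneg_nonneg) simp
  have "(1 + L\<^sup>2 * \<eta>\<^sup>2) * (\<delta> / (L * real b)) \<le> 2 * (\<delta> / (L * real b))"
    using L\<eta>_bounds \<delta>_pos L by (intro mult_right_mono) auto
  then show "\<kappa> \<le> 2 * (\<delta> / (L * real b))" by (simp add: \<kappa>_def)
  have \<delta>L: "\<delta> / L = 2 / (L * \<eta>) - 2" using L \<eta> by (simp add: \<delta> field_simps)
  moreover have "\<delta> / L \<le> 1" using \<gamma>_range[of m] \<gamma>_m by simp
  ultimately have "2 / (L * \<eta>) \<le> 3" by linarith
  then have "2/3 \<le> L * \<eta>" using L\<eta>_bounds(1) by (simp add: pos_divide_le_eq)
  then have "(1 + L\<^sup>2 * \<eta>\<^sup>2) * (\<delta> / L) \<le> 3/2"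
    using one_plus_power2_mult_inverse_gap_le[of "L * \<eta>"] L\<eta>_bounds
    by (simp add: \<delta>L power_mult_distrib)
  then have "(1 + L\<^sup>2 * \<eta>\<^sup>2) * (\<delta> / L) / real b \<le> (3/2) / 1"
    using batch_sizes nonneg by (intro frac_le) auto
  then show "\<kappa> \<le> 3/2" by (simp add: \<kappa>_def)
qed

sublocale damping_recursion damping \<beta> \<kappa> m
proof
  show "damping 0 = 0" by (simp add: damping_def)
  show "damping (Suc r) = \<beta>\<^sup>2 * (damping r + \<kappa> / (1 + damping r))" if r: "r < m" for r
  proof -
    have "tail (m - Suc r) = \<beta>\<^sup>2 * (\<gamma> (m - r) + tail (m - r))"
      using tail_rec[of "m - Suc r"] r by (simp add: Suc_diff_Suc)
    then have "damping (Suc r) = \<beta>\<^sup>2 * (damping r + (1 + L\<^sup>2 * \<eta>\<^sup>2) * \<gamma> (m - r) / real b)"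
      by (simp add: damping_def algebra_simps add_divide_distrib)
    also have "(1 + L\<^sup>2 * \<eta>\<^sup>2) * \<gamma> (m - r) / real b = \<kappa> / (1 + damping r)"
      using \<gamma>_eq[of "m - r"] r by (simp add: \<kappa>_def)
    finally show ?thesis .
  qed
qed (use \<beta>_bounds \<kappa>_bounds in auto)

lemma \<gamma>_mult_damping: "t \<le> m \<Longrightarrow> L * (1 + damping (m - t)) * \<gamma> t = \<delta>"
  using \<gamma>_eq[of t] y_nonneg[of "m - t"] L by simp

lemma \<gamma>_almost_mono:
  assumes st: "s \<le> t" "t \<le> m"
  shows "\<gamma> s \<le> (1 + 2 * \<beta>) * \<gamma> t"
proof -
  have "1 + damping (m - t) \<le> (1 + 2 * \<beta>) * (1 + damping (m - s))"
    using st by (intro y_almost_mono) auto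
  then have "1 / (1 + damping (m - s)) \<le> (1 + 2 * \<beta>) / (1 + damping (m - t))"
    using y_nonneg[of "m - t"] y_nonneg[of "m - s"] by (simp add: field_simps)
  then have "(\<delta> / L) * (1 / (1 + damping (m - s)))
      \<le> (\<delta> / L) * ((1 + 2 * \<beta>) / (1 + damping (m - t)))"
    using \<delta>_pos L by (intro mult_left_mono) auto
  then show ?thesis using st by (simp add: \<gamma>_eq mult.commute)
qed

lemma sum_\<gamma>_pos: "0 < (\<Sum>t\<le>m. \<gamma> t)"
  using \<gamma>_range by (intro sum_pos) auto

definition damping_scale :: real where "damping_scale = sqrt (L * \<delta> / (real b * (1 - \<beta>)))"

lemma sum_\<gamma>_lower_bound: "(real m + 1) * \<delta> \<le> sqrt 2 * (L + damping_scale) * (\<Sum>t\<le>m. \<gamma> t)"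
proof -
  have "\<delta> \<le> sqrt 2 * (L + damping_scale) * \<gamma> t" if t: "t \<le> m" for t
  proof -
    have "damping (m - t) \<le> sqrt (\<kappa> / (1 - \<beta>))" by (intro y_le_sqrt) simp
    also have "\<dots> \<le> sqrt (2 * (\<delta> / (L * real b)) / (1 - \<beta>))"
      using \<kappa>_bounds(3) \<beta>_bounds by (intro real_sqrt_le_mono divide_right_mono) auto
    finally have "L * damping (m - t) \<le> L * sqrt (2 * (\<delta> / (L * real b)) / (1 - \<beta>))"
      using L by (intro mult_left_mono) auto
    also have "\<dots> = sqrt (L\<^sup>2 * (2 * (\<delta> / (L * real b)) / (1 - \<beta>)))"
      unfolding real_sqrt_mult[of "L\<^sup>2"] using L by simp
    also have "L\<^sup>2 * (2 * (\<delta> / (L * real b)) / (1 - \<beta>)) = 2 * (L * \<delta> / (real b * (1 - \<beta>)))"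
      using L by (simp add: power2_eq_square)
    finally have "L * damping (m - t) \<le> sqrt 2 * damping_scale"
      by (simp add: damping_scale_def real_sqrt_mult real_sqrt_divide)
    moreover have "1 * L \<le> sqrt 2 * L" using L by (intro mult_right_mono) auto
    ultimately have "L * (1 + damping (m - t)) \<le> sqrt 2 * (L + damping_scale)"
      by (simp add: algebra_simps)
    then show ?thesis
      using \<gamma>_range[OF t] \<gamma>_mult_damping[OF t]
        mult_right_mono[of _ "sqrt 2 * (L + damping_scale)" "\<gamma> t"] by fastforce
  qed
  then have "(\<Sum>t\<le>m. \<delta>) \<le> (\<Sum>t\<le>m. sqrt 2 * (L + damping_scale) * \<gamma> t)" by (intro sum_mono) auto
  then show ?thesis by (simp add: add.commute flip: sum_distrib_left)
qed

lemma damping_scale_eq: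
  "damping_scale
    = (real bt * (real m + 1)) powr (1/4) * sqrt (L * \<delta>) / (real bh powr (1/4) * sqrt (real b))"
proof -
  have "x powr (1/4) = sqrt (sqrt x)" if "0 \<le> x" for x :: real
    using that by (simp add: powr_powr flip: powr_half_sqrt)
  then show ?thesis
    unfolding damping_scale_def by (simp add: \<beta>_def real_sqrt_mult real_sqrt_divide mult_ac)
qed

definition iteration_factor :: "real \<Rightarrow> real \<Rightarrow> real" where
  "iteration_factor \<sigma> \<epsilon> = 96 * sqrt 3 * max 1 \<sigma> / (\<eta> ^ 3 * L * sqrt (L * \<delta>) * real b * \<epsilon> ^ 3)"

lemma one_minus_\<beta>_power2: "1 - \<beta>\<^sup>2 = (1 - \<beta>) * (1 + \<beta>)"
  by (simp add: power2_eq_square algebra_simps)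

lemma sum_powers_mult_fresh_variance_le:
  assumes v: "0 \<le> v"
  shows "(\<Sum>j<t. (\<beta>\<^sup>2) ^ j) * ((1 - \<beta>)\<^sup>2 * v / real bh) \<le> noise_level * v / (1 + \<beta>)"
proof -
  have "(\<Sum>j<t. (\<beta>\<^sup>2) ^ j) * ((1 - \<beta>)\<^sup>2 * v / real bh) \<le> 1 / (1 - \<beta>\<^sup>2) * ((1 - \<beta>)\<^sup>2 * v / real bh)"
    using geometric_partial_sum_le \<beta>_power2_bounds v by (intro mult_right_mono) auto
  also have "\<dots> = (1 - \<beta>) * v / (real bh * (1 + \<beta>))"
    unfolding one_minus_\<beta>_power2 using \<beta>_bounds by (simp add: power2_eq_square)
  also have "\<dots> = noise_level * v / (1 + \<beta>)" unfolding one_minus_\<beta> using batch_sizes by simp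
  finally show ?thesis .
qed

lemma sum_weighted_powers_mult_initial_variance_le:
  assumes v: "0 \<le> v"
  shows "(\<Sum>t\<le>m. \<gamma> t * (\<beta>\<^sup>2) ^ t) * (v / real bt)
    \<le> (1 + 2 * \<beta>) * noise_level * v / (1 + \<beta>) * (\<Sum>t\<le>m. \<gamma> t)"
proof -
  let ?\<Sigma> = "\<Sum>t\<le>m. \<gamma> t"
  have "(real m + 1) * (\<Sum>t\<le>m. \<gamma> t * (\<beta>\<^sup>2) ^ t) \<le> (1 + 2 * \<beta>) * ?\<Sigma> * (\<Sum>t\<le>m. (\<beta>\<^sup>2) ^ t)"
    using Chebyshev_sum_upper_almost_mono[of "Suc m" \<gamma> "1 + 2 * \<beta>" "\<lambda>t. (\<beta>\<^sup>2) ^ t"]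
      \<gamma>_almost_mono \<beta>_power2_bounds by (simp add: lessThan_Suc_atMost power_decreasing add.commute)
  also have "\<dots> \<le> (1 + 2 * \<beta>) * ?\<Sigma> * (1 / (1 - \<beta>\<^sup>2))"
    using geometric_partial_sum_le[of "\<beta>\<^sup>2" "Suc m"] \<beta>_power2_bounds \<beta>_bounds sum_\<gamma>_pos
    by (intro mult_left_mono) (auto simp: lessThan_Suc_atMost)
  finally have "(\<Sum>t\<le>m. \<gamma> t * (\<beta>\<^sup>2) ^ t) \<le> (1 + 2 * \<beta>) * ?\<Sigma> / (1 - \<beta>\<^sup>2) / (real m + 1)"
    by (subst pos_le_divide_eq) (simp_all add: mult.commute)
  then have "(\<Sum>t\<le>m. \<gamma> t * (\<beta>\<^sup>2) ^ t) * (v / real bt)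
      \<le> (1 + 2 * \<beta>) * ?\<Sigma> / (1 - \<beta>\<^sup>2) / (real m + 1) * (v / real bt)"
    using v by (intro mult_right_mono) auto
  also have "\<dots> = (1 + 2 * \<beta>) * v / (1 + \<beta>) * ?\<Sigma> * (1 / (real bt * (real m + 1) * (1 - \<beta>)))"
    unfolding one_minus_\<beta>_power2 by (simp add: mult_ac)
  finally show ?thesis unfolding inverse_batch_eq_noise_level by (simp add: mult_ac)
qed

definition error_weight :: real where "error_weight = (1 + L\<^sup>2 * \<eta>\<^sup>2) / (2 * L)"

lemma error_weight_bounds: "0 \<le> error_weight" "error_weight \<le> 1 / L"
  unfolding error_weight_def using L L\<eta>_bounds by (auto simp: field_simps)

lemma error_weight_tail:
  assumes "t \<le> m"
  shows "error_weight * (tail t * (L\<^sup>2 * (\<gamma> t)\<^sup>2 / real b)) = \<gamma> t / 2 * (\<delta> - L * \<gamma> t)"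
proof -
  have "\<delta> - L * \<gamma> t = L * \<gamma> t * ((1 + L\<^sup>2 * \<eta>\<^sup>2) * tail t / real b)"
    using \<gamma>_mult_damping[OF assms] assms by (simp add: damping_def algebra_simps)
  then show ?thesis using L by (simp add: error_weight_def power2_eq_square)
qed

context
  fixes E D :: "nat \<Rightarrow> real" and v :: real
  assumes v: "0 \<le> v" and E_0: "E 0 \<le> v / real bt"
    and E_Suc: "\<And>t. t < m \<Longrightarrow>
      E (Suc t) \<le> \<beta>\<^sup>2 * (E t + L\<^sup>2 * (\<gamma> t)\<^sup>2 / real b * D t) + (1 - \<beta>)\<^sup>2 * v / real bh"
begin

lemma error_le_sum_drift:
  assumes t: "t \<le> m"
  shows "E t \<le> (\<beta>\<^sup>2) ^ t * (v / real bt)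
    + (\<Sum>k<t. (\<beta>\<^sup>2) ^ (t - k) * (L\<^sup>2 * (\<gamma> k)\<^sup>2 / real b * D k)) + noise_level * v / (1 + \<beta>)"
proof -
  have "E t \<le> (\<beta>\<^sup>2) ^ t * E 0 + (\<Sum>k<t. (\<beta>\<^sup>2) ^ (t - k) * (L\<^sup>2 * (\<gamma> k)\<^sup>2 / real b * D k))
      + (\<Sum>j<t. (\<beta>\<^sup>2) ^ j) * ((1 - \<beta>)\<^sup>2 * v / real bh)"
    using E_Suc t by (intro affine_recursion_le[where m = m]) auto
  moreover have "(\<beta>\<^sup>2) ^ t * E 0 \<le> (\<beta>\<^sup>2) ^ t * (v / real bt)"
    using E_0 by (intro mult_left_mono) auto
  ultimately show ?thesis using sum_powers_mult_fresh_variance_le[OF v, of t] by linarith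
qed

lemma weighted_error_le:
  "error_weight * (\<Sum>t\<le>m. \<gamma> t * E t)
    \<le> (\<Sum>t\<le>m. \<gamma> t / 2 * (\<delta> - L * \<gamma> t) * D t) + 2 * noise_level * v / L * (\<Sum>t\<le>m. \<gamma> t)"
proof -
  let ?\<Sigma> = "\<Sum>t\<le>m. \<gamma> t" and ?drift = "\<lambda>k. L\<^sup>2 * (\<gamma> k)\<^sup>2 / real b * D k"
  have "\<gamma> t * E t \<le> \<gamma> t * ((\<beta>\<^sup>2) ^ t * (v / real bt)
      + (\<Sum>k<t. (\<beta>\<^sup>2) ^ (t - k) * ?drift k) + noise_level * v / (1 + \<beta>))" if "t \<le> m" for t
    using error_le_sum_drift[OF that] \<gamma>_range[OF that] by (intro mult_left_mono) auto
  then have "(\<Sum>t\<le>m. \<gamma> t * E t) \<le> (\<Sum>t\<le>m. \<gamma> t * ((\<beta>\<^sup>2) ^ t * (v / real bt)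
      + (\<Sum>k<t. (\<beta>\<^sup>2) ^ (t - k) * ?drift k) + noise_level * v / (1 + \<beta>)))"
    by (intro sum_mono) auto
  also have "\<dots> = (\<Sum>t\<le>m. \<gamma> t * (\<beta>\<^sup>2) ^ t) * (v / real bt)
      + (\<Sum>t\<le>m. \<gamma> t * (\<Sum>k<t. (\<beta>\<^sup>2) ^ (t - k) * ?drift k)) + noise_level * v / (1 + \<beta>) * ?\<Sigma>"
    unfolding distrib_left sum.distrib sum_distrib_right sum_distrib_left[of _ \<gamma>]
    by (simp add: mult_ac)
  also have "\<dots> \<le> (1 + 2 * \<beta>) * noise_level * v / (1 + \<beta>) * ?\<Sigma>
      + (\<Sum>k\<le>m. tail k * ?drift k) + noise_level * v / (1 + \<beta>) * ?\<Sigma>"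
    unfolding sum_discounted_past_eq_sum_discounted_future tail_def[symmetric]
    by (intro add_right_mono sum_weighted_powers_mult_initial_variance_le v)
  also have "\<dots> = (\<Sum>k\<le>m. tail k * ?drift k) + 2 * noise_level * v * ?\<Sigma>"
  proof -
    have "(1 + 2 * \<beta>) / (1 + \<beta>) + 1 / (1 + \<beta>) = 2"
      using \<beta>_bounds by (simp add: divide_eq_eq flip: add_divide_distrib)
    then have "((1 + 2 * \<beta>) / (1 + \<beta>) + 1 / (1 + \<beta>)) * (noise_level * v * ?\<Sigma>)
        = 2 * (noise_level * v * ?\<Sigma>)" by simp
    then show ?thesis by (simp add: distrib_right mult.assoc)
  qed
  finally have "error_weight * (\<Sum>t\<le>m. \<gamma> t * E t)
      \<le> error_weight * ((\<Sum>k\<le>m. tail k * ?drift k) + 2 * noise_level * v * ?\<Sigma>)"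
    using error_weight_bounds by (intro mult_left_mono)
  also have "\<dots> = (\<Sum>t\<le>m. \<gamma> t / 2 * (\<delta> - L * \<gamma> t) * D t) + error_weight * (2 * noise_level * v * ?\<Sigma>)"
    unfolding distrib_left sum_distrib_left[of error_weight]
    by (intro arg_cong2[where f = "(+)"] sum.cong refl)
      (simp only: atMost_iff mult.assoc[symmetric]
        error_weight_tail[unfolded mult.assoc[symmetric]])
  also have "error_weight * (2 * noise_level * v * ?\<Sigma>) \<le> 1 / L * (2 * noise_level * v * ?\<Sigma>)"
    using error_weight_bounds noise_level_pos v sum_\<gamma>_pos by (intro mult_right_mono) auto
  finally show ?thesis by (simp add: mult_ac)
qed

end

end

locale hsgd_tuned_parameters = hsgd_parameters L \<eta> \<delta> \<beta> \<gamma> m b bh bt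
  for L \<eta> \<delta> \<beta> \<gamma> m b bh bt +
  fixes \<sigma> \<epsilon> c\<^sub>1 :: real
  assumes \<sigma>: "0 \<le> \<sigma>" and \<epsilon>: "0 < \<epsilon>" and c\<^sub>1: "1 / (real m + 1) < c\<^sub>1" and bh_eq: "bh = b"
    and b_le: "real b \<le> 2 * sqrt (6 * \<delta>) / (L * sqrt L * \<eta> * \<epsilon>)"
    and bt_eq: "real bt = 24 * c\<^sub>1 / (L\<^sup>2 * \<eta>\<^sup>2 * \<epsilon>\<^sup>2) * max (\<sigma>\<^sup>2) 1"
    and m_eq: "real m + 1 = 24 / (c\<^sub>1 * L\<^sup>2 * \<eta>\<^sup>2 * real b * \<epsilon>\<^sup>2) * max (\<sigma>\<^sup>2) 1"
begin

definition \<sigma>\<^sub>1 :: real where "\<sigma>\<^sub>1 = max 1 \<sigma>"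

definition scaled_\<epsilon> :: real where "scaled_\<epsilon> = L * \<eta> * \<epsilon>"

lemma parameters_pos: "0 < \<sigma>\<^sub>1" "0 < scaled_\<epsilon>" "0 < c\<^sub>1" "0 < real b"
proof -
  have "0 < 1 / (real m + 1)" by simp
  then show "0 < c\<^sub>1" using c\<^sub>1 by (rule less_trans)
qed (use L \<eta> \<epsilon> batch_sizes in \<open>simp_all add: \<sigma>\<^sub>1_def scaled_\<epsilon>_def\<close>)

lemma \<sigma>\<^sub>1_power2: "max (\<sigma>\<^sup>2) 1 = \<sigma>\<^sub>1\<^sup>2"
  using \<sigma> power_mono[of 1 \<sigma> 2] power_mono[of \<sigma> 1 2] by (cases "1 \<le> \<sigma>") (auto simp: \<sigma>\<^sub>1_def)

lemma bt_eq_\<sigma>\<^sub>1: "real bt = 24 * c\<^sub>1 * \<sigma>\<^sub>1\<^sup>2 / scaled_\<epsilon>\<^sup>2"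
  by (simp add: bt_eq \<sigma>\<^sub>1_power2 scaled_\<epsilon>_def power_mult_distrib)

lemma m_eq_\<sigma>\<^sub>1: "real m + 1 = 24 * \<sigma>\<^sub>1\<^sup>2 / (c\<^sub>1 * real b * scaled_\<epsilon>\<^sup>2)"
  by (simp add: m_eq \<sigma>\<^sub>1_power2 scaled_\<epsilon>_def power_mult_distrib mult_ac)

lemma initial_batch_ratio: "real bt / (real m + 1) = c\<^sub>1\<^sup>2 * real b"
  unfolding bt_eq_\<sigma>\<^sub>1 m_eq_\<sigma>\<^sub>1 using parameters_pos by (simp add: power2_eq_square)

lemma noise_level_eq: "noise_level = scaled_\<epsilon>\<^sup>2 / (24 * \<sigma>\<^sub>1\<^sup>2)"
proof -
  have "real bh * real bt * (real m + 1) = (24 * \<sigma>\<^sub>1\<^sup>2 / scaled_\<epsilon>\<^sup>2)\<^sup>2"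
    unfolding bh_eq bt_eq_\<sigma>\<^sub>1 m_eq_\<sigma>\<^sub>1 using parameters_pos by (simp add: power2_eq_square)
  then show ?thesis using parameters_pos by (simp add: noise_level_def)
qed

lemma noise_le: "8 * \<sigma>\<^sup>2 / (L\<^sup>2 * \<eta>\<^sup>2) * noise_level \<le> \<epsilon>\<^sup>2 / 3"
proof -
  have "8 * \<sigma>\<^sup>2 / (L\<^sup>2 * \<eta>\<^sup>2) * noise_level = \<epsilon>\<^sup>2 / 3 * (\<sigma>\<^sup>2 / \<sigma>\<^sub>1\<^sup>2)"
    unfolding noise_level_eq scaled_\<epsilon>_def using L \<eta> by (simp add: power_mult_distrib)
  also have "\<dots> \<le> \<epsilon>\<^sup>2 / 3 * 1"
    using \<sigma> parameters_pos(1) by (intro mult_left_mono) (auto simp: \<sigma>\<^sub>1_def intro: power_mono)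
  finally show ?thesis by simp
qed

lemma damping_scale_eq_\<sigma>\<^sub>1: "damping_scale = 2 * sqrt 6 * \<sigma>\<^sub>1 * sqrt (L * \<delta>) / (scaled_\<epsilon> * real b)"
proof -
  have "1 - \<beta> = real b * (scaled_\<epsilon>\<^sup>2 / (24 * \<sigma>\<^sub>1\<^sup>2))"
    using one_minus_\<beta>[unfolded noise_level_eq] bh_eq by simp
  then have "L * \<delta> / (real b * (1 - \<beta>)) = (L * \<delta>) * (24 * (\<sigma>\<^sub>1 / (scaled_\<epsilon> * real b))\<^sup>2)"
    by (simp add: power2_eq_square)
  then have "damping_scale = sqrt (L * \<delta>) * (sqrt 24 * (\<sigma>\<^sub>1 / (scaled_\<epsilon> * real b)))"
    unfolding damping_scale_def using parameters_pos by (simp add: real_sqrt_mult)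
  moreover have "sqrt 24 = 2 * sqrt 6" using real_sqrt_mult[of 4 6] by simp
  ultimately show ?thesis by simp
qed

lemma L_le_damping_scale: "L \<le> damping_scale"
proof -
  have "real b * (L * sqrt L * \<eta> * \<epsilon>) \<le> 2 * sqrt (6 * \<delta>)"
    using b_le L \<eta> \<epsilon> by (simp add: pos_le_divide_eq)
  then have "sqrt L * (real b * (L * sqrt L * \<eta> * \<epsilon>)) \<le> sqrt L * (2 * sqrt (6 * \<delta>))"
    using L by (intro mult_left_mono) auto
  also have "sqrt L * (real b * (L * sqrt L * \<eta> * \<epsilon>)) = (sqrt L * sqrt L) * (real b * scaled_\<epsilon>)"
    unfolding scaled_\<epsilon>_def by (simp only: mult_ac)
  also have "sqrt L * (2 * sqrt (6 * \<delta>)) = 1 * (2 * sqrt 6 * sqrt (L * \<delta>))"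
    by (simp add: real_sqrt_mult)
  also have "\<dots> \<le> \<sigma>\<^sub>1 * (2 * sqrt 6 * sqrt (L * \<delta>))"
    using L \<delta>_pos by (intro mult_right_mono) (auto simp: \<sigma>\<^sub>1_def)
  finally show ?thesis
    unfolding damping_scale_eq_\<sigma>\<^sub>1 using L parameters_pos by (simp add: pos_le_divide_eq mult_ac)
qed

lemma optimization_factor_le:
  "4 * sqrt 2 * (L + damping_scale) / (L * \<eta>\<^sup>2 * \<delta>) \<le> iteration_factor \<sigma> \<epsilon> * (\<epsilon>\<^sup>2 / 3)"
proof -
  define q where "q = sqrt (L * \<delta>)"
  have q: "0 < q" "L * \<delta> = q * q" using L \<delta>_pos by (auto simp: q_def)
  have "sqrt 2 * sqrt 6 = 2 * sqrt 3"
    using real_sqrt_mult[of 2 6] real_sqrt_mult[of 4 3] by simp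
  have "4 * sqrt 2 * (L + damping_scale) / (L * \<eta>\<^sup>2 * \<delta>)
      \<le> 4 * sqrt 2 * (damping_scale + damping_scale) / (L * \<eta>\<^sup>2 * \<delta>)"
    using L_le_damping_scale L \<delta>_pos by (intro divide_right_mono mult_left_mono) auto
  also have "\<dots> = 16 * (sqrt 2 * sqrt 6) * \<sigma>\<^sub>1 * q / (scaled_\<epsilon> * real b) / (\<eta>\<^sup>2 * (L * \<delta>))"
    unfolding damping_scale_eq_\<sigma>\<^sub>1 q_def by (simp add: mult_ac)
  also have "\<dots> = 32 * sqrt 3 * \<sigma>\<^sub>1 / (scaled_\<epsilon> * real b * \<eta>\<^sup>2 * q)"
    unfolding \<open>sqrt 2 * sqrt 6 = 2 * sqrt 3\<close> q(2) using q(1) by simp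
  also have "\<dots> = iteration_factor \<sigma> \<epsilon> * (\<epsilon>\<^sup>2 / 3)"
    unfolding iteration_factor_def \<sigma>\<^sub>1_def[symmetric] q_def[symmetric] scaled_\<epsilon>_def
    using L \<eta> \<epsilon> q(1) parameters_pos by (simp add: field_simps power2_eq_square power3_eq_cube)
  finally show ?thesis .
qed

lemma num_grad_floor_le:
  "num_grad bt b m (real_of_int \<lfloor>iteration_factor \<sigma> \<epsilon> * \<Delta>\<rfloor> / (real m + 1))
    \<le> (c\<^sub>1\<^sup>2 + 3) * (96 * sqrt 3 * max 1 \<sigma> / (\<eta> ^ 3 * L * sqrt (L * \<delta>) * \<epsilon> ^ 3)) * \<Delta>"
proof -
  have "num_grad bt b m (T / (real m + 1)) = (real bt / (real m + 1) + 3 * real b) * T" for T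
    by (simp add: num_grad_def add_divide_distrib distrib_right)
  then have "num_grad bt b m (real_of_int \<lfloor>iteration_factor \<sigma> \<epsilon> * \<Delta>\<rfloor> / (real m + 1))
      = (c\<^sub>1\<^sup>2 + 3) * real b * real_of_int \<lfloor>iteration_factor \<sigma> \<epsilon> * \<Delta>\<rfloor>"
    by (simp only: initial_batch_ratio distrib_right)
  also have "\<dots> \<le> (c\<^sub>1\<^sup>2 + 3) * real b * (iteration_factor \<sigma> \<epsilon> * \<Delta>)"
    by (intro mult_left_mono) auto
  also have "\<dots> = (c\<^sub>1\<^sup>2 + 3) * (96 * sqrt 3 * max 1 \<sigma> / (\<eta> ^ 3 * L * sqrt (L * \<delta>) * \<epsilon> ^ 3)) * \<Delta>"
    unfolding iteration_factor_def using parameters_pos(4) by (simp add: mult_ac)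
  finally show ?thesis .
qed

end

section \<open>One proximal gradient step\<close>

lemma inner_le_weighted_squares:
  fixes e d :: "'a::real_inner"
  assumes "0 < c"
  shows "inner e d \<le> (norm e)\<^sup>2 / (2 * c) + c / 2 * (norm d)\<^sup>2"
proof -
  have "0 \<le> (norm (e - c *\<^sub>R d))\<^sup>2 / (2 * c)" using assms by simp
  also have "\<dots> = (norm e)\<^sup>2 / (2 * c) - inner e d + c / 2 * (norm d)\<^sup>2"
    unfolding power2_norm_eq_inner using assms
    by (simp add: inner_diff_left inner_diff_right inner_commute field_simps)
  finally show ?thesis by simp
qed

locale composite_problem = closed_proper_convex \<psi> for \<psi> :: "'a::euclidean_space \<Rightarrow> ereal" +
  fixes P :: "'z measure" and fs :: "'z \<Rightarrow> 'a \<Rightarrow> real" and f :: "'a \<Rightarrow> real" and L \<sigma> :: real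
  assumes prob_space_P: "prob_space P"
    and grad_continuous: "\<And>z. z \<in> space P \<Longrightarrow> continuous_on UNIV (grad (fs z))"
    and f_differentiable: "\<And>x. f differentiable (at x)"
    and grad_integrable: "\<And>x. integrable P (\<lambda>z. grad (fs z) x)"
    and grad_unbiased: "\<And>x. (LINT z|P. grad (fs z) x) = grad f x"
    and L_pos: "0 < L"
    and mean_square_lipschitz: "\<And>x y. x \<in> edom \<psi> \<Longrightarrow> y \<in> edom \<psi> \<Longrightarrow>
      second_moment P (\<lambda>z. grad (fs z) x - grad (fs z) y) \<le> ennreal (L\<^sup>2 * (norm (x - y))\<^sup>2)"
    and bounded_variance: "\<And>x. x \<in> edom \<psi> \<Longrightarrow>
      second_moment P (\<lambda>z. grad (fs z) x - grad f x) \<le> ennreal (\<sigma>\<^sup>2)"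
begin

sublocale P: prob_space P
  by (rule prob_space_P)

abbreviation \<Phi> :: "'a \<Rightarrow> real" where "\<Phi> x \<equiv> f x + \<psi>\<^sub>r x"

lemma borel_measurable_grad_sample:
  assumes "\<zeta> \<in> N \<rightarrow>\<^sub>M P" "X \<in> borel_measurable N"
  shows "(\<lambda>w. grad (fs (\<zeta> w)) (X w)) \<in> borel_measurable N"
proof -
  have "(\<lambda>(z, x). grad (fs z) x) \<in> borel_measurable (P \<Otimes>\<^sub>M borel)"
    using grad_integrable grad_continuous by (intro borel_measurable_pair_continuous_snd) auto
  from measurable_compose[OF measurable_Pair[OF assms] this] show ?thesis by simp
qed

lemma borel_measurable_grad_f:
  assumes "X \<in> borel_measurable N"
  shows "(\<lambda>w. grad f (X w)) \<in> borel_measurable N"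
proof -
  have "(\<lambda>(x, z). grad (fs z) x) \<in> borel_measurable (borel \<Otimes>\<^sub>M P)"
    unfolding case_prod_beta by (rule borel_measurable_grad_sample) auto
  then have "(\<lambda>x. LINT z|P. grad (fs z) x) \<in> borel_measurable borel"
    by (rule P.borel_measurable_lebesgue_integral)
  then have "grad f \<in> borel_measurable borel" by (simp add: grad_unbiased)
  then show ?thesis by (rule measurable_compose[OF assms])
qed

lemma grad_f_lipschitz:
  assumes "x \<in> edom \<psi>" "y \<in> edom \<psi>"
  shows "norm (grad f x - grad f y) \<le> L * norm (x - y)"
proof -
  have "ennreal ((norm (grad f x - grad f y))\<^sup>2)
      \<le> second_moment P (\<lambda>z. grad (fs z) x - grad (fs z) y)"
    using P.norm_expectation_power2_le_second_moment[of "\<lambda>z. grad (fs z) x - grad (fs z) y"]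
    by (simp add: grad_integrable grad_unbiased)
  also have "\<dots> \<le> ennreal (L\<^sup>2 * (norm (x - y))\<^sup>2)" by (rule mean_square_lipschitz[OF assms])
  finally have "(norm (grad f x - grad f y))\<^sup>2 \<le> (L * norm (x - y))\<^sup>2"
    by (simp add: power_mult_distrib)
  then show ?thesis using L_pos by (simp add: power2_le_iff_abs_le)
qed

lemma gradient_difference_variance:
  assumes "x \<in> edom \<psi>" "y \<in> edom \<psi>"
  shows "second_moment P (\<lambda>z. grad (fs z) x - grad (fs z) y - (grad f x - grad f y))
    \<le> ennreal (L\<^sup>2 * (norm (x - y))\<^sup>2)"
proof -
  have "second_moment P (\<lambda>z. grad (fs z) x - grad (fs z) y - (grad f x - grad f y))
      \<le> second_moment P (\<lambda>z. grad (fs z) x - grad (fs z) y)"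
    using P.second_moment_centered_le[of "\<lambda>z. grad (fs z) x - grad (fs z) y"]
    by (simp add: grad_integrable grad_unbiased)
  also have "\<dots> \<le> ennreal (L\<^sup>2 * (norm (x - y))\<^sup>2)" by (rule mean_square_lipschitz[OF assms])
  finally show ?thesis .
qed

lemma borel_measurable_grad_map:
  assumes "0 < \<eta>" and X: "X \<in> borel_measurable N"
  shows "(\<lambda>w. grad_map f \<psi> \<eta> (X w)) \<in> borel_measurable N"
  unfolding grad_map_def
  by (intro borel_measurable_scaleR borel_measurable_diff borel_measurable_prox
      borel_measurable_grad_f borel_measurable_const assms)

lemma norm_grad_map_le:
  assumes \<eta>: "0 < \<eta>" and x: "x \<in> edom \<psi>" and y: "y \<in> edom \<psi>"
  shows "norm (grad_map f \<psi> \<eta> x) \<le> norm (grad_map f \<psi> \<eta> y) + (2 / \<eta> + L) * norm (x - y)"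
proof -
  let ?d = "\<lambda>x. prox_direction \<eta> x (grad f x)"
  have "norm (?d x) \<le> norm (?d y) + norm (?d x - ?d y)" by (rule norm_triangle_sub)
  also have "norm (?d x - ?d y) \<le> 2 * norm (x - y) + \<eta> * norm (grad f x - grad f y)"
    by (rule norm_prox_direction_diff_le[OF \<eta>])
  also have "\<dots> \<le> 2 * norm (x - y) + \<eta> * (L * norm (x - y))"
    using grad_f_lipschitz[OF x y] \<eta> by (intro add_left_mono mult_left_mono) auto
  finally show ?thesis using \<eta> by (simp add: grad_map_eq_prox_direction field_simps)
qed

lemma norm_prox_direction_add_grad_map_le:
  assumes "0 < \<eta>"
  shows "norm (prox_direction \<eta> x v + \<eta> *\<^sub>R grad_map f \<psi> \<eta> x) \<le> \<eta> * norm (v - grad f x)"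
  using norm_prox_direction_diff_le[OF assms, of x v x "grad f x"] assms
  by (simp add: grad_map_eq_prox_direction)

lemma grad_map_power2_le:
  assumes \<eta>: "0 < \<eta>"
  shows "\<eta>\<^sup>2 * (norm (grad_map f \<psi> \<eta> x))\<^sup>2
    \<le> 2 * (norm (prox_direction \<eta> x v))\<^sup>2 + 2 * \<eta>\<^sup>2 * (norm (v - grad f x))\<^sup>2"
proof -
  let ?d = "prox_direction \<eta> x v" and ?g = "\<eta> *\<^sub>R grad_map f \<psi> \<eta> x"
  have "\<eta>\<^sup>2 * (norm (grad_map f \<psi> \<eta> x))\<^sup>2 = (norm (- ?d + (?d + ?g)))\<^sup>2"
    by (simp add: power_mult_distrib)
  also have "\<dots> \<le> 2 * (norm (- ?d))\<^sup>2 + 2 * (norm (?d + ?g))\<^sup>2" by (rule norm_add_power2_le)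
  also have "(norm (?d + ?g))\<^sup>2 \<le> (\<eta> * norm (v - grad f x))\<^sup>2"
    by (intro power_mono norm_prox_direction_add_grad_map_le \<eta>) simp
  finally show ?thesis by (simp add: power_mult_distrib)
qed

lemma \<Phi>_step_le:
  fixes x v :: 'a
  assumes \<eta>: "0 < \<eta>" and t: "0 \<le> t" "t \<le> 1" and x: "x \<in> edom \<psi>"
  defines "d \<equiv> prox_direction \<eta> x v"
  shows "\<Phi> (x + t *\<^sub>R d)
    \<le> \<Phi> x + t * ((norm (v - grad f x))\<^sup>2 / (2 * L) - (1 / \<eta> - L / 2 - L * t / 2) * (norm d)\<^sup>2)"
proof -
  define e where "e = v - grad f x"
  have "x + t *\<^sub>R d \<in> edom \<psi>"
    unfolding d_def by (rule prox_direction_step_in_edom[OF \<eta> t x])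
  then have smooth: "f (x + t *\<^sub>R d) \<le> f x + t * inner (grad f x) d + L / 2 * (t\<^sup>2 * (norm d)\<^sup>2)"
    using lipschitz_grad_imp_quadratic_upper_bound[OF convex_edom x _ f_differentiable
        grad_f_lipschitz]
    by (fastforce simp: power_mult_distrib)
  have "t * inner (- e) d \<le> t * ((norm e)\<^sup>2 / (2 * L) + L / 2 * (norm d)\<^sup>2)"
    using inner_le_weighted_squares[OF L_pos, of "- e" d] t by (intro mult_left_mono) auto
  then have "t * inner (grad f x) d - t * inner v d
      \<le> t * ((norm e)\<^sup>2 / (2 * L) + L / 2 * (norm d)\<^sup>2)"
    by (simp add: e_def inner_diff_left algebra_simps)
  moreover have "\<psi>\<^sub>r (x + t *\<^sub>R d) \<le> \<psi>\<^sub>r x - t * ((norm d)\<^sup>2 / \<eta> + inner v d)"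
    unfolding d_def by (rule prox_direction_decrease[OF \<eta> t x])
  ultimately have "\<Phi> (x + t *\<^sub>R d) \<le> \<Phi> x + t * ((norm e)\<^sup>2 / (2 * L) + L / 2 * (norm d)\<^sup>2)
      - t * ((norm d)\<^sup>2 / \<eta>) + L / 2 * (t\<^sup>2 * (norm d)\<^sup>2)"
    using smooth by (simp add: algebra_simps)
  then show ?thesis by (simp add: e_def algebra_simps power2_eq_square)
qed

lemma prox_gradient_step_descent:
  fixes x v :: 'a
  assumes \<eta>: "0 < \<eta>" and t: "0 \<le> t" "t \<le> 1" and x: "x \<in> edom \<psi>"
  defines "d \<equiv> prox_direction \<eta> x v"
  shows "\<Phi> (x + t *\<^sub>R d) + L * \<eta>\<^sup>2 / 4 * t * (norm (grad_map f \<psi> \<eta> x))\<^sup>2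
      + t / 2 * (2 / \<eta> - 2 * L - L * t) * (norm d)\<^sup>2
    \<le> \<Phi> x + (1 + L\<^sup>2 * \<eta>\<^sup>2) / (2 * L) * t * (norm (v - grad f x))\<^sup>2"
proof -
  define e where "e = v - grad f x"
  have "L / 4 * t * (\<eta>\<^sup>2 * (norm (grad_map f \<psi> \<eta> x))\<^sup>2)
      \<le> L / 4 * t * (2 * (norm d)\<^sup>2 + 2 * \<eta>\<^sup>2 * (norm e)\<^sup>2)"
    using grad_map_power2_le[OF \<eta>, of x v] t L_pos
    unfolding d_def e_def by (intro mult_left_mono) auto
  then have "\<Phi> (x + t *\<^sub>R d) + L * \<eta>\<^sup>2 / 4 * t * (norm (grad_map f \<psi> \<eta> x))\<^sup>2
      \<le> \<Phi> x + t * ((norm e)\<^sup>2 / (2 * L) - (1 / \<eta> - L / 2 - L * t / 2) * (norm d)\<^sup>2)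
        + L / 4 * t * (2 * (norm d)\<^sup>2 + 2 * \<eta>\<^sup>2 * (norm e)\<^sup>2)"
    using \<Phi>_step_le[OF \<eta> t x, of v] unfolding d_def e_def by (simp add: mult_ac)
  also have "\<dots> = \<Phi> x + (1 + L\<^sup>2 * \<eta>\<^sup>2) / (2 * L) * t * (norm e)\<^sup>2
      - t / 2 * (2 / \<eta> - 2 * L - L * t) * (norm d)\<^sup>2"
    using L_pos \<eta> by (simp add: field_simps power2_eq_square)
  finally show ?thesis by (simp add: e_def)
qed

end

section \<open>The iterates and their estimation error\<close>

lemma hsgd_cong:
  assumes "\<And>i. i < bt \<Longrightarrow> Z (Init s i) = Z' (Init s i)"
    and "\<And>u i. 1 \<le> u \<Longrightarrow> u \<le> t \<Longrightarrow> i < b \<Longrightarrow> Z (Diff s u i) = Z' (Diff s u i)"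
    and "\<And>u i. 1 \<le> u \<Longrightarrow> u \<le> t \<Longrightarrow> i < bh \<Longrightarrow> Z (Fresh s u i) = Z' (Fresh s u i)"
  shows "hsgd_x fs \<psi> \<eta> \<beta> \<gamma> bt b bh Z s x0 t = hsgd_x fs \<psi> \<eta> \<beta> \<gamma> bt b bh Z' s x0 t \<and>
    hsgd_v fs \<psi> \<eta> \<beta> \<gamma> bt b bh Z s x0 t = hsgd_v fs \<psi> \<eta> \<beta> \<gamma> bt b bh Z' s x0 t"
  using assms
proof (induction t)
  case (Suc t)
  have IH: "hsgd_x fs \<psi> \<eta> \<beta> \<gamma> bt b bh Z s x0 t = hsgd_x fs \<psi> \<eta> \<beta> \<gamma> bt b bh Z' s x0 t"
    "hsgd_v fs \<psi> \<eta> \<beta> \<gamma> bt b bh Z s x0 t = hsgd_v fs \<psi> \<eta> \<beta> \<gamma> bt b bh Z' s x0 t"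
    using Suc by auto
  show ?case using Suc.prems by (simp add: IH del: sum_subtractf)
qed simp

lemma finite_sample_labels: "finite (sample_labels S m bt b bh)"
proof -
  have "sample_labels S m bt b bh \<subseteq> (\<Union>s\<in>{1..S}. Init s ` {..<bt})
      \<union> (\<Union>s\<in>{1..S}. \<Union>t\<in>{1..m}. Diff s t ` {..<b}) \<union> (\<Union>s\<in>{1..S}. \<Union>t\<in>{1..m}. Fresh s t ` {..<bh})"
    unfolding sample_labels_def by (intro Un_mono) (blast intro: lessThan_iff[THEN iffD2])+
  then show ?thesis by (rule finite_subset) simp
qed

lemma scaleR_sum_diff_const:
  fixes g :: "nat \<Rightarrow> 'a::real_vector"
  assumes "1 \<le> n"
  shows "(c / real n) *\<^sub>R (\<Sum>i<n. g i - a) = (c / real n) *\<^sub>R (\<Sum>i<n. g i) - c *\<^sub>R a"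
  using assms by (simp add: sum_subtractf scaleR_diff_right sum_constant_scaleR)

locale hsgd_rs =
  composite_problem \<psi> P fs f L \<sigma> + hsgd_parameters L \<eta> \<delta> \<beta> \<gamma> m b bh bt
  for \<psi> :: "'a::euclidean_space \<Rightarrow> ereal" and P :: "'z measure"
    and fs f L \<sigma> \<eta> \<delta> \<beta> \<gamma> m b bh bt +
  fixes S :: nat and xb0 :: 'a and \<Phi>\<^sub>m\<^sub>i\<^sub>n :: real
  assumes xb0_in_edom: "xb0 \<in> edom \<psi>"
    and \<Phi>_ge: "\<And>x. x \<in> edom \<psi> \<Longrightarrow> \<Phi>\<^sub>m\<^sub>i\<^sub>n \<le> f x + real_of_ereal (\<psi> x)"
begin

abbreviation "labels \<equiv> sample_labels S m bt b bh"

abbreviation "\<Omega> \<equiv> PiM labels (\<lambda>_. P)"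

abbreviation xbar :: "nat \<Rightarrow> (sample_label \<Rightarrow> 'z) \<Rightarrow> 'a" where
  "xbar s Z \<equiv> rs_xbar fs \<psi> \<eta> \<beta> \<gamma> m bt b bh Z xb0 s"

abbreviation iterate :: "nat \<Rightarrow> nat \<Rightarrow> (sample_label \<Rightarrow> 'z) \<Rightarrow> 'a" where
  "iterate s t Z \<equiv> rs_iterate fs \<psi> \<eta> \<beta> \<gamma> m bt b bh Z xb0 s t"

definition estimator :: "nat \<Rightarrow> nat \<Rightarrow> (sample_label \<Rightarrow> 'z) \<Rightarrow> 'a" where
  "estimator s t Z = hsgd_v fs \<psi> \<eta> \<beta> \<gamma> bt b bh Z s (xbar (s - 1) Z) t"

definition error :: "nat \<Rightarrow> nat \<Rightarrow> (sample_label \<Rightarrow> 'z) \<Rightarrow> 'a" where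
  "error s t Z = estimator s t Z - grad f (iterate s t Z)"

definition direction :: "nat \<Rightarrow> nat \<Rightarrow> (sample_label \<Rightarrow> 'z) \<Rightarrow> 'a" where
  "direction s t Z = prox_direction \<eta> (iterate s t Z) (estimator s t Z)"

sublocale \<Omega>: prob_space \<Omega>
  by (intro prob_space_PiM prob_space_P)

lemma iterate_0: "iterate s 0 Z = xbar (s - 1) Z"
  by (simp add: rs_iterate_def)

lemma iterate_Suc: "iterate s (Suc t) Z = iterate s t Z + \<gamma> t *\<^sub>R direction s t Z"
  by (simp add: rs_iterate_def direction_def estimator_def prox_direction_def algebra_simps)

lemma xbar_Suc: "xbar (Suc s) Z = iterate (Suc s) (Suc m) Z"
  by (simp add: rs_iterate_def)

lemma estimator_0:
  "estimator s 0 Z = (1 / real bt) *\<^sub>R (\<Sum>i<bt. grad (fs (Z (Init s i))) (iterate s 0 Z))"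
  by (simp add: estimator_def rs_iterate_def)

lemma estimator_Suc:
  "estimator s (Suc t) Z = \<beta> *\<^sub>R estimator s t Z
    + (\<beta> / real b) *\<^sub>R (\<Sum>i<b. grad (fs (Z (Diff s (Suc t) i))) (iterate s (Suc t) Z)
        - grad (fs (Z (Diff s (Suc t) i))) (iterate s t Z))
    + ((1 - \<beta>) / real bh) *\<^sub>R (\<Sum>i<bh. grad (fs (Z (Fresh s (Suc t) i))) (iterate s (Suc t) Z))"
  by (simp add: estimator_def rs_iterate_def del: hsgd_x.simps)

lemma iterate_in_edom_if_xbar:
  "xbar (s - 1) Z \<in> edom \<psi> \<Longrightarrow> t \<le> Suc m \<Longrightarrow> iterate s t Z \<in> edom \<psi>"
proof (induction t)
  case (Suc t)
  then have "0 \<le> \<gamma> t" "\<gamma> t \<le> 1" using \<gamma>_range[of t] by auto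
  then show ?case
    unfolding iterate_Suc direction_def using Suc \<eta>(1) by (intro prox_direction_step_in_edom) auto
qed (simp add: iterate_0)

lemma xbar_in_edom: "xbar s Z \<in> edom \<psi>"
proof (induction s)
  case (Suc s)
  then show ?case unfolding xbar_Suc by (intro iterate_in_edom_if_xbar) auto
qed (simp add: xb0_in_edom)

lemma iterate_in_edom: "t \<le> Suc m \<Longrightarrow> iterate s t Z \<in> edom \<psi>"
  by (rule iterate_in_edom_if_xbar[OF xbar_in_edom])

definition drawn :: "nat \<Rightarrow> nat \<Rightarrow> sample_label set" where
  "drawn s t = {l \<in> labels. case l of Init s' _ \<Rightarrow> s' \<le> s
     | Diff s' t' _ \<Rightarrow> s' < s \<or> s' = s \<and> t' \<le> t | Fresh s' t' _ \<Rightarrow> s' < s \<or> s' = s \<and> t' \<le> t}"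

lemma drawn_previous_stage_subset: "s' < s \<Longrightarrow> drawn s' t' \<subseteq> drawn s t"
  by (auto simp: drawn_def split: sample_label.splits)

lemma stage_cong:
  assumes "s \<in> {1..S}" "t \<le> m" "xbar (s - 1) Z = xbar (s - 1) Z'"
    and "\<And>l. l \<in> drawn s t \<Longrightarrow> Z l = Z' l"
  shows "iterate s t Z = iterate s t Z' \<and> estimator s t Z = estimator s t Z'"
proof -
  have "hsgd_x fs \<psi> \<eta> \<beta> \<gamma> bt b bh Z s x0 t = hsgd_x fs \<psi> \<eta> \<beta> \<gamma> bt b bh Z' s x0 t \<and>
    hsgd_v fs \<psi> \<eta> \<beta> \<gamma> bt b bh Z s x0 t = hsgd_v fs \<psi> \<eta> \<beta> \<gamma> bt b bh Z' s x0 t" for x0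
    using assms(1,2) by (intro hsgd_cong assms(4)) (auto simp: drawn_def sample_labels_def)
  then show ?thesis unfolding estimator_def rs_iterate_def assms(3) by blast
qed

lemma xbar_cong:
  assumes "s \<le> S" "\<And>l. l \<in> drawn s m \<Longrightarrow> Z l = Z' l"
  shows "xbar s Z = xbar s Z'"
  using assms
proof (induction s)
  case (Suc s)
  then have "xbar s Z = xbar s Z'"
    using drawn_previous_stage_subset[of s "Suc s" m m] by auto
  then have "iterate (Suc s) m Z = iterate (Suc s) m Z'
      \<and> estimator (Suc s) m Z = estimator (Suc s) m Z'"
    using Suc.prems by (intro stage_cong) auto
  then show ?case by (simp only: xbar_Suc iterate_Suc direction_def)
qed simp

lemma
  assumes s: "s \<in> {1..S}" and t: "t \<le> m" and Z: "\<And>l. l \<in> drawn s t \<Longrightarrow> Z l = Z' l"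
  shows iterate_cong: "iterate s t Z = iterate s t Z'"
    and iterate_Suc_cong: "iterate s (Suc t) Z = iterate s (Suc t) Z'"
    and error_cong: "error s t Z = error s t Z'"
proof -
  have "xbar (s - 1) Z = xbar (s - 1) Z'"
    using s drawn_previous_stage_subset[of "s - 1" s m t] by (intro xbar_cong Z) auto
  from stage_cong[OF s t this Z] show "iterate s t Z = iterate s t Z'"
    and "iterate s (Suc t) Z = iterate s (Suc t) Z'" and "error s t Z = error s t Z'"
    by (auto simp: iterate_Suc direction_def error_def)
qed

lemma iterate_0_update:
  assumes s: "s \<in> {1..S}"
  shows "iterate s 0 (Z(Init s i := z)) = iterate s 0 Z"
  unfolding iterate_0 using s by (intro xbar_cong) (auto simp: drawn_def)

lemma
  assumes "s \<in> {1..S}" "t \<le> m" and l: "l \<notin> drawn s t"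
  shows iterate_update: "iterate s t (Z(l := z)) = iterate s t Z"
    and iterate_Suc_update: "iterate s (Suc t) (Z(l := z)) = iterate s (Suc t) Z"
    and error_update: "error s t (Z(l := z)) = error s t Z"
proof -
  have "(Z(l := z)) k = Z k" if "k \<in> drawn s t" for k using l that by auto
  with assms(1,2) show "iterate s t (Z(l := z)) = iterate s t Z"
    and "iterate s (Suc t) (Z(l := z)) = iterate s (Suc t) Z"
    and "error s t (Z(l := z)) = error s t Z"
    by (blast intro: iterate_cong iterate_Suc_cong error_cong)+
qed

lemma measurable_sample: "l \<in> labels \<Longrightarrow> (\<lambda>Z. Z l) \<in> \<Omega> \<rightarrow>\<^sub>M P"
  by (rule measurable_component_singleton)

lemma borel_measurable_prox_direction:
  assumes "X \<in> borel_measurable N" "V \<in> borel_measurable N"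
  shows "(\<lambda>w. prox_direction \<eta> (X w) (V w)) \<in> borel_measurable N"
  unfolding prox_direction_def
  by (intro borel_measurable_diff borel_measurable_prox borel_measurable_scaleR
      borel_measurable_const assms \<eta>(1))

lemma borel_measurable_iterate_Suc_if:
  assumes "iterate s t \<in> borel_measurable \<Omega>" "estimator s t \<in> borel_measurable \<Omega>"
  shows "iterate s (Suc t) \<in> borel_measurable \<Omega>"
  unfolding iterate_Suc direction_def
  by (intro borel_measurable_add borel_measurable_scaleR borel_measurable_const
      borel_measurable_prox_direction assms)

lemma borel_measurable_stage:
  assumes s: "s \<in> {1..S}" and start: "xbar (s - 1) \<in> borel_measurable \<Omega>"
  shows "t \<le> m \<Longrightarrow> iterate s t \<in> borel_measurable \<Omega> \<and> estimator s t \<in> borel_measurable \<Omega>"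
proof (induction t)
  case 0
  have "iterate s 0 \<in> borel_measurable \<Omega>" using start by (simp add: iterate_0)
  moreover from this have "estimator s 0 \<in> borel_measurable \<Omega>"
    unfolding estimator_0 using s
    by (intro borel_measurable_scaleR borel_measurable_sum borel_measurable_grad_sample
        measurable_sample borel_measurable_const) (auto simp: sample_labels_def)
  ultimately show ?case ..
next
  case (Suc t)
  then have IH: "iterate s t \<in> borel_measurable \<Omega>" "estimator s t \<in> borel_measurable \<Omega>" by auto
  have "iterate s (Suc t) \<in> borel_measurable \<Omega>" by (rule borel_measurable_iterate_Suc_if[OF IH])
  moreover from this have "estimator s (Suc t) \<in> borel_measurable \<Omega>"
    unfolding estimator_Suc using s Suc.prems IH
    by (intro borel_measurable_add borel_measurable_scaleR borel_measurable_sum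
        borel_measurable_diff borel_measurable_grad_sample measurable_sample borel_measurable_const)
      (auto simp: sample_labels_def)
  ultimately show ?case ..
qed

lemma borel_measurable_xbar: "s \<le> S \<Longrightarrow> xbar s \<in> borel_measurable \<Omega>"
proof (induction s)
  case (Suc s)
  then show ?case
    unfolding xbar_Suc using borel_measurable_stage[of "Suc s" m]
    by (intro borel_measurable_iterate_Suc_if) auto
qed simp

lemma
  assumes s: "s \<in> {1..S}" and t: "t \<le> m"
  shows borel_measurable_iterate: "iterate s t \<in> borel_measurable \<Omega>"
    and borel_measurable_iterate_Suc: "iterate s (Suc t) \<in> borel_measurable \<Omega>"
    and borel_measurable_error: "error s t \<in> borel_measurable \<Omega>"
    and borel_measurable_direction: "direction s t \<in> borel_measurable \<Omega>"
proof -
  have "xbar (s - 1) \<in> borel_measurable \<Omega>" using s by (intro borel_measurable_xbar) auto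
  from borel_measurable_stage[OF s this t]
  have meas: "iterate s t \<in> borel_measurable \<Omega>" "estimator s t \<in> borel_measurable \<Omega>" by auto
  then show "iterate s t \<in> borel_measurable \<Omega>" by simp
  from meas show "iterate s (Suc t) \<in> borel_measurable \<Omega>" by (rule borel_measurable_iterate_Suc_if)
  from meas show "error s t \<in> borel_measurable \<Omega>"
    unfolding error_def by (intro borel_measurable_diff borel_measurable_grad_f)
  from meas show "direction s t \<in> borel_measurable \<Omega>"
    unfolding direction_def by (rule borel_measurable_prox_direction)
qed

lemma second_moment_add_gradient_noise_le:
  assumes n: "1 \<le> n" and l: "\<And>i. i < n \<Longrightarrow> l i \<in> labels" "inj_on l {..<n}"
    and U: "U \<in> borel_measurable \<Omega>" "\<And>Z z i. i < n \<Longrightarrow> U (Z(l i := z)) = U Z"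
    and X: "X \<in> borel_measurable \<Omega>" "\<And>Z z i. i < n \<Longrightarrow> X (Z(l i := z)) = X Z"
      "\<And>Z. X Z \<in> edom \<psi>"
  shows "second_moment \<Omega>
      (\<lambda>Z. U Z + (c / real n) *\<^sub>R (\<Sum>i<n. grad (fs (Z (l i))) (X Z) - grad f (X Z)))
    \<le> second_moment \<Omega> U + ennreal (c\<^sup>2 * \<sigma>\<^sup>2 / real n)"
proof -
  let ?H = "\<lambda>Z z. grad (fs z) (X Z) - grad f (X Z)"
  have "second_moment \<Omega> (\<lambda>Z. U Z + (c / real n) *\<^sub>R (\<Sum>i<n. ?H Z (Z (l i))))
      \<le> second_moment \<Omega> U + ennreal (c\<^sup>2 / real n) * (\<integral>\<^sup>+Z. ennreal (\<sigma>\<^sup>2) \<partial>\<Omega>)"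
  proof (rule second_moment_add_fresh_batch_mean[OF prob_space_P finite_sample_labels])
    show "(\<lambda>(Z, z). ?H Z z) \<in> borel_measurable (\<Omega> \<Otimes>\<^sub>M P)"
      unfolding case_prod_beta
      by (intro borel_measurable_diff borel_measurable_grad_sample borel_measurable_grad_f
          measurable_compose[OF measurable_fst X(1)] measurable_snd)
    show "integrable P (?H Z)" for Z by (simp add: grad_integrable)
    show "(LINT z|P. ?H Z z) = 0" for Z by (simp add: grad_integrable grad_unbiased P.prob_space)
    show "second_moment P (?H Z) \<le> ennreal (\<sigma>\<^sup>2)" for Z by (rule bounded_variance[OF X(3)])
    show "?H (Z(l i := z)) = ?H Z" if "i < n" for Z z i by (simp only: X(2)[OF that])
  qed (use n l U in auto)
  then show ?thesis by (simp add: \<Omega>.emeasure_space_1 flip: ennreal_mult)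
qed

lemma second_moment_add_gradient_difference_noise_le:
  assumes n: "1 \<le> n" and l: "\<And>i. i < n \<Longrightarrow> l i \<in> labels" "inj_on l {..<n}"
    and U: "U \<in> borel_measurable \<Omega>" "\<And>Z z i. i < n \<Longrightarrow> U (Z(l i := z)) = U Z"
    and X: "X \<in> borel_measurable \<Omega>" "\<And>Z z i. i < n \<Longrightarrow> X (Z(l i := z)) = X Z"
      "\<And>Z. X Z \<in> edom \<psi>"
    and Y: "Y \<in> borel_measurable \<Omega>" "\<And>Z z i. i < n \<Longrightarrow> Y (Z(l i := z)) = Y Z"
      "\<And>Z. Y Z \<in> edom \<psi>"
  shows "second_moment \<Omega> (\<lambda>Z. U Z + (c / real n) *\<^sub>R (\<Sum>i<n. grad (fs (Z (l i))) (X Z)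
        - grad (fs (Z (l i))) (Y Z) - (grad f (X Z) - grad f (Y Z))))
    \<le> second_moment \<Omega> U + ennreal (c\<^sup>2 * L\<^sup>2 / real n) * second_moment \<Omega> (\<lambda>Z. X Z - Y Z)"
proof -
  let ?H = "\<lambda>Z z. grad (fs z) (X Z) - grad (fs z) (Y Z) - (grad f (X Z) - grad f (Y Z))"
  note [measurable] = X(1) Y(1)
  have "second_moment \<Omega> (\<lambda>Z. U Z + (c / real n) *\<^sub>R (\<Sum>i<n. ?H Z (Z (l i))))
      \<le> second_moment \<Omega> U
        + ennreal (c\<^sup>2 / real n) * (\<integral>\<^sup>+Z. ennreal (L\<^sup>2 * (norm (X Z - Y Z))\<^sup>2) \<partial>\<Omega>)"
  proof (rule second_moment_add_fresh_batch_mean[OF prob_space_P finite_sample_labels])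
    show "(\<lambda>(Z, z). ?H Z z) \<in> borel_measurable (\<Omega> \<Otimes>\<^sub>M P)"
      unfolding case_prod_beta
      by (intro borel_measurable_diff borel_measurable_grad_sample borel_measurable_grad_f
          measurable_compose[OF measurable_fst X(1)] measurable_compose[OF measurable_fst Y(1)]
          measurable_snd)
    show "integrable P (?H Z)" for Z by (simp add: grad_integrable)
    show "(LINT z|P. ?H Z z) = 0" for Z by (simp add: grad_integrable grad_unbiased P.prob_space)
    show "second_moment P (?H Z) \<le> ennreal (L\<^sup>2 * (norm (X Z - Y Z))\<^sup>2)" for Z
      by (rule gradient_difference_variance[OF X(3) Y(3)])
    show "?H (Z(l i := z)) = ?H Z" if "i < n" for Z z i by (simp only: X(2)[OF that] Y(2)[OF that])
  qed (use n l U in auto)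
  also have "(\<integral>\<^sup>+Z. ennreal (L\<^sup>2 * (norm (X Z - Y Z))\<^sup>2) \<partial>\<Omega>)
      = ennreal (L\<^sup>2) * second_moment \<Omega> (\<lambda>Z. X Z - Y Z)"
    unfolding second_moment_def by (simp add: nn_integral_cmult ennreal_mult)
  finally show ?thesis by (simp flip: ennreal_mult mult.assoc)
qed

lemma second_moment_error_0:
  assumes s: "s \<in> {1..S}"
  shows "second_moment \<Omega> (error s 0) \<le> ennreal (\<sigma>\<^sup>2 / real bt)"
proof -
  let ?X = "iterate s 0"
  have "second_moment \<Omega>
        (\<lambda>Z. 0 + (1 / real bt) *\<^sub>R (\<Sum>i<bt. grad (fs (Z (Init s i))) (?X Z) - grad f (?X Z)))
      \<le> second_moment \<Omega> (\<lambda>_. 0::'a) + ennreal (1\<^sup>2 * \<sigma>\<^sup>2 / real bt)"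
    using s batch_sizes
    by (intro second_moment_add_gradient_noise_le iterate_in_edom borel_measurable_iterate)
      (auto simp: sample_labels_def inj_on_def iterate_0_update)
  moreover have "error s 0
      = (\<lambda>Z. 0 + (1 / real bt) *\<^sub>R (\<Sum>i<bt. grad (fs (Z (Init s i))) (?X Z) - grad f (?X Z)))"
    by (simp only: error_def estimator_0 scaleR_sum_diff_const[OF batch_sizes(3)] fun_eq_iff) simp
  ultimately show ?thesis by (simp add: second_moment_def)
qed

definition corrected_error :: "nat \<Rightarrow> nat \<Rightarrow> (sample_label \<Rightarrow> 'z) \<Rightarrow> 'a" where
  "corrected_error s t Z = \<beta> *\<^sub>R error s t Z
    + (\<beta> / real b) *\<^sub>R (\<Sum>i<b. grad (fs (Z (Diff s (Suc t) i))) (iterate s (Suc t) Z)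
        - grad (fs (Z (Diff s (Suc t) i))) (iterate s t Z)
        - (grad f (iterate s (Suc t) Z) - grad f (iterate s t Z)))"

lemma error_Suc_eq:
  "error s (Suc t) Z = corrected_error s t Z + ((1 - \<beta>) / real bh) *\<^sub>R
    (\<Sum>i<bh. grad (fs (Z (Fresh s (Suc t) i))) (iterate s (Suc t) Z) - grad f (iterate s (Suc t) Z))"
  unfolding error_def corrected_error_def estimator_Suc
    scaleR_sum_diff_const[OF batch_sizes(1)] scaleR_sum_diff_const[OF batch_sizes(2)]
  by (simp add: algebra_simps)

lemma borel_measurable_corrected_error:
  assumes s: "s \<in> {1..S}" and t: "t < m"
  shows "corrected_error s t \<in> borel_measurable \<Omega>"
  unfolding corrected_error_def using s t
  by (intro borel_measurable_add borel_measurable_scaleR borel_measurable_sum borel_measurable_diff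
      borel_measurable_const borel_measurable_error borel_measurable_iterate
      borel_measurable_iterate_Suc borel_measurable_grad_sample borel_measurable_grad_f
      measurable_sample) (auto simp: sample_labels_def)

lemma second_moment_corrected_error_le:
  assumes s: "s \<in> {1..S}" and t: "t < m"
  shows "second_moment \<Omega> (corrected_error s t)
    \<le> ennreal (\<beta>\<^sup>2) * second_moment \<Omega> (error s t)
      + ennreal (\<beta>\<^sup>2 * L\<^sup>2 / real b * (\<gamma> t)\<^sup>2) * second_moment \<Omega> (direction s t)"
proof -
  have not_drawn: "Diff s (Suc t) i \<notin> drawn s t" for i by (simp add: drawn_def)
  have t': "t \<le> m" using t by simp
  note update = iterate_update[OF s t' not_drawn] iterate_Suc_update[OF s t' not_drawn]
    error_update[OF s t' not_drawn]
  have "second_moment \<Omega> (corrected_error s t) \<le> second_moment \<Omega> (\<lambda>Z. \<beta> *\<^sub>R error s t Z)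
      + ennreal (\<beta>\<^sup>2 * L\<^sup>2 / real b) * second_moment \<Omega> (\<lambda>Z. iterate s (Suc t) Z - iterate s t Z)"
    unfolding corrected_error_def using s t batch_sizes
    by (intro second_moment_add_gradient_difference_noise_le iterate_in_edom borel_measurable_scaleR
        borel_measurable_const borel_measurable_error borel_measurable_iterate
        borel_measurable_iterate_Suc update arg_cong[where f = "scaleR \<beta>"])
      (auto simp: sample_labels_def inj_on_def)
  also have "second_moment \<Omega> (\<lambda>Z. \<beta> *\<^sub>R error s t Z) = ennreal (\<beta>\<^sup>2) * second_moment \<Omega> (error s t)"
    by (rule second_moment_scaleR[OF borel_measurable_error[OF s t']])
  also have "second_moment \<Omega> (\<lambda>Z. iterate s (Suc t) Z - iterate s t Z)
      = ennreal ((\<gamma> t)\<^sup>2) * second_moment \<Omega> (direction s t)"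
    by (simp add: iterate_Suc second_moment_scaleR borel_measurable_direction[OF s t'])
  finally show ?thesis by (simp add: mult.assoc[symmetric] flip: ennreal_mult)
qed

lemma second_moment_error_Suc:
  assumes s: "s \<in> {1..S}" and t: "t < m"
  shows "second_moment \<Omega> (error s (Suc t))
    \<le> ennreal (\<beta>\<^sup>2) * second_moment \<Omega> (error s t)
      + ennreal (\<beta>\<^sup>2 * L\<^sup>2 / real b * (\<gamma> t)\<^sup>2) * second_moment \<Omega> (direction s t)
      + ennreal ((1 - \<beta>)\<^sup>2 * \<sigma>\<^sup>2 / real bh)"
proof -
  have not_drawn: "Fresh s (Suc t) i \<notin> drawn s t" for i by (simp add: drawn_def)
  have t': "t \<le> m" using t by simp
  note update = iterate_update[OF s t' not_drawn] iterate_Suc_update[OF s t' not_drawn]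
    error_update[OF s t' not_drawn]
  have "corrected_error s t (Z(Fresh s (Suc t) i := z)) = corrected_error s t Z" for Z z i
    by (simp add: corrected_error_def update)
  then have "second_moment \<Omega> (error s (Suc t))
      \<le> second_moment \<Omega> (corrected_error s t) + ennreal ((1 - \<beta>)\<^sup>2 * \<sigma>\<^sup>2 / real bh)"
    unfolding error_Suc_eq using s t batch_sizes
    by (intro second_moment_add_gradient_noise_le iterate_in_edom borel_measurable_corrected_error
        borel_measurable_iterate_Suc update)
      (auto simp: sample_labels_def inj_on_def)
  also have "\<dots> \<le> (ennreal (\<beta>\<^sup>2) * second_moment \<Omega> (error s t)
      + ennreal (\<beta>\<^sup>2 * L\<^sup>2 / real b * (\<gamma> t)\<^sup>2) * second_moment \<Omega> (direction s t))
      + ennreal ((1 - \<beta>)\<^sup>2 * \<sigma>\<^sup>2 / real bh)"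
    by (intro add_right_mono second_moment_corrected_error_le s t)
  finally show ?thesis .
qed

end

section \<open>Expected descent over all stages\<close>

context hsgd_rs
begin

lemma square_integrable_grad_map_iterate:
  assumes s: "s \<in> {1..S}" and t: "t \<le> m" and X: "square_integrable \<Omega> (iterate s t)"
  shows "square_integrable \<Omega> (\<lambda>Z. grad_map f \<psi> \<eta> (iterate s t Z))"
proof (rule square_integrable_bound)
  let ?h = "\<lambda>Z. norm (grad_map f \<psi> \<eta> xb0) + (2 / \<eta> + L) *\<^sub>R norm (iterate s t Z + - xb0)"
  show "square_integrable \<Omega> ?h"
    by (intro square_integrable_add square_integrable_scaleR square_integrable_norm
        \<Omega>.square_integrable_const X)
  show "(\<lambda>Z. grad_map f \<psi> \<eta> (iterate s t Z)) \<in> borel_measurable \<Omega>"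
    by (rule borel_measurable_grad_map[OF \<eta>(1) borel_measurable_iterate[OF s t]])
  show "norm (grad_map f \<psi> \<eta> (iterate s t Z)) \<le> norm (?h Z)" for Z
    using norm_grad_map_le[OF \<eta>(1) iterate_in_edom xb0_in_edom, of t Z s] t by simp
qed

lemma square_integrable_direction_if:
  assumes s: "s \<in> {1..S}" and t: "t \<le> m" and X: "square_integrable \<Omega> (iterate s t)"
    and e: "square_integrable \<Omega> (error s t)"
  shows "square_integrable \<Omega> (direction s t)"
proof (rule square_integrable_bound)
  let ?G = "\<lambda>Z. grad_map f \<psi> \<eta> (iterate s t Z)"
  let ?h = "\<lambda>Z. \<eta> *\<^sub>R norm (error s t Z) + \<eta> *\<^sub>R norm (?G Z)"
  show "square_integrable \<Omega> ?h"
    by (intro square_integrable_add square_integrable_scaleR square_integrable_norm e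
        square_integrable_grad_map_iterate s t X)
  show "direction s t \<in> borel_measurable \<Omega>" by (rule borel_measurable_direction[OF s t])
  show "norm (direction s t Z) \<le> norm (?h Z)" for Z
    using norm_prox_direction_add_grad_map_le[OF \<eta>(1), of "iterate s t Z" "estimator s t Z"]
      norm_triangle_ineq4[of "direction s t Z + \<eta> *\<^sub>R ?G Z" "\<eta> *\<^sub>R ?G Z"] \<eta>(1)
    by (simp add: direction_def error_def)
qed

lemma square_integrable_iterate_Suc_if:
  assumes "s \<in> {1..S}" "t \<le> m" "square_integrable \<Omega> (iterate s t)" "square_integrable \<Omega> (error s t)"
  shows "square_integrable \<Omega> (iterate s (Suc t))"
  unfolding iterate_Suc
  by (intro square_integrable_add square_integrable_scaleR square_integrable_direction_if assms)

lemma square_integrable_stage: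
  assumes s: "s \<in> {1..S}" and start: "square_integrable \<Omega> (xbar (s - 1))"
  shows "t \<le> m \<Longrightarrow> square_integrable \<Omega> (iterate s t) \<and> square_integrable \<Omega> (error s t)"
proof (induction t)
  case 0
  have "second_moment \<Omega> (error s 0) < \<infinity>"
    using second_moment_error_0[OF s] by (rule le_less_trans) simp
  then show ?case
    using start borel_measurable_error[OF s, of 0] by (simp add: iterate_0 square_integrable_def)
next
  case (Suc t)
  then have t: "t \<le> m" "t < m"
    and IH: "square_integrable \<Omega> (iterate s t)" "square_integrable \<Omega> (error s t)" by auto
  have "square_integrable \<Omega> (direction s t)" by (rule square_integrable_direction_if[OF s t(1) IH])
  with IH have "ennreal (\<beta>\<^sup>2) * second_moment \<Omega> (error s t)
      + ennreal (\<beta>\<^sup>2 * L\<^sup>2 / real b * (\<gamma> t)\<^sup>2) * second_moment \<Omega> (direction s t)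
      + ennreal ((1 - \<beta>)\<^sup>2 * \<sigma>\<^sup>2 / real bh) < \<infinity>"
    by (auto simp: square_integrable_def ennreal_mult_less_top)
  with second_moment_error_Suc[OF s t(2)] have "second_moment \<Omega> (error s (Suc t)) < \<infinity>"
    by (rule le_less_trans)
  then have "square_integrable \<Omega> (error s (Suc t))"
    using borel_measurable_error[OF s Suc.prems] by (simp add: square_integrable_def)
  moreover have "square_integrable \<Omega> (iterate s (Suc t))"
    by (rule square_integrable_iterate_Suc_if[OF s t(1) IH])
  ultimately show ?case by blast
qed

lemma square_integrable_xbar: "s \<le> S \<Longrightarrow> square_integrable \<Omega> (xbar s)"
proof (induction s)
  case (Suc s)
  then show ?case
    unfolding xbar_Suc using square_integrable_stage[of "Suc s" m]
    by (intro square_integrable_iterate_Suc_if) auto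
qed (simp add: \<Omega>.square_integrable_const)

lemma
  assumes s: "s \<in> {1..S}" and t: "t \<le> m"
  shows square_integrable_error: "square_integrable \<Omega> (error s t)"
    and square_integrable_direction: "square_integrable \<Omega> (direction s t)"
    and square_integrable_grad_map: "square_integrable \<Omega> (\<lambda>Z. grad_map f \<psi> \<eta> (iterate s t Z))"
proof -
  have "square_integrable \<Omega> (xbar (s - 1))" using s by (intro square_integrable_xbar) auto
  from square_integrable_stage[OF s this t]
  have X: "square_integrable \<Omega> (iterate s t)" and e: "square_integrable \<Omega> (error s t)" by auto
  show "square_integrable \<Omega> (error s t)" by (rule e)
  show "square_integrable \<Omega> (direction s t)" by (rule square_integrable_direction_if[OF s t X e])
  show "square_integrable \<Omega> (\<lambda>Z. grad_map f \<psi> \<eta> (iterate s t Z))"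
    by (rule square_integrable_grad_map_iterate[OF s t X])
qed

abbreviation mean_square :: "((sample_label \<Rightarrow> 'z) \<Rightarrow> 'a) \<Rightarrow> real" where
  "mean_square g \<equiv> (LINT Z|\<Omega>. (norm (g Z))\<^sup>2)"

lemma mean_square_error_0:
  assumes s: "s \<in> {1..S}"
  shows "mean_square (error s 0) \<le> \<sigma>\<^sup>2 / real bt"
  using second_moment_error_0[OF s]
    second_moment_eq_integral[OF square_integrable_error[OF s, of 0]] by simp

lemma mean_square_error_Suc:
  assumes s: "s \<in> {1..S}" and t: "t < m"
  shows "mean_square (error s (Suc t))
    \<le> \<beta>\<^sup>2 * (mean_square (error s t) + L\<^sup>2 * (\<gamma> t)\<^sup>2 / real b * mean_square (direction s t))
      + (1 - \<beta>)\<^sup>2 * \<sigma>\<^sup>2 / real bh"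
proof -
  have t': "t \<le> m" "Suc t \<le> m" using t by auto
  have "mean_square (error s (Suc t)) \<le> \<beta>\<^sup>2 * mean_square (error s t)
      + \<beta>\<^sup>2 * L\<^sup>2 / real b * (\<gamma> t)\<^sup>2 * mean_square (direction s t) + (1 - \<beta>)\<^sup>2 * \<sigma>\<^sup>2 / real bh"
    using second_moment_error_Suc[OF s t]
    unfolding second_moment_eq_integral[OF square_integrable_error[OF s t'(1)]]
      second_moment_eq_integral[OF square_integrable_error[OF s t'(2)]]
      second_moment_eq_integral[OF square_integrable_direction[OF s t'(1)]]
    by (simp flip: ennreal_mult ennreal_plus)
  then show ?thesis by (simp add: algebra_simps)
qed

definition step_gain :: "nat \<Rightarrow> nat \<Rightarrow> (sample_label \<Rightarrow> 'z) \<Rightarrow> real" where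
  "step_gain s t Z = L * \<eta>\<^sup>2 / 4 * \<gamma> t * (norm (grad_map f \<psi> \<eta> (iterate s t Z)))\<^sup>2
    + \<gamma> t / 2 * (\<delta> - L * \<gamma> t) * (norm (direction s t Z))\<^sup>2
    - error_weight * \<gamma> t * (norm (error s t Z))\<^sup>2"

lemma step_gain_le: "t \<le> m \<Longrightarrow> step_gain s t Z \<le> \<Phi> (iterate s t Z) - \<Phi> (iterate s (Suc t) Z)"
  using prox_gradient_step_descent[OF \<eta>(1) _ _ iterate_in_edom, of "\<gamma> t" t Z s "estimator s t Z"]
    \<gamma>_range[of t]
  unfolding step_gain_def error_weight_def iterate_Suc direction_def error_def by (simp add: \<delta>)

definition initial_gap :: real where "initial_gap = \<Phi> xb0 - \<Phi>\<^sub>m\<^sub>i\<^sub>n"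

lemma initial_gap_nonneg: "0 \<le> initial_gap"
  using \<Phi>_ge[OF xb0_in_edom] by (simp add: initial_gap_def)

lemma sum_step_gain_le: "(\<Sum>s=1..S. \<Sum>t\<le>m. step_gain s t Z) \<le> initial_gap"
proof -
  have "(\<Sum>t\<le>m. step_gain s t Z) \<le> \<Phi> (xbar (s - 1) Z) - \<Phi> (xbar s Z)" if "s \<in> {1..S}" for s
  proof -
    have "(\<Sum>t\<le>m. step_gain s t Z) \<le> (\<Sum>t\<le>m. \<Phi> (iterate s t Z) - \<Phi> (iterate s (Suc t) Z))"
      by (intro sum_mono step_gain_le) simp
    also have "\<dots> = \<Phi> (iterate s 0 Z) - \<Phi> (iterate s (Suc m) Z)"
      using sum_telescope[of "\<lambda>t. \<Phi> (iterate s t Z)" m] by simp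
    also have "iterate s (Suc m) Z = xbar s Z"
      using that xbar_Suc[where s = "s - 1" and Z = Z] by (simp del: rs_xbar.simps)
    finally show ?thesis by (simp only: iterate_0)
  qed
  then have "(\<Sum>s=1..S. \<Sum>t\<le>m. step_gain s t Z) \<le> (\<Sum>s=1..S. \<Phi> (xbar (s - 1) Z) - \<Phi> (xbar s Z))"
    by (rule sum_mono)
  also have "\<dots> = \<Phi> (xbar 0 Z) - \<Phi> (xbar S Z)" by (induction S) simp_all
  also have "\<dots> \<le> initial_gap"
    using \<Phi>_ge[OF xbar_in_edom[where s = S and Z = Z]] by (simp add: initial_gap_def)
  finally show ?thesis .
qed

lemma
  assumes s: "s \<in> {1..S}" and t: "t \<le> m"
  shows integrable_step_gain: "integrable \<Omega> (step_gain s t)"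
    and integral_step_gain: "(LINT Z|\<Omega>. step_gain s t Z)
      = L * \<eta>\<^sup>2 / 4 * \<gamma> t * mean_square (\<lambda>Z. grad_map f \<psi> \<eta> (iterate s t Z))
        + \<gamma> t / 2 * (\<delta> - L * \<gamma> t) * mean_square (direction s t)
        - error_weight * \<gamma> t * mean_square (error s t)"
  using square_integrable_integrable[OF square_integrable_grad_map[OF s t]]
    square_integrable_integrable[OF square_integrable_direction[OF s t]]
    square_integrable_integrable[OF square_integrable_error[OF s t]]
  unfolding step_gain_def by simp_all

lemma expected_stage_gain_ge:
  assumes s: "s \<in> {1..S}"
  shows "(\<Sum>t\<le>m. LINT Z|\<Omega>. step_gain s t Z)
    \<ge> L * \<eta>\<^sup>2 / 4 * (\<Sum>t\<le>m. \<gamma> t * mean_square (\<lambda>Z. grad_map f \<psi> \<eta> (iterate s t Z)))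
      - 2 * noise_level * \<sigma>\<^sup>2 / L * (\<Sum>t\<le>m. \<gamma> t)"
proof -
  have "error_weight * (\<Sum>t\<le>m. \<gamma> t * mean_square (error s t))
      \<le> (\<Sum>t\<le>m. \<gamma> t / 2 * (\<delta> - L * \<gamma> t) * mean_square (direction s t))
        + 2 * noise_level * \<sigma>\<^sup>2 / L * (\<Sum>t\<le>m. \<gamma> t)"
    by (intro weighted_error_le mean_square_error_0 mean_square_error_Suc s) auto
  moreover have "(\<Sum>t\<le>m. LINT Z|\<Omega>. step_gain s t Z)
      = (\<Sum>t\<le>m. L * \<eta>\<^sup>2 / 4 * \<gamma> t * mean_square (\<lambda>Z. grad_map f \<psi> \<eta> (iterate s t Z))
        + \<gamma> t / 2 * (\<delta> - L * \<gamma> t) * mean_square (direction s t)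
        - error_weight * \<gamma> t * mean_square (error s t))"
    using integral_step_gain[OF s] by (intro sum.cong) auto
  ultimately show ?thesis
    by (simp add: sum.distrib sum_subtractf sum_distrib_left mult.assoc)
qed

lemma weighted_expected_grad_map_le:
  "L * \<eta>\<^sup>2 / 4 * (\<Sum>s=1..S. \<Sum>t\<le>m. \<gamma> t * mean_square (\<lambda>Z. grad_map f \<psi> \<eta> (iterate s t Z)))
    \<le> initial_gap + real S * (2 * noise_level * \<sigma>\<^sup>2 / L * (\<Sum>t\<le>m. \<gamma> t))"
proof -
  have stage: "integrable \<Omega> (\<lambda>Z. \<Sum>t\<le>m. step_gain s t Z)"
    "(LINT Z|\<Omega>. (\<Sum>t\<le>m. step_gain s t Z)) = (\<Sum>t\<le>m. LINT Z|\<Omega>. step_gain s t Z)"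
    if "s \<in> {1..S}" for s
    using integrable_step_gain[OF that] by auto
  have "(\<Sum>s=1..S. L * \<eta>\<^sup>2 / 4 * (\<Sum>t\<le>m. \<gamma> t * mean_square (\<lambda>Z. grad_map f \<psi> \<eta> (iterate s t Z)))
        - 2 * noise_level * \<sigma>\<^sup>2 / L * (\<Sum>t\<le>m. \<gamma> t))
      \<le> (\<Sum>s=1..S. LINT Z|\<Omega>. (\<Sum>t\<le>m. step_gain s t Z))"
    using expected_stage_gain_ge by (intro sum_mono) (simp add: stage(2))
  also have "\<dots> = (LINT Z|\<Omega>. (\<Sum>s=1..S. \<Sum>t\<le>m. step_gain s t Z))"
    by (rule Bochner_Integration.integral_sum[symmetric]) (rule stage(1))
  also have "\<dots> \<le> initial_gap"
    by (intro \<Omega>.integral_le_const Bochner_Integration.integrable_sum stage(1) AE_I2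
        sum_step_gain_le)
  finally show ?thesis by (simp add: sum_subtractf sum_distrib_left)
qed

end

section \<open>Random output and complexity\<close>

lemma num_prox_divide: "num_prox m (T / (real m + 1)) = T"
  by (simp add: num_prox_def)

context prob_space
begin

lemma Int_stable_vimages: "Int_stable {X -` A \<inter> space M | A. A \<in> sets N}"
proof (rule Int_stableI)
  fix a b assume "a \<in> {X -` A \<inter> space M | A. A \<in> sets N}" "b \<in> {X -` A \<inter> space M | A. A \<in> sets N}"
  then obtain A B where "a = X -` A \<inter> space M" "b = X -` B \<inter> space M" "A \<in> sets N" "B \<in> sets N"
    by auto
  then show "a \<inter> b \<in> {X -` A \<inter> space M | A. A \<in> sets N}"
    by (intro CollectI exI[of _ "A \<inter> B"]) auto
qed

lemma vimages_compose_subset: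
  assumes X: "random_variable N X" and u: "u \<in> N \<rightarrow>\<^sub>M K"
  shows "{(\<lambda>\<omega>. u (X \<omega>)) -` A \<inter> space M | A. A \<in> sets K} \<subseteq> {X -` A \<inter> space M | A. A \<in> sets N}"
proof safe
  fix A assume "A \<in> sets K"
  then have "u -` A \<inter> space N \<in> sets N" by (rule measurable_sets[OF u])
  moreover have "(\<lambda>\<omega>. u (X \<omega>)) -` A \<inter> space M = X -` (u -` A \<inter> space N) \<inter> space M"
    using measurable_space[OF X] by auto
  ultimately show "\<exists>B. (\<lambda>\<omega>. u (X \<omega>)) -` A \<inter> space M = X -` B \<inter> space M \<and> B \<in> sets N" by blast
qed

context
  fixes X :: "'a \<Rightarrow> 'c" and Y :: "'a \<Rightarrow> 'd" and N K
  assumes X: "random_variable N X" and Y: "random_variable K Y"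
    and indep_vimages: "indep_set {X -` A \<inter> space M | A. A \<in> sets N}
      {Y -` B \<inter> space M | B. B \<in> sets K}"
begin

lemma indep_var_compose_if_indep_vimages:
  assumes u: "u \<in> N \<rightarrow>\<^sub>M N'" and v: "v \<in> K \<rightarrow>\<^sub>M K'"
  shows "indep_var N' (\<lambda>\<omega>. u (X \<omega>)) K' (\<lambda>\<omega>. v (Y \<omega>))"
proof -
  have "indep_set {(\<lambda>\<omega>. u (X \<omega>)) -` A \<inter> space M | A. A \<in> sets N'}
      {(\<lambda>\<omega>. v (Y \<omega>)) -` B \<inter> space M | B. B \<in> sets K'}"
    using indep_vimages vimages_compose_subset[OF X u] vimages_compose_subset[OF Y v]
    unfolding indep_sets2_eq by (meson subset_trans subsetD)
  then show ?thesis
    unfolding indep_var_eq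
    by (intro conjI indep_set_sigma_sets Int_stable_vimages measurable_compose[OF X u]
        measurable_compose[OF Y v])
qed

lemma
  fixes g :: "'c \<Rightarrow> real"
  assumes B: "B \<in> sets K" and g: "integrable (distr M N X) g"
  shows integrable_indep_mult_indicator: "integrable M (\<lambda>\<omega>. g (X \<omega>) * indicator B (Y \<omega>))"
    and expectation_indep_mult_indicator: "expectation (\<lambda>\<omega>. g (X \<omega>) * indicator B (Y \<omega>))
      = (LINT z|distr M N X. g z) * prob (Y -` B \<inter> space M)"
proof -
  have g_meas: "g \<in> borel_measurable N" using g by auto
  have gX: "integrable M (\<lambda>\<omega>. g (X \<omega>))" using g integrable_distr_eq[OF X g_meas] by simp
  have event: "Y -` B \<inter> space M \<in> events" by (rule measurable_sets[OF Y B])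
  have "indicator B (Y \<omega>) = (indicator (Y -` B \<inter> space M) \<omega> :: real)" if "\<omega> \<in> space M" for \<omega>
    using that by (simp add: indicator_def)
  note indicator_eq = Bochner_Integration.integrable_cong[OF refl this]
    Bochner_Integration.integral_cong[OF refl this]
  have indicator: "integrable M (\<lambda>\<omega>. indicator B (Y \<omega>) :: real)"
    using event by (subst indicator_eq(1)) (auto simp: emeasure_eq_measure)
  have indep: "indep_var borel (\<lambda>\<omega>. g (X \<omega>)) borel (\<lambda>\<omega>. indicator B (Y \<omega>) :: real)"
    by (rule indep_var_compose_if_indep_vimages[OF g_meas borel_measurable_indicator[OF B]])
  show "integrable M (\<lambda>\<omega>. g (X \<omega>) * indicator B (Y \<omega>))"
    by (rule indep_var_integrable[OF indep gX indicator])
  have "expectation (\<lambda>\<omega>. g (X \<omega>) * indicator B (Y \<omega>))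
      = expectation (\<lambda>\<omega>. g (X \<omega>)) * expectation (\<lambda>\<omega>. indicator B (Y \<omega>))"
    by (rule indep_var_lebesgue_integral[OF indep gX indicator])
  also have "expectation (\<lambda>\<omega>. g (X \<omega>)) = (LINT z|distr M N X. g z)"
    by (rule integral_distr[OF X g_meas, symmetric])
  also have "expectation (\<lambda>\<omega>. indicator B (Y \<omega>)) = prob (Y -` B \<inter> space M)"
    by (subst indicator_eq(2)) (simp_all add: Bochner_Integration.integral_indicator Int_assoc)
  finally show "expectation (\<lambda>\<omega>. g (X \<omega>) * indicator B (Y \<omega>))
      = (LINT z|distr M N X. g z) * prob (Y -` B \<inter> space M)" .
qed

end

context
  fixes X :: "'a \<Rightarrow> 'c" and J :: "'a \<Rightarrow> 'j" and N K and g :: "'j \<Rightarrow> 'c \<Rightarrow> real"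
  assumes X: "random_variable N X" and J: "random_variable (count_space K) J"
    and indep: "indep_set {X -` A \<inter> space M | A. A \<in> sets N}
      {J -` B \<inter> space M | B. B \<in> sets (count_space K)}"
    and K: "finite K" and g: "\<And>j. j \<in> K \<Longrightarrow> integrable (distr M N X) (g j)"
begin

lemma eq_sum_mult_indicator_index:
  assumes "\<omega> \<in> space M"
  shows "g (J \<omega>) (X \<omega>) = (\<Sum>j\<in>K. g j (X \<omega>) * indicator {j} (J \<omega>))"
  using K measurable_space[OF J assms] by (simp add: indicator_def if_distrib cong: if_cong)

lemma integrable_mult_indicator_index:
  "j \<in> K \<Longrightarrow> integrable M (\<lambda>\<omega>. g j (X \<omega>) * indicator {j} (J \<omega>))"
  using g by (intro integrable_indep_mult_indicator[OF X J indep]) auto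

lemma integrable_at_indep_index: "integrable M (\<lambda>\<omega>. g (J \<omega>) (X \<omega>))"
  using integrable_mult_indicator_index
  by (subst Bochner_Integration.integrable_cong[OF refl eq_sum_mult_indicator_index]) auto

lemma expectation_at_indep_index:
  "expectation (\<lambda>\<omega>. g (J \<omega>) (X \<omega>))
    = (\<Sum>j\<in>K. (LINT z|distr M N X. g j z) * prob {\<omega> \<in> space M. J \<omega> = j})"
proof -
  have "expectation (\<lambda>\<omega>. g (J \<omega>) (X \<omega>))
      = expectation (\<lambda>\<omega>. \<Sum>j\<in>K. g j (X \<omega>) * indicator {j} (J \<omega>))"
    by (rule Bochner_Integration.integral_cong[OF refl eq_sum_mult_indicator_index])
  also have "\<dots> = (\<Sum>j\<in>K. expectation (\<lambda>\<omega>. g j (X \<omega>) * indicator {j} (J \<omega>)))"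
    using integrable_mult_indicator_index by (rule Bochner_Integration.integral_sum)
  also have "\<dots> = (\<Sum>j\<in>K. (LINT z|distr M N X. g j z) * prob {\<omega> \<in> space M. J \<omega> = j})"
  proof (rule sum.cong)
    fix j assume j: "j \<in> K"
    have "J -` {j} \<inter> space M = {\<omega> \<in> space M. J \<omega> = j}" by auto
    then show "expectation (\<lambda>\<omega>. g j (X \<omega>) * indicator {j} (J \<omega>))
        = (LINT z|distr M N X. g j z) * prob {\<omega> \<in> space M. J \<omega> = j}"
      using expectation_indep_mult_indicator[OF X J indep _ g[OF j], of "{j}"] j by simp
  qed simp
  finally show ?thesis .
qed

end

end

locale hsgd_rs_output = hsgd_rs \<psi> P fs f L \<sigma> \<eta> \<delta> \<beta> \<gamma> m b bh bt S xb0 \<Phi>\<^sub>m\<^sub>i\<^sub>n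
  for \<psi> :: "'a::euclidean_space \<Rightarrow> ereal" and P :: "'z measure"
    and fs f L \<sigma> \<eta> \<delta> \<beta> \<gamma> m b bh bt S xb0 \<Phi>\<^sub>m\<^sub>i\<^sub>n +
  fixes M :: "'w measure" and \<xi> :: "sample_label \<Rightarrow> 'w \<Rightarrow> 'z" and J :: "'w \<Rightarrow> nat \<times> nat"
    and xT :: "'w \<Rightarrow> 'a"
  assumes S_pos: "1 \<le> S"
    and prob_space_M: "prob_space M"
    and samples_indep: "prob_space.indep_vars M (\<lambda>_. P) \<xi> (sample_labels S m bt b bh)"
    and samples_law: "\<And>l. l \<in> sample_labels S m bt b bh \<Longrightarrow> distr M P (\<xi> l) = P"
    and J_measurable: "J \<in> M \<rightarrow>\<^sub>M count_space ({1..S} \<times> {0..m})"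
    and J_law: "\<And>s t. s \<in> {1..S} \<Longrightarrow> t \<in> {0..m} \<Longrightarrow>
        measure M {\<omega> \<in> space M. J \<omega> = (s, t)} = \<gamma> t / (real S * (\<Sum>t=0..m. \<gamma> t))"
    and J_indep: "prob_space.indep_set M
        {(\<lambda>\<omega>. \<lambda>l\<in>sample_labels S m bt b bh. \<xi> l \<omega>) -` A \<inter> space M | A.
            A \<in> sets (PiM (sample_labels S m bt b bh) (\<lambda>_. P))}
        {J -` B \<inter> space M | B. B \<in> sets (count_space ({1..S} \<times> {0..m}))}"
    and xT: "\<And>\<omega>. xT \<omega> =
        rs_iterate fs \<psi> \<eta> \<beta> \<gamma> m bt b bh (\<lambda>l. \<xi> l \<omega>) xb0 (fst (J \<omega>)) (snd (J \<omega>))"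
begin

sublocale M: prob_space M
  by (rule prob_space_M)

definition samples :: "'w \<Rightarrow> sample_label \<Rightarrow> 'z" where
  "samples \<omega> = (\<lambda>l\<in>labels. \<xi> l \<omega>)"

lemma measurable_samples: "samples \<in> M \<rightarrow>\<^sub>M \<Omega>"
  unfolding samples_def using samples_indep
  by (intro measurable_restrict) (auto simp: M.indep_vars_def2)

lemma distr_samples: "distr M \<Omega> samples = \<Omega>"
proof -
  have "Init 1 0 \<in> labels" using batch_sizes S_pos by (auto simp: sample_labels_def)
  moreover have "\<xi> l \<in> M \<rightarrow>\<^sub>M P" if "l \<in> labels" for l
    using samples_indep that by (auto simp: M.indep_vars_def2)
  ultimately have "distr M \<Omega> samples = PiM labels (\<lambda>l. distr M P (\<xi> l))"
    using samples_indep M.indep_vars_iff_distr_eq_PiM'[of labels \<xi> "\<lambda>_. P"]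
    unfolding samples_def by auto
  also have "\<dots> = \<Omega>" using samples_law by (intro PiM_cong) auto
  finally show ?thesis .
qed

lemma indep_samples_J: "M.indep_set {samples -` A \<inter> space M | A. A \<in> sets \<Omega>}
    {J -` B \<inter> space M | B. B \<in> sets (count_space ({1..S} \<times> {0..m}))}"
  using J_indep unfolding samples_def[abs_def] .

lemma xT_eq_iterate: "\<omega> \<in> space M \<Longrightarrow> xT \<omega> = iterate (fst (J \<omega>)) (snd (J \<omega>)) (samples \<omega>)"
proof -
  assume "\<omega> \<in> space M"
  then have "J \<omega> \<in> {1..S} \<times> {0..m}" using measurable_space[OF J_measurable] by simp
  then show ?thesis
    unfolding xT by (intro iterate_cong) (auto simp: samples_def drawn_def)
qed

lemma
  shows integrable_output: "integrable M (\<lambda>\<omega>. (norm (grad_map f \<psi> \<eta> (xT \<omega>)))\<^sup>2)"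
    and expected_output: "(LINT \<omega>|M. (norm (grad_map f \<psi> \<eta> (xT \<omega>)))\<^sup>2)
      = (\<Sum>s=1..S. \<Sum>t\<le>m. \<gamma> t * mean_square (\<lambda>Z. grad_map f \<psi> \<eta> (iterate s t Z)))
        / (real S * (\<Sum>t\<le>m. \<gamma> t))"
proof -
  let ?K = "{1..S} \<times> {0..m}"
  let ?g = "\<lambda>j Z. (norm (grad_map f \<psi> \<eta> (iterate (fst j) (snd j) Z)))\<^sup>2"
  have g: "integrable (distr M \<Omega> samples) (?g j)" if "j \<in> ?K" for j
    unfolding distr_samples using that
    by (intro square_integrable_integrable square_integrable_grad_map) auto
  have output_eq: "(norm (grad_map f \<psi> \<eta> (xT \<omega>)))\<^sup>2 = ?g (J \<omega>) (samples \<omega>)" if "\<omega> \<in> space M" for \<omega>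
    by (simp add: xT_eq_iterate that)
  show "integrable M (\<lambda>\<omega>. (norm (grad_map f \<psi> \<eta> (xT \<omega>)))\<^sup>2)"
    using M.integrable_at_indep_index[where g = ?g,
        OF measurable_samples J_measurable indep_samples_J _ g]
    by (subst Bochner_Integration.integrable_cong[OF refl output_eq]) auto
  have "(LINT \<omega>|M. (norm (grad_map f \<psi> \<eta> (xT \<omega>)))\<^sup>2) = (LINT \<omega>|M. ?g (J \<omega>) (samples \<omega>))"
    by (rule Bochner_Integration.integral_cong[OF refl output_eq])
  also have "\<dots> = (\<Sum>j\<in>?K. (LINT Z|\<Omega>. ?g j Z) * M.prob {\<omega> \<in> space M. J \<omega> = j})"
    using M.expectation_at_indep_index[where g = ?g,
        OF measurable_samples J_measurable indep_samples_J _ g]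
    unfolding distr_samples by simp
  also have "\<dots> = (\<Sum>s=1..S. \<Sum>t\<le>m. mean_square (\<lambda>Z. grad_map f \<psi> \<eta> (iterate s t Z))
      * (\<gamma> t / (real S * (\<Sum>t\<le>m. \<gamma> t))))"
    unfolding atMost_atLeast0 sum.cartesian_product
    by (intro sum.cong) (auto simp: J_law)
  finally show "(LINT \<omega>|M. (norm (grad_map f \<psi> \<eta> (xT \<omega>)))\<^sup>2)
      = (\<Sum>s=1..S. \<Sum>t\<le>m. \<gamma> t * mean_square (\<lambda>Z. grad_map f \<psi> \<eta> (iterate s t Z)))
        / (real S * (\<Sum>t\<le>m. \<gamma> t))"
    by (simp add: sum_divide_distrib mult.commute)
qed

lemma expected_output_le:
  "(LINT \<omega>|M. (norm (grad_map f \<psi> \<eta> (xT \<omega>)))\<^sup>2)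
    \<le> 4 * sqrt 2 * (L + damping_scale) / (L * \<eta>\<^sup>2 * \<delta> * real S * (real m + 1)) * initial_gap
      + 8 * \<sigma>\<^sup>2 / (L\<^sup>2 * \<eta>\<^sup>2) * noise_level" (is "?E \<le> _")
proof -
  let ?\<Sigma> = "\<Sum>t\<le>m. \<gamma> t"
  note pos = sum_\<gamma>_pos L \<eta>(1) \<delta>_pos S_pos
  have inverse_sum_le: "1 / ?\<Sigma> \<le> sqrt 2 * (L + damping_scale) / ((real m + 1) * \<delta>)"
    using sum_\<gamma>_lower_bound pos by (simp add: pos_divide_le_eq pos_le_divide_eq)
  have "L * \<eta>\<^sup>2 / 4 * (?E * (real S * ?\<Sigma>))
      \<le> initial_gap + real S * (2 * noise_level * \<sigma>\<^sup>2 / L * ?\<Sigma>)"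
    using weighted_expected_grad_map_le pos by (simp add: expected_output)
  then have "?E \<le> (initial_gap + real S * (2 * noise_level * \<sigma>\<^sup>2 / L * ?\<Sigma>))
      * (4 / (L * \<eta>\<^sup>2 * (real S * ?\<Sigma>)))"
    using pos by (simp add: field_simps)
  also have "\<dots> = 4 / (L * \<eta>\<^sup>2 * real S) * initial_gap * (1 / ?\<Sigma>)
      + 8 * \<sigma>\<^sup>2 / (L\<^sup>2 * \<eta>\<^sup>2) * noise_level"
    using pos by (simp add: field_simps power2_eq_square)
  also have "4 / (L * \<eta>\<^sup>2 * real S) * initial_gap * (1 / ?\<Sigma>)
      \<le> 4 / (L * \<eta>\<^sup>2 * real S) * initial_gap * (sqrt 2 * (L + damping_scale) / ((real m + 1) * \<delta>))"
    using inverse_sum_le initial_gap_nonneg pos by (intro mult_left_mono) auto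
  also have "\<dots> = 4 * sqrt 2 * (L + damping_scale) / (L * \<eta>\<^sup>2 * \<delta> * real S * (real m + 1))
      * initial_gap"
    by (simp add: mult_ac)
  finally show ?thesis by simp
qed

lemma expected_output_le_quarter_powers:
  "(LINT \<omega>|M. (norm (grad_map f \<psi> \<eta> (xT \<omega>)))\<^sup>2)
    \<le> 8 * sqrt 2 * (real bh powr (1/4) * sqrt (real b) * L
          + (real bt * (real m + 1)) powr (1/4) * sqrt (L * \<delta>))
        / (L * \<eta>\<^sup>2 * \<delta> * real S * (real m + 1) * real bh powr (1/4) * sqrt (real b))
        * initial_gap
      + 8 * \<sigma>\<^sup>2 / (L\<^sup>2 * \<eta>\<^sup>2 * sqrt (real bh * real bt * (real m + 1)))"
proof -
  define u where "u = real bh powr (1/4) * sqrt (real b)"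
  define v where "v = (real bt * (real m + 1)) powr (1/4) * sqrt (L * \<delta>)"
  define c where "c = L * \<eta>\<^sup>2 * \<delta> * real S * (real m + 1)"
  have "0 < u" using batch_sizes by (simp add: u_def)
  have "0 \<le> damping_scale" using L \<delta>_pos \<beta>_bounds by (simp add: damping_scale_def)
  have factor_eq: "8 * sqrt 2 * (L + damping_scale) / c = 8 * sqrt 2 * (u * L + v) / (c * u)"
  proof -
    have "L + damping_scale = (u * L + v) / u"
      using \<open>0 < u\<close> damping_scale_eq unfolding u_def[symmetric] v_def[symmetric]
      by (simp add: field_simps)
    then show ?thesis by simp
  qed
  note expected_output_le[folded c_def]
  also have "4 * sqrt 2 * (L + damping_scale) / c * initial_gap
      \<le> 8 * sqrt 2 * (L + damping_scale) / c * initial_gap"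
    using initial_gap_nonneg \<open>0 \<le> damping_scale\<close> L \<delta>_pos
    by (intro mult_right_mono divide_right_mono) (auto simp: c_def)
  finally show ?thesis
    unfolding factor_eq by (simp add: noise_level_def u_def v_def c_def mult.assoc)
qed

lemma expected_output_le_if_enough_stages:
  assumes "hsgd_tuned_parameters L \<eta> \<delta> \<beta> \<gamma> m b bh bt \<sigma> \<epsilon> c\<^sub>1"
    and stages: "real_of_int \<lfloor>iteration_factor \<sigma> \<epsilon> * initial_gap\<rfloor> / (real m + 1) \<le> real S"
  shows "(LINT \<omega>|M. (norm (grad_map f \<psi> \<eta> (xT \<omega>)))\<^sup>2) \<le> \<epsilon>\<^sup>2"
proof -
  interpret tuned: hsgd_tuned_parameters L \<eta> \<delta> \<beta> \<gamma> m b bh bt \<sigma> \<epsilon> c\<^sub>1 by (rule assms(1))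
  define N where "N = real S * (real m + 1)"
  have "1 * 1 \<le> N" unfolding N_def using S_pos by (intro mult_mono) auto
  moreover have "real_of_int \<lfloor>iteration_factor \<sigma> \<epsilon> * initial_gap\<rfloor> \<le> N"
    using stages by (simp add: pos_divide_le_eq N_def)
  ultimately have iterations: "0 < N" "iteration_factor \<sigma> \<epsilon> * initial_gap \<le> 2 * N" by linarith+
  have "4 * sqrt 2 * (L + damping_scale) / (L * \<eta>\<^sup>2 * \<delta>) * (initial_gap / N)
      \<le> iteration_factor \<sigma> \<epsilon> * (\<epsilon>\<^sup>2 / 3) * (initial_gap / N)"
    using tuned.optimization_factor_le initial_gap_nonneg iterations(1)
    by (intro mult_right_mono) auto
  also have "\<dots> = (iteration_factor \<sigma> \<epsilon> * initial_gap) * (\<epsilon>\<^sup>2 / (3 * N))" by simp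
  also have "\<dots> \<le> 2 * N * (\<epsilon>\<^sup>2 / (3 * N))"
    using iterations by (intro mult_right_mono) auto
  also have "\<dots> = 2 / 3 * \<epsilon>\<^sup>2" using iterations(1) by simp
  finally have "4 * sqrt 2 * (L + damping_scale) / (L * \<eta>\<^sup>2 * \<delta> * real S * (real m + 1))
      * initial_gap \<le> 2 / 3 * \<epsilon>\<^sup>2"
    by (simp add: N_def mult.assoc)
  then show ?thesis using expected_output_le tuned.noise_le by linarith
qed

lemma complexity:
  assumes "hsgd_tuned_parameters L \<eta> \<delta> \<beta> \<gamma> m b bh bt \<sigma> \<epsilon> c\<^sub>1"
  shows "let T = \<lfloor>96 * sqrt 3 * max 1 \<sigma> / (\<eta> ^ 3 * L * sqrt (L * \<delta>) * real b * \<epsilon> ^ 3)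
            * initial_gap\<rfloor>;
      Tgrad = \<lfloor>(c\<^sub>1\<^sup>2 + 3) * (96 * sqrt 3 * max 1 \<sigma> / (\<eta> ^ 3 * L * sqrt (L * \<delta>) * \<epsilon> ^ 3))
            * initial_gap\<rfloor>;
      S\<epsilon> = real_of_int T / (real m + 1)
    in (S\<epsilon> \<le> real S \<longrightarrow> (LINT \<omega>|M. (norm (grad_map f \<psi> \<eta> (xT \<omega>)))\<^sup>2) \<le> \<epsilon>\<^sup>2)
      \<and> num_prox m S\<epsilon> = real_of_int T \<and> \<lfloor>num_grad bt b m S\<epsilon>\<rfloor> \<le> Tgrad"
proof -
  interpret tuned: hsgd_tuned_parameters L \<eta> \<delta> \<beta> \<gamma> m b bh bt \<sigma> \<epsilon> c\<^sub>1 by (rule assms)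
  show ?thesis
    unfolding Let_def num_prox_divide iteration_factor_def[symmetric]
    by (intro conjI impI refl floor_mono tuned.num_grad_floor_le
        expected_output_le_if_enough_stages[OF assms])
qed

end

theorem theorem5:
  fixes P :: "'z measure"
    and fs :: "'z \<Rightarrow> 'a::euclidean_space \<Rightarrow> real"
    and f :: "'a \<Rightarrow> real"
    and \<psi> F :: "'a \<Rightarrow> ereal"
    and Fstar :: ereal
    and L \<sigma> \<eta> \<delta> \<beta> \<Sigma>m :: real
    and \<gamma> :: "nat \<Rightarrow> real"
    and m S b bh bt :: nat
    and xb0 :: 'a
    and M :: "'w measure"
    and \<xi> :: "sample_label \<Rightarrow> 'w \<Rightarrow> 'z"
    and J :: "'w \<Rightarrow> nat \<times> nat"
    and xT :: "'w \<Rightarrow> 'a"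
  assumes P: "prob_space P"
    and smooth: "\<And>z. z \<in> space P \<Longrightarrow> C1_fun (fs z)"
    and f_int: "\<And>x. integrable P (\<lambda>z. fs z x)"
    and f_def: "\<And>x. f x = (LINT z|P. fs z x)"
    and f_diff: "\<And>x. f differentiable (at x)"
    and grad_int: "\<And>x. integrable P (\<lambda>z. grad (fs z) x)"
    and unbiased: "\<And>x. (LINT z|P. grad (fs z) x) = grad f x"
    and F_def: "\<And>x. F x = ereal (f x) + \<psi> x"
    and Fstar_def: "Fstar = (INF x. F x)"
    and A1: "proper_fun \<psi>" "closed_fun \<psi>" "convex_fun \<psi>" "edom F \<noteq> {}" "Fstar > -\<infinity>"
    and L_pos: "L > 0"
    and A2: "\<And>x y. x \<in> edom F \<Longrightarrow> y \<in> edom F \<Longrightarrow>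
        (\<integral>\<^sup>+z. ennreal ((norm (grad (fs z) x - grad (fs z) y))\<^sup>2) \<partial>P)
          \<le> ennreal (L\<^sup>2 * (norm (x - y))\<^sup>2)"
    and \<sigma>_nonneg: "\<sigma> \<ge> 0"
    and A3: "\<And>x. x \<in> edom F \<Longrightarrow>
        (\<integral>\<^sup>+z. ennreal ((norm (grad (fs z) x - grad f x))\<^sup>2) \<partial>P) \<le> ennreal (\<sigma>\<^sup>2)"
    and sizes: "b \<ge> 1" "bh \<ge> 1" "bt \<ge> 1" "S \<ge> 1" "bh \<le> bt * (m + 1)"
    and x0: "xb0 \<in> edom F"
    and \<eta>: "0 < \<eta>" "\<eta> < 1 / L"
    and \<delta>: "\<delta> = 2 / \<eta> - 2 * L"
    and \<beta>: "\<beta> = 1 - sqrt (real bh) / sqrt (real bt * (real m + 1))"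
    and \<gamma>_m: "\<gamma> m = \<delta> / L"
    and \<gamma>_t: "\<And>t. t < m \<Longrightarrow> \<gamma> t = \<delta> * real b /
        (L * real b + L * (1 + L\<^sup>2 * \<eta>\<^sup>2) * (\<Sum>k=t+1..m. \<beta> ^ (2 * (k - t)) * \<gamma> k))"
    and \<gamma>_range: "\<And>t. t \<le> m \<Longrightarrow> 0 < \<gamma> t \<and> \<gamma> t \<le> 1"
    and \<Sigma>m: "\<Sigma>m = (\<Sum>t=0..m. \<gamma> t)"
    and M: "prob_space M"
    and samples_indep:
      "prob_space.indep_vars M (\<lambda>_. P) \<xi> (sample_labels S m bt b bh)"
    and samples_law: "\<And>l. l \<in> sample_labels S m bt b bh \<Longrightarrow> distr M P (\<xi> l) = P"
    and J_meas: "J \<in> M \<rightarrow>\<^sub>M count_space ({1..S} \<times> {0..m})"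
    and J_law: "\<And>s t. s \<in> {1..S} \<Longrightarrow> t \<in> {0..m} \<Longrightarrow>
        measure M {\<omega> \<in> space M. J \<omega> = (s, t)} = \<gamma> t / (real S * \<Sigma>m)"
    and J_indep: "prob_space.indep_set M
        {(\<lambda>\<omega>. \<lambda>l\<in>sample_labels S m bt b bh. \<xi> l \<omega>) -` A \<inter> space M | A.
            A \<in> sets (PiM (sample_labels S m bt b bh) (\<lambda>_. P))}
        {J -` B \<inter> space M | B. B \<in> sets (count_space ({1..S} \<times> {0..m}))}"
    and xT: "\<And>\<omega>. xT \<omega> = rs_iterate fs \<psi> \<eta> \<beta> \<gamma> m bt b bh (\<lambda>l. \<xi> l \<omega>) xb0 (fst (J \<omega>)) (snd (J \<omega>))"
  shows
    "integrable M (\<lambda>\<omega>. (norm (grad_map f \<psi> \<eta> (xT \<omega>)))\<^sup>2) \<and>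
     (LINT \<omega>|M. (norm (grad_map f \<psi> \<eta> (xT \<omega>)))\<^sup>2)
       \<le> 8 * sqrt 2 * (real bh powr (1/4) * sqrt (real b) * L
                       + (real bt * (real m + 1)) powr (1/4) * sqrt (L * \<delta>))
           / (L * \<eta>\<^sup>2 * \<delta> * real S * (real m + 1) * real bh powr (1/4) * sqrt (real b))
           * real_of_ereal (F xb0 - Fstar)
         + 8 * \<sigma>\<^sup>2 / (L\<^sup>2 * \<eta>\<^sup>2 * sqrt (real bh * real bt * (real m + 1)))
     \<and>
     (\<forall>\<epsilon> c1 :: real.
        \<epsilon> > 0 \<and> c1 > 1 / (real m + 1) \<and> bh = b
        \<and> real b \<le> 2 * sqrt (6 * \<delta>) / (L * sqrt L * \<eta> * \<epsilon>)
        \<and> real bt = 24 * c1 / (L\<^sup>2 * \<eta>\<^sup>2 * \<epsilon>\<^sup>2) * max (\<sigma>\<^sup>2) 1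
        \<and> real m + 1 = 24 / (c1 * L\<^sup>2 * \<eta>\<^sup>2 * real b * \<epsilon>\<^sup>2) * max (\<sigma>\<^sup>2) 1
        \<longrightarrow>
        (let T = \<lfloor>96 * sqrt 3 * max 1 \<sigma> / (\<eta> ^ 3 * L * sqrt (L * \<delta>) * real b * \<epsilon> ^ 3)
                    * real_of_ereal (F xb0 - Fstar)\<rfloor>;
             Tgrad = \<lfloor>(c1\<^sup>2 + 3) * (96 * sqrt 3 * max 1 \<sigma> / (\<eta> ^ 3 * L * sqrt (L * \<delta>) * \<epsilon> ^ 3))
                    * real_of_ereal (F xb0 - Fstar)\<rfloor>;
             S\<epsilon> = real_of_int T / (real m + 1)
         in (S\<epsilon> \<le> real S \<longrightarrow> (LINT \<omega>|M. (norm (grad_map f \<psi> \<eta> (xT \<omega>)))\<^sup>2) \<le> \<epsilon>\<^sup>2)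
            \<and> num_prox m S\<epsilon> = real_of_int T
            \<and> \<lfloor>num_grad bt b m S\<epsilon>\<rfloor> \<le> Tgrad))"
proof -
  interpret P: prob_space P by (rule P)
  interpret M: prob_space M by (rule M)
  interpret closed_proper_convex \<psi> using A1 by unfold_locales
  have F: "F = (\<lambda>x. ereal (f x) + \<psi> x)" by (rule ext) (rule F_def)
  then have edom_F: "edom F = edom \<psi>" by (simp add: edom_ereal_add)
  obtain \<Phi>min where Fstar: "Fstar = ereal \<Phi>min"
    and \<Phi>min: "\<And>x. x \<in> edom \<psi> \<Longrightarrow> \<Phi>min \<le> f x + \<psi>\<^sub>r x"
    using finite_infimum_composite[of f] A1(5) unfolding Fstar_def F by blast
  interpret hsgd_rs_output \<psi> P fs f L \<sigma> \<eta> \<delta> \<beta> \<gamma> m b bh bt S xb0 \<Phi>min M \<xi> J xT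
    by unfold_locales (fact smooth[unfolded C1_fun_def, THEN conjunct2] f_diff grad_int unbiased
      L_pos A2[unfolded edom_F, folded second_moment_def] A3[unfolded edom_F, folded second_moment_def]
      x0[unfolded edom_F] sizes \<eta> \<delta> \<beta> \<gamma>_m \<gamma>_t \<gamma>_range \<Phi>min samples_indep samples_law
      J_meas J_law[unfolded \<Sigma>m] J_indep xT)+
  have gap: "real_of_ereal (F xb0 - Fstar) = initial_gap"
    by (simp add: F Fstar ereal_add_\<psi> xb0_in_edom initial_gap_def)
  show ?thesis
    unfolding gap
    by (intro conjI allI impI integrable_output expected_output_le_quarter_powers complexity)
      (unfold_locales; blast intro: \<sigma>_nonneg)
qed

end
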